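(* For all positive integers $n$ and nonnegative integers $k$, there is a constant amortised time (CAT) algorithm which exhaustively generates (lists each element exactly once) all elements of $\mathcal{V}(n,k)$, the set of tatami coverings of the $n\times n$ grid that use exactly $n$ monominoes, have monominoes in both top corner cells, and contain exactly $k$ vertical dominoes.
   Context: A tatami covering of a region of the integer grid is a non-overlapping covering of all its unit cells by $1\times 1$ monominoes, $1\times 2$ horizontal dominoes and $2\times 1$ vertical dominoes, such that no point of the grid is a common corner of four distinct tiles. $\mathcal{V}(n,k)$ denotes the tatami coverings of the $n\times n$ grid with exactly $n$ monominoes, placed in the orientation where the top-left and top-right cells are covered by monominoes, and having exactly $k$ vertical dominoes. An exhaustive generation algorithm is CAT (constant amortised time) if, apart from an initialization using $O(n)$ steps, its total running time is proportional to the number of objects it outputs, i.e. it uses $O(1)$ time per generated object on average. *)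

theory Defs
  imports Main
begin

section \<open>Tatami coverings\<close>

text \<open>
  Cells are pairs (row, column), counted from 0, with row 0 at the top and column 0 on the left.
  A tile carries its upper left cell. Grid points use the same coordinates: the upper left
  corner of cell \<open>(r, c)\<close> is the point \<open>(r, c)\<close>.
\<close>

type_synonym cell = "nat \<times> nat"

datatype tile = Mono nat nat | HDom nat nat | VDom nat nat

fun cells :: "tile \<Rightarrow> cell set" where
  "cells (Mono r c) = {(r, c)}"
| "cells (HDom r c) = {(r, c), (r, c + 1)}"
| "cells (VDom r c) = {(r, c), (r + 1, c)}"

fun corners :: "tile \<Rightarrow> (nat \<times> nat) set" where
  "corners (Mono r c) = {r, r + 1} \<times> {c, c + 1}"
| "corners (HDom r c) = {r, r + 1} \<times> {c, c + 2}"
| "corners (VDom r c) = {r, r + 2} \<times> {c, c + 1}"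

definition covering :: "cell set \<Rightarrow> tile set \<Rightarrow> bool" where
  "covering R T \<longleftrightarrow>
     (\<Union>t\<in>T. cells t) = R \<and>
     (\<forall>t\<in>T. \<forall>u\<in>T. t \<noteq> u \<longrightarrow> cells t \<inter> cells u = {})"

definition tatami :: "tile set \<Rightarrow> bool" where
  "tatami T \<longleftrightarrow> \<not> (\<exists>p. \<exists>S\<subseteq>T. card S = 4 \<and> (\<forall>t\<in>S. p \<in> corners t))"

definition grid :: "nat \<Rightarrow> cell set" where
  "grid n = {0..<n} \<times> {0..<n}"

definition V :: "nat \<Rightarrow> nat \<Rightarrow> tile set set" where
  "V n k = {T. covering (grid n) T \<and> tatami T \<and>
               card {(r, c). Mono r c \<in> T} = n \<and>
               Mono 0 0 \<in> T \<and> Mono 0 (n - 1) \<in> T \<and>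
               card {(r, c). VDom r c \<in> T} = k}"


section \<open>Word RAM programs\<close>

text \<open>
  The machine model is a unit-cost word RAM, programmed by while programs over finitely many
  word variables and word arrays. Words have \<open>w\<close> bits: every computed value is reduced
  modulo \<open>2 ^ w\<close>. The exception is subtraction, which is truncated at 0. The command
  \<open>Visit\<close> presents the current machine state as the next generated object.
\<close>

type_synonym vname = string

datatype binop = Add | Sub | Mul | Quot | Rem | Less | Equal

datatype expr =
    Const nat
  | Var vname
  | Elem vname expr
  | Op binop expr expr

datatype com =
    Skip
  | Assign vname expr
  | Store vname expr expr
  | Seq com com
  | If expr com com
  | While expr com
  | Visit

record state =
  vars :: "vname \<Rightarrow> nat"
  arrs :: "vname \<Rightarrow> nat \<Rightarrow> nat"

fun binop_val :: "binop \<Rightarrow> nat \<Rightarrow> nat \<Rightarrow> nat" where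
  "binop_val Add x y = x + y"
| "binop_val Sub x y = x - y"
| "binop_val Mul x y = x * y"
| "binop_val Quot x y = x div y"
| "binop_val Rem x y = x mod y"
| "binop_val Less x y = (if x < y then 1 else 0)"
| "binop_val Equal x y = (if x = y then 1 else 0)"

fun eval_expr :: "nat \<Rightarrow> expr \<Rightarrow> state \<Rightarrow> nat" where
  "eval_expr w (Const m) s = m mod 2 ^ w"
| "eval_expr w (Var x) s = vars s x"
| "eval_expr w (Elem a e) s = arrs s a (eval_expr w e s)"
| "eval_expr w (Op f d e) s = binop_val f (eval_expr w d s) (eval_expr w e s) mod 2 ^ w"

fun expr_cost :: "expr \<Rightarrow> nat" where
  "expr_cost (Const m) = 1"
| "expr_cost (Var x) = 1"
| "expr_cost (Elem a e) = expr_cost e + 1"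
| "expr_cost (Op f d e) = expr_cost d + expr_cost e + 1"

definition set_var :: "vname \<Rightarrow> nat \<Rightarrow> state \<Rightarrow> state" where
  "set_var x v s = s\<lparr>vars := (vars s)(x := v)\<rparr>"

definition set_elem :: "vname \<Rightarrow> nat \<Rightarrow> nat \<Rightarrow> state \<Rightarrow> state" where
  "set_elem a i v s = s\<lparr>arrs := (arrs s)(a := (arrs s a)(i := v))\<rparr>"

text \<open>
  \<open>exec w p s out t s'\<close>: started in state \<open>s\<close>, the program \<open>p\<close> halts in state \<open>s'\<close> after
  \<open>t\<close> steps, and \<open>out\<close> lists the states in which \<open>Visit\<close> was executed.
\<close>

inductive exec :: "nat \<Rightarrow> com \<Rightarrow> state \<Rightarrow> state list \<Rightarrow> nat \<Rightarrow> state \<Rightarrow> bool" for w where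
  Skip: "exec w Skip s [] 1 s"
| Assign: "exec w (Assign x e) s [] (1 + expr_cost e) (set_var x (eval_expr w e s) s)"
| Store: "exec w (Store a d e) s [] (1 + expr_cost d + expr_cost e)
            (set_elem a (eval_expr w d s) (eval_expr w e s) s)"
| Seq: "exec w p s out1 t1 s' \<Longrightarrow> exec w q s' out2 t2 s'' \<Longrightarrow>
          exec w (Seq p q) s (out1 @ out2) (t1 + t2) s''"
| IfTrue: "eval_expr w e s \<noteq> 0 \<Longrightarrow> exec w p s out t s' \<Longrightarrow>
             exec w (If e p q) s out (1 + expr_cost e + t) s'"
| IfFalse: "eval_expr w e s = 0 \<Longrightarrow> exec w q s out t s' \<Longrightarrow>
              exec w (If e p q) s out (1 + expr_cost e + t) s'"
| WhileFalse: "eval_expr w e s = 0 \<Longrightarrow> exec w (While e p) s [] (1 + expr_cost e) s"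
| WhileTrue: "eval_expr w e s \<noteq> 0 \<Longrightarrow> exec w p s out1 t1 s' \<Longrightarrow>
                exec w (While e p) s' out2 t2 s'' \<Longrightarrow>
                exec w (While e p) s (out1 @ out2) (1 + expr_cost e + t1 + t2) s''"
| Visit: "exec w Visit s [s] 1 s"

lemma exec_deterministic:
  "exec w p s out t s' \<Longrightarrow> exec w p s out' t' s'' \<Longrightarrow> (out', t', s'') = (out, t, s')"
proof (induction arbitrary: out' t' s'' rule: exec.induct)
  case (Seq p s out1 t1 s1 q out2 t2 s2)
  from Seq.prems obtain o1 u1 z o2 u2
    where "exec w p s o1 u1 z" "exec w q z o2 u2 s''" "out' = o1 @ o2" "t' = u1 + u2"
    by cases
  with Seq.IH show ?case by blast
next
  case (IfTrue e s p out t s1 q)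
  from IfTrue.prems IfTrue.hyps obtain u
    where "exec w p s out' u s''" "t' = 1 + expr_cost e + u"
    by cases blast+
  with IfTrue.IH show ?case by blast
next
  case (IfFalse e s q out t s1 p)
  from IfFalse.prems IfFalse.hyps obtain u
    where "exec w q s out' u s''" "t' = 1 + expr_cost e + u"
    by cases blast+
  with IfFalse.IH show ?case by blast
next
  case (WhileFalse e s p)
  from WhileFalse.prems WhileFalse.hyps show ?case by cases blast+
next
  case (WhileTrue e s p out1 t1 s1 out2 t2 s2)
  from WhileTrue.prems WhileTrue.hyps obtain o1 u1 z o2 u2
    where "exec w p s o1 u1 z" "exec w (While e p) z o2 u2 s''"
      "out' = o1 @ o2" "t' = 1 + expr_cost e + u1 + u2"
    by cases blast+
  with WhileTrue.IH show ?case by blast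
qed (auto elim: exec.cases)

definition input_state :: "nat \<Rightarrow> nat \<Rightarrow> state" where
  "input_state n k = \<lparr>vars = (\<lambda>_. 0)(''n'' := n, ''k'' := k), arrs = \<lambda>_ _. 0\<rparr>"


section \<open>Constant amortised time generation\<close>

text \<open>
  A list of all tiles of one covering already has length of order \<open>n\<^sup>2\<close>, so a generator with
  \<open>O(n)\<close> initialization and \<open>O(1)\<close> amortised time per object cannot write the coverings out
  one by one. As usual in combinatorial generation, it maintains a data structure for the
  current object and visits it. The data structure is required to give random access to
  the covering in constant time: from a visited state, the program \<open>q\<close>, given a cell in the
  variables \<open>row\<close> and \<open>col\<close>, finds within \<open>d\<close> steps the tile which contains that cell. It returns
  the shape of the tile in \<open>kind\<close> and the upper left cell of the tile in \<open>row\<close> and \<open>col\<close>.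
\<close>

definition result_tile :: "state \<Rightarrow> tile" where
  "result_tile s =
     (if vars s ''kind'' = 0 then Mono else if vars s ''kind'' = 1 then HDom else VDom)
       (vars s ''row'') (vars s ''col'')"

definition represents :: "nat \<Rightarrow> com \<Rightarrow> nat \<Rightarrow> nat \<Rightarrow> state \<Rightarrow> tile set \<Rightarrow> bool" where
  "represents w q d n s T \<longleftrightarrow>
     (\<forall>r<n. \<forall>c<n. \<exists>t s'.
        exec w q (set_var ''row'' r (set_var ''col'' c s)) [] t s' \<and> t \<le> d \<and>
        result_tile s' \<in> T \<and> (r, c) \<in> cells (result_tile s'))"

text \<open>
  On input \<open>n\<close>, \<open>k\<close>, the program \<open>p\<close> visits representations of the elements of \<open>A\<close>, each
  exactly once, and halts after \<open>t\<close> steps.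
\<close>

definition generates ::
  "nat \<Rightarrow> com \<Rightarrow> com \<Rightarrow> nat \<Rightarrow> nat \<Rightarrow> nat \<Rightarrow> tile set set \<Rightarrow> nat \<Rightarrow> bool" where
  "generates w p q d n k A t \<longleftrightarrow>
     (\<exists>out s' Ts. exec w p (input_state n k) out t s' \<and>
        distinct Ts \<and> set Ts = A \<and> list_all2 (represents w q d n) out Ts)"

text \<open>
  The program and all constants are uniform in \<open>n\<close> and \<open>k\<close>. The term \<open>a * n\<close> pays for the
  initialization. Words of \<open>O(log (n + k))\<close> bits have to be sufficient.
\<close>

definition CAT_algorithm :: "com \<Rightarrow> (nat \<Rightarrow> nat \<Rightarrow> tile set set) \<Rightarrow> bool" where
  "CAT_algorithm p F \<longleftrightarrow>
     (\<exists>q a b d e. \<forall>n\<ge>1. \<forall>k w. (n + k + 2) ^ e \<le> 2 ^ w \<longrightarrow>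
        (\<exists>t. generates w p q d n k (F n k) t \<and> t \<le> a * n + b * card (F n k)))"

end

theory Submission
  imports Defs
begin

text \<open>
  Weigh the cells and the interior grid points by suitable sums of distances to the diagonals. Then
  the weight of the monominoes, plus the weighted excess of the points over one adjacent domino
  side, is exactly \<open>n\<close>. A tatami covering has no negative excess, so with \<open>n\<close> monominoes all of these
  lie on the boundary and each interior point is the midpoint of exactly one domino side. Its direction
  is then constant along diagonal strips. Relative to a fixed running bond pattern, the covering is
  given by the sets \<open>A\<close>, \<open>B \<subseteq> {1..n - 2}\<close> of flipped strips in the two diagonal directions. Flipped strips must
  not cross, which means \<open>a + b \<le> n - 2\<close> for all \<open>a \<in> A\<close>, \<open>b \<in> B\<close>. The number of vertical dominoes is \<open>\<Sum>A + \<Sum>B\<close>,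
  or its difference to \<open>n * (n - 1) div 2\<close> if \<open>n\<close> is odd, where the picture has to be transposed.

  The pairs of a fixed weight are generated by reverse search. Moving one element up and
  another one down brings each set to an interval with at most one gap, without changing its sum
  and without raising its maximum. This defines trees of pairs whose nodes have at most eight kids, each
  found and undone in constant time. The roots form a sequence with constant time steps. As each node of a
  tree and each root is an output, the total time is \<open>O(n)\<close> plus a constant for each output.
\<close>

section \<open>A weight identity for domino placements\<close>

text \<open>The weights are concentric: \<open>cell_weight\<close> is one plus twice the distance of
  a cell to the boundary of the grid, \<open>point_weight\<close> is twice the distance of a point
  to it. Only the form with two diagonal distances makes the balance over a domino visible. No cell
  weighs less than 1, so exactly \<open>n\<close> monominoes leave no slack anywhere.

  The obstacle to constant amortised time is work without output. All pairs with fixed sums P and K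
  - P descend from a single compact root, and if that root is too wide, there are no such pairs at
  all. So no tree is searched in vain, and only runs of empty values P have to be jumped over. If
  the maxima for P + 1 overshoot \<open>m\<close>, they do so by exactly one, so the end of the run
  can be computed. If it is not reached, convexity of the triangular numbers excludes all further P
  up to K / 2. This is why P stops at K / 2 and the remaining pairs come from a swap, which costs
  one flag since the lookup program reads the sets through it.

  The trees are walked with an explicit stack of moves. Its height is only known to be at most cubic
  in \<open>n\<close>, which words of O(log (n + k)) bits can still count.\<close>

lemma gauss_int: "0 \<le> n \<Longrightarrow> 2 * (\<Sum>i\<in>{0..<n}. i) = n * (n - 1)" for n :: int
proof (induction n rule: int_ge_induct)
  case (step i)
  have "{0..<i + 1} = insert i {0..<i}" using step.hyps by auto
  with step show ?case by (simp add: algebra_simps)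
qed simp

lemma interval_split_first: "1 \<le> n \<Longrightarrow> (\<Sum>i\<in>{0..<n}. f i) = f 0 + (\<Sum>i\<in>{1..<n}. f i)"
  for n :: int and f :: "int \<Rightarrow> int"
proof -
  assume "1 \<le> n"
  hence "{0..<n} = insert 0 {1..<n}" by auto
  thus ?thesis by simp
qed

lemma interval_split_last: "1 \<le> n \<Longrightarrow> (\<Sum>i\<in>{0..<n}. f i) = (\<Sum>i\<in>{0..<n - 1}. f i) + f (n - 1)"
  for n :: int and f :: "int \<Rightarrow> int"
proof -
  assume "1 \<le> n"
  hence "{0..<n} = insert (n - 1) {0..<n - 1}" by auto
  thus ?thesis by simp
qed

lemma interval_shift: "(\<Sum>i\<in>{1..<n}. f i) = (\<Sum>i\<in>{0..<n - 1}. f (i + 1))"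
  for n :: int and f :: "int \<Rightarrow> int"
  by (rule sum.reindex_bij_witness[of _ "\<lambda>i. i + 1" "\<lambda>i. i - 1"]) auto

text \<open>Split off the first column and the last row of the cells; the rest matches the interior
  points under a shift of the rows by one. The column and the row contribute 0 + 1 + ... + (n - 1)
  each.\<close>

lemma anti_diagonal_excess:
  fixes n :: int
  assumes "1 \<le> n"
  shows "(\<Sum>r\<in>{0..<n}. \<Sum>c\<in>{0..<n}. \<bar>r + c - n + 1\<bar>)
    = (\<Sum>r\<in>{1..<n}. \<Sum>c\<in>{1..<n}. \<bar>r + c - n\<bar>) + n * (n - 1)"
proof -
  let ?R = "\<lambda>r. \<Sum>c\<in>{1..<n}. \<bar>r + c - n + 1\<bar>"
  have "(\<Sum>r\<in>{0..<n}. \<Sum>c\<in>{0..<n}. \<bar>r + c - n + 1\<bar>) = (\<Sum>r\<in>{0..<n}. \<bar>r - n + 1\<bar> + ?R r)"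
    using assms by (simp add: interval_split_first)
  also have "\<dots> = (\<Sum>r\<in>{0..<n}. \<bar>r - n + 1\<bar>) + (\<Sum>r\<in>{0..<n}. ?R r)"
    by (rule sum.distrib)
  also have "(\<Sum>r\<in>{0..<n}. ?R r) = (\<Sum>r\<in>{0..<n - 1}. ?R r) + ?R (n - 1)"
    using assms by (rule interval_split_last)
  also have "?R (n - 1) = (\<Sum>c\<in>{1..<n}. c)"
    by (rule sum.cong) auto
  also have "\<dots> = (\<Sum>c\<in>{0..<n}. c)"
    using interval_split_first[OF assms, of "\<lambda>c. c"] by simp
  also have "(\<Sum>r\<in>{0..<n - 1}. ?R r) = (\<Sum>r\<in>{1..<n}. \<Sum>c\<in>{1..<n}. \<bar>r + c - n\<bar>)"
    by (simp add: interval_shift[of "\<lambda>r. \<Sum>c\<in>{1..<n}. \<bar>r + c - n\<bar>"] algebra_simps)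
  also have "(\<Sum>r\<in>{0..<n}. \<bar>r - n + 1\<bar>) = (\<Sum>r\<in>{0..<n}. r)"
    by (rule sum.reindex_bij_witness[of _ "\<lambda>r. n - 1 - r" "\<lambda>r. n - 1 - r"]) auto
  finally show ?thesis using gauss_int[of n] assms by simp
qed

lemma diagonal_excess:
  fixes n :: int
  assumes "1 \<le> n"
  shows "(\<Sum>r\<in>{0..<n}. \<Sum>c\<in>{0..<n}. \<bar>r - c\<bar>)
    = (\<Sum>r\<in>{1..<n}. \<Sum>c\<in>{1..<n}. \<bar>r - c\<bar>) + n * (n - 1)"
proof -
  let ?R = "\<lambda>r. \<Sum>c\<in>{1..<n}. \<bar>r - c\<bar>"
  have "(\<Sum>r\<in>{0..<n}. \<Sum>c\<in>{0..<n}. \<bar>r - c\<bar>) = (\<Sum>r\<in>{0..<n}. \<bar>r\<bar> + ?R r)"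
    using assms by (simp add: interval_split_first)
  also have "\<dots> = (\<Sum>r\<in>{0..<n}. \<bar>r\<bar>) + (\<Sum>r\<in>{0..<n}. ?R r)"
    by (rule sum.distrib)
  also have "(\<Sum>r\<in>{0..<n}. ?R r) = ?R 0 + (\<Sum>r\<in>{1..<n}. ?R r)"
    using assms by (rule interval_split_first)
  also have "?R 0 = (\<Sum>c\<in>{1..<n}. c)"
    by (rule sum.cong) auto
  also have "\<dots> = (\<Sum>c\<in>{0..<n}. c)"
    using interval_split_first[OF assms, of "\<lambda>c. c"] by simp
  also have "(\<Sum>r\<in>{0..<n}. \<bar>r\<bar>) = (\<Sum>r\<in>{0..<n}. r)"
    by (rule sum.cong) auto
  finally show ?thesis using gauss_int[of n] assms by simp
qed

text \<open>
  The weights are made such that the two cells of a domino together weigh as much as the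
  midpoints of its two long sides.
\<close>

definition cell_weight :: "int \<Rightarrow> int \<times> int \<Rightarrow> int" where
  "cell_weight n = (\<lambda>(r, c). n - \<bar>r + c - n + 1\<bar> - \<bar>r - c\<bar>)"

definition point_weight :: "int \<Rightarrow> int \<times> int \<Rightarrow> int" where
  "point_weight n = (\<lambda>(r, c). n - \<bar>r + c - n\<bar> - \<bar>r - c\<bar>)"

text \<open>Neither sum has to be evaluated. The main terms differ by
  \<open>n * n * n - (n - 1) * (n - 1) * n\<close>, and each of the two diagonal corrections takes
  away \<open>n * (n - 1)\<close>, which leaves \<open>n\<close>.\<close>

lemma weight_excess:
  fixes n :: int
  assumes "1 \<le> n"
  shows "sum (cell_weight n) ({0..<n} \<times> {0..<n}) = sum (point_weight n) ({1..<n} \<times> {1..<n}) + n"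
proof -
  have "sum (cell_weight n) ({0..<n} \<times> {0..<n})
      = (\<Sum>r\<in>{0..<n}. \<Sum>c\<in>{0..<n}. n - \<bar>r + c - n + 1\<bar> - \<bar>r - c\<bar>)"
    by (simp add: cell_weight_def sum.cartesian_product)
  also have "\<dots> = n * n * n - (\<Sum>r\<in>{0..<n}. \<Sum>c\<in>{0..<n}. \<bar>r + c - n + 1\<bar>)
      - (\<Sum>r\<in>{0..<n}. \<Sum>c\<in>{0..<n}. \<bar>r - c\<bar>)"
    using assms by (simp add: sum_subtractf)
  also have "\<dots> = n * n * n - 2 * n * (n - 1) - (\<Sum>r\<in>{1..<n}. \<Sum>c\<in>{1..<n}. \<bar>r + c - n\<bar>)
      - (\<Sum>r\<in>{1..<n}. \<Sum>c\<in>{1..<n}. \<bar>r - c\<bar>)"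
    by (simp add: anti_diagonal_excess[OF assms] diagonal_excess[OF assms])
  also have "\<dots> = (n - 1) * (n - 1) * n + n - (\<Sum>r\<in>{1..<n}. \<Sum>c\<in>{1..<n}. \<bar>r + c - n\<bar>)
      - (\<Sum>r\<in>{1..<n}. \<Sum>c\<in>{1..<n}. \<bar>r - c\<bar>)"
    by (simp add: algebra_simps)
  also have "(n - 1) * (n - 1) * n + n - (\<Sum>r\<in>{1..<n}. \<Sum>c\<in>{1..<n}. \<bar>r + c - n\<bar>)
      - (\<Sum>r\<in>{1..<n}. \<Sum>c\<in>{1..<n}. \<bar>r - c\<bar>)
      = (\<Sum>r\<in>{1..<n}. \<Sum>c\<in>{1..<n}. n - \<bar>r + c - n\<bar> - \<bar>r - c\<bar>) + n"
    using assms by (simp add: sum_subtractf)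
  also have "(\<Sum>r\<in>{1..<n}. \<Sum>c\<in>{1..<n}. n - \<bar>r + c - n\<bar> - \<bar>r - c\<bar>)
      = sum (point_weight n) ({1..<n} \<times> {1..<n})"
    by (simp add: point_weight_def sum.cartesian_product)
  finally show ?thesis .
qed

text \<open>The double counting step: a sum over the cells or points that have a domino in a given
  relative position becomes a sum over the dominoes.\<close>

lemma sum_shifted_indicator:
  fixes f :: "int \<times> int \<Rightarrow> int"
  assumes "finite S" "\<And>r c. p r c \<Longrightarrow> (r + i, c + j) \<in> S"
  shows "(\<Sum>x\<in>S. of_bool (p (fst x - i) (snd x - j)) * f x)
    = (\<Sum>x\<in>{(r, c). p r c}. f (fst x + i, snd x + j))"
proof -
  have "(\<Sum>x\<in>S. of_bool (p (fst x - i) (snd x - j)) * f x)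
      = (\<Sum>x\<in>{x\<in>S. p (fst x - i) (snd x - j)}. f x)"
    using assms(1) by (intro sum.mono_neutral_cong_right) auto
  also have "\<dots> = (\<Sum>x\<in>{(r, c). p r c}. f (fst x + i, snd x + j))"
    by (rule sum.reindex_bij_witness[of _ "\<lambda>(r, c). (r + i, c + j)" "\<lambda>(r, c). (r - i, c - j)"])
      (use assms(2) in auto)
  finally show ?thesis .
qed

text \<open>
  \<open>h r c\<close> and \<open>v r c\<close> say that a horizontal or vertical domino has \<open>(r, c)\<close> as its upper left
  cell. The coordinates are integers, so that cells outside of the grid need no special treatment.
\<close>

locale domino_grid =
  fixes n :: int and h v :: "int \<Rightarrow> int \<Rightarrow> bool"
  assumes n_pos: "1 \<le> n"
    and h_range: "h r c \<Longrightarrow> 0 \<le> r \<and> r < n \<and> 0 \<le> c \<and> c + 1 < n"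
    and v_range: "v r c \<Longrightarrow> 0 \<le> r \<and> r + 1 < n \<and> 0 \<le> c \<and> c < n"
    and h_h: "h r c \<Longrightarrow> \<not> h r (c - 1)"
    and v_v: "v r c \<Longrightarrow> \<not> v (r - 1) c"
    and h_v: "h r c \<Longrightarrow> \<not> v r c \<and> \<not> v (r - 1) c"
    and h_v': "h r (c - 1) \<Longrightarrow> \<not> v r c \<and> \<not> v (r - 1) c"
begin

definition bare :: "int \<Rightarrow> int \<Rightarrow> bool" where
  "bare r c \<longleftrightarrow> 0 \<le> r \<and> r < n \<and> 0 \<le> c \<and> c < n \<and>
     \<not> h r c \<and> \<not> h r (c - 1) \<and> \<not> v r c \<and> \<not> v (r - 1) c"

definition bare_cells :: "(int \<times> int) set" where
  "bare_cells = {(r, c). bare r c}"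

text \<open>
  The degree of a point counts the dominoes which have it as the midpoint of a long side.
\<close>

definition degree :: "int \<times> int \<Rightarrow> int" where
  "degree = (\<lambda>(r, c). of_bool (h (r - 1) (c - 1)) + of_bool (h r (c - 1))
     + of_bool (v (r - 1) (c - 1)) + of_bool (v (r - 1) c))"

lemma finite_bare_cells: "finite bare_cells"
  by (rule finite_subset[of _ "{0..<n} \<times> {0..<n}"]) (auto simp: bare_cells_def bare_def)

text \<open>Every cell is bare or lies in exactly one of four positions: left or right half, upper
  or lower half. The weight stays arbitrary because the lemma serves the weight identity and, with
  weight 1, the count of horizontal dominoes.\<close>

lemma covered_weight:
  "sum w ({0..<n} \<times> {0..<n}) - sum w bare_cells
    = (\<Sum>x\<in>{(r, c). h r c}. w x + w (fst x, snd x + 1))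
      + (\<Sum>x\<in>{(r, c). v r c}. w x + w (fst x + 1, snd x))"
  for w :: "int \<times> int \<Rightarrow> int"
proof -
  let ?C = "{0..<n} \<times> {0..<n}"
  let ?H = "{(r, c). h r c}" and ?V = "{(r, c). v r c}"
  have cell: "w x = of_bool (bare (fst x) (snd x)) * w x
      + of_bool (h (fst x - 0) (snd x - 0)) * w x + of_bool (h (fst x - 0) (snd x - 1)) * w x
      + of_bool (v (fst x - 0) (snd x - 0)) * w x + of_bool (v (fst x - 1) (snd x - 0)) * w x"
    if "x \<in> ?C" for x
  proof -
    obtain r c where x: "x = (r, c)" by (cases x)
    have "of_bool (bare r c) + of_bool (h r c) + of_bool (h r (c - 1)) + of_bool (v r c)
        + of_bool (v (r - 1) c) = (1 :: int)"
      using that x h_h[of r c] v_v[of r c] h_v[of r c] h_v'[of r c] by (auto simp: bare_def)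
    hence "(of_bool (bare r c) + of_bool (h r c) + of_bool (h r (c - 1)) + of_bool (v r c)
        + of_bool (v (r - 1) c)) * w x = w x" by simp
    thus ?thesis by (simp add: x algebra_simps)
  qed
  have "sum w ?C = (\<Sum>x\<in>?C. of_bool (bare (fst x) (snd x)) * w x
      + of_bool (h (fst x - 0) (snd x - 0)) * w x + of_bool (h (fst x - 0) (snd x - 1)) * w x
      + of_bool (v (fst x - 0) (snd x - 0)) * w x + of_bool (v (fst x - 1) (snd x - 0)) * w x)"
    by (rule sum.cong[OF refl cell])
  also have "\<dots> = (\<Sum>x\<in>?C. of_bool (bare (fst x - 0) (snd x - 0)) * w x)
      + (\<Sum>x\<in>?C. of_bool (h (fst x - 0) (snd x - 0)) * w x)
      + (\<Sum>x\<in>?C. of_bool (h (fst x - 0) (snd x - 1)) * w x)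
      + (\<Sum>x\<in>?C. of_bool (v (fst x - 0) (snd x - 0)) * w x)
      + (\<Sum>x\<in>?C. of_bool (v (fst x - 1) (snd x - 0)) * w x)"
    by (simp add: sum.distrib)
  also have "(\<Sum>x\<in>?C. of_bool (bare (fst x - 0) (snd x - 0)) * w x)
      = (\<Sum>x\<in>{(r, c). bare r c}. w (fst x + 0, snd x + 0))"
    by (rule sum_shifted_indicator) (auto simp: bare_def)
  also have "\<dots> = sum w bare_cells" by (simp add: bare_cells_def)
  also have "(\<Sum>x\<in>?C. of_bool (h (fst x - 0) (snd x - 0)) * w x)
      = (\<Sum>x\<in>?H. w (fst x + 0, snd x + 0))"
    by (rule sum_shifted_indicator) (auto dest: h_range)
  also have "(\<Sum>x\<in>?C. of_bool (h (fst x - 0) (snd x - 1)) * w x)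
      = (\<Sum>x\<in>?H. w (fst x + 0, snd x + 1))"
    by (rule sum_shifted_indicator) (auto dest: h_range)
  also have "(\<Sum>x\<in>?C. of_bool (v (fst x - 0) (snd x - 0)) * w x)
      = (\<Sum>x\<in>?V. w (fst x + 0, snd x + 0))"
    by (rule sum_shifted_indicator) (auto dest: v_range)
  also have "(\<Sum>x\<in>?C. of_bool (v (fst x - 1) (snd x - 0)) * w x)
      = (\<Sum>x\<in>?V. w (fst x + 1, snd x + 0))"
    by (rule sum_shifted_indicator) (auto dest: v_range)
  finally show ?thesis by (simp add: sum.distrib)
qed

text \<open>The cells of a domino and the midpoints of its long sides have the same pair of diagonal
  distances, so the weights agree domino by domino. Regrouping by midpoints yields
  \<open>degree\<close>.\<close>

lemma domino_weight_balance:
  "sum (cell_weight n) ({0..<n} \<times> {0..<n}) - sum (cell_weight n) bare_cells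
    = (\<Sum>x\<in>{1..<n} \<times> {1..<n}. degree x * point_weight n x)"
proof -
  let ?w = "cell_weight n" and ?p = "point_weight n"
  let ?P = "{0..n} \<times> {0..n}"
  let ?H = "{(r, c). h r c}" and ?V = "{(r, c). v r c}"
  \<comment> \<open>Midpoints may lie on the boundary of the grid, but \<open>point_weight\<close>
    vanishes there.\<close>
  have "(\<Sum>x\<in>{1..<n} \<times> {1..<n}. degree x * ?p x) = (\<Sum>x\<in>?P. degree x * ?p x)"
    by (rule sum.mono_neutral_left) (auto simp: point_weight_def)
  also have "\<dots> = (\<Sum>x\<in>?P. of_bool (h (fst x - 1) (snd x - 1)) * ?p x
      + of_bool (h (fst x - 0) (snd x - 1)) * ?p x + of_bool (v (fst x - 1) (snd x - 1)) * ?p x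
      + of_bool (v (fst x - 1) (snd x - 0)) * ?p x)"
    by (rule sum.cong) (auto simp: degree_def algebra_simps)
  also have "\<dots> = (\<Sum>x\<in>?P. of_bool (h (fst x - 1) (snd x - 1)) * ?p x)
      + (\<Sum>x\<in>?P. of_bool (h (fst x - 0) (snd x - 1)) * ?p x)
      + (\<Sum>x\<in>?P. of_bool (v (fst x - 1) (snd x - 1)) * ?p x)
      + (\<Sum>x\<in>?P. of_bool (v (fst x - 1) (snd x - 0)) * ?p x)"
    by (simp add: sum.distrib)
  also have "(\<Sum>x\<in>?P. of_bool (h (fst x - 1) (snd x - 1)) * ?p x)
      = (\<Sum>x\<in>?H. ?p (fst x + 1, snd x + 1))"
    by (rule sum_shifted_indicator) (auto dest: h_range)
  also have "(\<Sum>x\<in>?P. of_bool (h (fst x - 0) (snd x - 1)) * ?p x)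
      = (\<Sum>x\<in>?H. ?p (fst x + 0, snd x + 1))"
    by (rule sum_shifted_indicator) (auto dest: h_range)
  also have "(\<Sum>x\<in>?P. of_bool (v (fst x - 1) (snd x - 1)) * ?p x)
      = (\<Sum>x\<in>?V. ?p (fst x + 1, snd x + 1))"
    by (rule sum_shifted_indicator) (auto dest: v_range)
  also have "(\<Sum>x\<in>?P. of_bool (v (fst x - 1) (snd x - 0)) * ?p x)
      = (\<Sum>x\<in>?V. ?p (fst x + 1, snd x + 0))"
    by (rule sum_shifted_indicator) (auto dest: v_range)
  finally have points: "(\<Sum>x\<in>{1..<n} \<times> {1..<n}. degree x * ?p x)
      = (\<Sum>x\<in>?H. ?p (fst x + 1, snd x + 1) + ?p (fst x + 0, snd x + 1))
        + (\<Sum>x\<in>?V. ?p (fst x + 1, snd x + 1) + ?p (fst x + 1, snd x + 0))"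
    by (simp add: sum.distrib)
  have "?w x + ?w (fst x, snd x + 1)
      = ?p (fst x + 1, snd x + 1) + ?p (fst x + 0, snd x + 1)" for x
    by (cases x) (simp add: cell_weight_def point_weight_def algebra_simps)
  moreover have "?w x + ?w (fst x + 1, snd x)
      = ?p (fst x + 1, snd x + 1) + ?p (fst x + 1, snd x + 0)" for x
    by (cases x) (simp add: cell_weight_def point_weight_def algebra_simps)
  ultimately show ?thesis unfolding covered_weight points by simp
qed

text \<open>It holds for every placement of dominoes, tatami or not. If no interior point has degree
  0, the second sum is nonnegative, and since bare cells weigh at least 1, there are at most
  \<open>n\<close> of them.\<close>

theorem weight_identity:
  "sum (cell_weight n) bare_cells
    + (\<Sum>x\<in>{1..<n} \<times> {1..<n}. (degree x - 1) * point_weight n x) = n"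
proof -
  have "(\<Sum>x\<in>{1..<n} \<times> {1..<n}. (degree x - 1) * point_weight n x)
      = (\<Sum>x\<in>{1..<n} \<times> {1..<n}. degree x * point_weight n x) - sum (point_weight n) ({1..<n} \<times> {1..<n})"
    by (simp add: left_diff_distrib sum_subtractf)
  thus ?thesis using domino_weight_balance weight_excess[OF n_pos] by simp
qed

lemma point_weight_pos: "x \<in> {1..<n} \<times> {1..<n} \<Longrightarrow> 0 < point_weight n x"
  by (auto simp: point_weight_def)

lemma cell_weight_pos: "x \<in> bare_cells \<Longrightarrow> 1 \<le> cell_weight n x"
  by (auto simp: cell_weight_def bare_cells_def bare_def)

end


section \<open>Strips\<close>

text \<open>
  A strip consists of the cells \<open>(r, c)\<close> with \<open>r + c \<in> {e - 1, e}\<close>, or with \<open>r - c \<in> {d, d + 1}\<close>,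
  where \<open>e\<close> and \<open>d\<close> are even. Flipping it changes its horizontal dominoes to vertical ones. The set
  \<open>A\<close> collects the flipped strips of the first kind and \<open>B\<close> those of the second kind, both by an
  index which is even on one side of the center, odd on the other side, and equal to the number of
  vertical dominoes gained.
\<close>

definition anti_strip :: "int \<Rightarrow> int \<Rightarrow> int" where
  "anti_strip n e = min e (2 * n - 1 - e)"

definition main_strip :: "int \<Rightarrow> int \<Rightarrow> int" where
  "main_strip n d = min (n + d) (n - 1 - d)"

text \<open>The upper cell of a flipped domino has odd \<open>r + c\<close> in a strip of the first
  kind and even \<open>r + c\<close> in one of the second kind, so parity alone decides which set is
  consulted.\<close>

definition pattern_v :: "int \<Rightarrow> int set \<Rightarrow> int set \<Rightarrow> int \<Rightarrow> int \<Rightarrow> bool" where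
  "pattern_v n A B r c \<longleftrightarrow> 0 \<le> r \<and> r + 1 < n \<and> 0 \<le> c \<and> c < n \<and>
     (if odd (r + c) then anti_strip n (r + c + 1) \<in> A else main_strip n (r - c) \<in> B)"

definition pattern_h :: "int \<Rightarrow> int set \<Rightarrow> int set \<Rightarrow> int \<Rightarrow> int \<Rightarrow> bool" where
  "pattern_h n A B r c \<longleftrightarrow> 0 \<le> r \<and> r < n \<and> 0 \<le> c \<and> c + 1 < n \<and>
     odd (r + c) \<and> anti_strip n (r + c + 1) \<notin> A \<and> main_strip n (r - c - 1) \<notin> B"

definition admissible :: "int \<Rightarrow> int set \<Rightarrow> int set \<Rightarrow> bool" where
  "admissible n A B \<longleftrightarrow> A \<subseteq> {1..n - 2} \<and> B \<subseteq> {1..n - 2} \<and> (\<forall>a\<in>A. \<forall>b\<in>B. a + b \<le> n - 2)"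

text \<open>
  If \<open>n\<close> is odd, the covering has been transposed, which moves the monomino of the top right
  corner to the bottom left.
\<close>

locale tatami_grid = domino_grid +
  assumes block: "1 \<le> r \<Longrightarrow> r < n \<Longrightarrow> 1 \<le> c \<Longrightarrow> c < n \<Longrightarrow>
      h (r - 1) (c - 1) \<or> h r (c - 1) \<or> v (r - 1) (c - 1) \<or> v (r - 1) c"
    and card_bare_cells: "int (card bare_cells) = n"
    and corner: "bare 0 0"
    and corner': "if even n then bare 0 (n - 1) else bare (n - 1) 0"
begin

section \<open>Equality in the weight identity\<close>

lemma sum_weight_bare_cells: "n \<le> sum (cell_weight n) bare_cells"
  using sum_mono[of bare_cells "\<lambda>_. 1" "cell_weight n"] cell_weight_pos card_bare_cells by simp

lemma degree_ge: "x \<in> {1..<n} \<times> {1..<n} \<Longrightarrow> 0 \<le> degree x - 1"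
  using block[of "fst x" "snd x"] by (cases x) (auto simp: degree_def)

lemma weight_terms_nonneg: "x \<in> {1..<n} \<times> {1..<n} \<Longrightarrow> 0 \<le> (degree x - 1) * point_weight n x"
  using degree_ge[of x] point_weight_pos[of x] by simp

text \<open>The \<open>n\<close> bare cells already exhaust the right side of the weight identity,
  so nothing is left for the nonnegative excess of the points.\<close>

lemma weight_terms_zero: "(\<Sum>x\<in>{1..<n} \<times> {1..<n}. (degree x - 1) * point_weight n x) = 0"
proof -
  have "0 \<le> (\<Sum>x\<in>{1..<n} \<times> {1..<n}. (degree x - 1) * point_weight n x)"
    by (rule sum_nonneg) (rule weight_terms_nonneg)
  thus ?thesis using weight_identity sum_weight_bare_cells by linarith
qed

lemma degree_one:
  assumes "1 \<le> r" "r < n" "1 \<le> c" "c < n"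
  shows "degree (r, c) = 1"
proof -
  have "(r, c) \<in> {1..<n} \<times> {1..<n}" using assms by simp
  moreover from this have "(degree (r, c) - 1) * point_weight n (r, c) = 0"
    using weight_terms_zero weight_terms_nonneg
    by (subst (asm) sum_nonneg_eq_0_iff) auto
  ultimately show ?thesis using point_weight_pos[of "(r, c)"] by simp
qed

text \<open>The bare cells have average weight 1 and none weighs less. So each weighs exactly 1, and
  only boundary cells do.\<close>

lemma bare_boundary:
  assumes "bare r c"
  shows "r = 0 \<or> r = n - 1 \<or> c = 0 \<or> c = n - 1"
proof -
  have "sum (\<lambda>x. cell_weight n x - 1) bare_cells = 0"
    using weight_identity weight_terms_zero card_bare_cells by (simp add: sum_subtractf)
  moreover have "0 \<le> cell_weight n x - 1" if "x \<in> bare_cells" for x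
    using cell_weight_pos[OF that] by simp
  ultimately have "\<forall>x\<in>bare_cells. cell_weight n x - 1 = 0"
    using sum_nonneg_eq_0_iff[OF finite_bare_cells, of "\<lambda>x. cell_weight n x - 1"] by simp
  hence "cell_weight n (r, c) - 1 = 0"
    using assms by (auto simp: bare_cells_def)
  thus ?thesis by (simp add: cell_weight_def abs_if split: if_splits; linarith)
qed

text \<open>
  An interior point of degree one has one missing edge, covered by a domino. \<open>NE\<close> says that this
  edge goes up or right, and \<open>NW\<close> that it goes up or left. Since no monomino is interior, both
  properties spread along diagonals.
\<close>

definition NE :: "int \<Rightarrow> int \<Rightarrow> bool" where
  "NE r c \<longleftrightarrow> h (r - 1) (c - 1) \<or> v (r - 1) c"

definition NW :: "int \<Rightarrow> int \<Rightarrow> bool" where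
  "NW r c \<longleftrightarrow> h (r - 1) (c - 1) \<or> v (r - 1) (c - 1)"

definition interior :: "int \<Rightarrow> int \<Rightarrow> bool" where
  "interior r c \<longleftrightarrow> 1 \<le> r \<and> r < n \<and> 1 \<le> c \<and> c < n"

text \<open>Exactly one of the four edges at the point is hidden inside a domino. The two bits tell
  the edges apart: up belongs to both classes, down to neither.\<close>

lemma directions:
  assumes "interior r c"
  shows up: "h (r - 1) (c - 1) \<longleftrightarrow> NE r c \<and> NW r c"
    and right: "v (r - 1) c \<longleftrightarrow> NE r c \<and> \<not> NW r c"
    and left: "v (r - 1) (c - 1) \<longleftrightarrow> \<not> NE r c \<and> NW r c"
    and down: "h r (c - 1) \<longleftrightarrow> \<not> NE r c \<and> \<not> NW r c"
  using degree_one[of r c] assms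
  by (auto simp: degree_def NE_def NW_def interior_def of_bool_def split: if_splits)

text \<open>The four sides of the cell between the two points are the up and right edges at the
  lower point and the down and left edges at the upper one. The cell is not bare, so its domino
  hides exactly one of these sides.\<close>

lemma NE_step:
  assumes "interior r c" "interior (r - 1) (c + 1)"
  shows "NE (r - 1) (c + 1) \<longleftrightarrow> NE r c"
proof -
  have "\<not> bare (r - 1) c"
    using bare_boundary[of "r - 1" c] assms by (auto simp: interior_def)
  hence cover: "h (r - 1) c \<or> h (r - 1) (c - 1) \<or> v (r - 1) c \<or> v (r - 2) c"
    using assms by (auto simp: interior_def bare_def)
  have excl: "(h (r - 1) c \<or> v (r - 2) c) \<longrightarrow> \<not> (h (r - 1) (c - 1) \<or> v (r - 1) c)"
    using h_h[of "r - 1" c] h_v[of "r - 1" c] h_v'[of "r - 1" c] v_v[of "r - 1" c] by auto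
  have "NE r c \<longleftrightarrow> h (r - 1) (c - 1) \<or> v (r - 1) c" by (simp add: NE_def)
  moreover have "\<not> NE (r - 1) (c + 1) \<longleftrightarrow> h (r - 1) c \<or> v (r - 2) c"
    using left[OF assms(2)] down[OF assms(2)] by auto
  ultimately show ?thesis using cover excl by blast
qed

lemma NW_step:
  assumes "interior r c" "interior (r - 1) (c - 1)"
  shows "NW (r - 1) (c - 1) \<longleftrightarrow> NW r c"
proof -
  have "\<not> bare (r - 1) (c - 1)"
    using bare_boundary[of "r - 1" "c - 1"] assms by (auto simp: interior_def)
  hence cover: "h (r - 1) (c - 1) \<or> h (r - 1) (c - 2) \<or> v (r - 1) (c - 1) \<or> v (r - 2) (c - 1)"
    using assms by (auto simp: interior_def bare_def)
  have excl: "(h (r - 1) (c - 2) \<or> v (r - 2) (c - 1)) \<longrightarrow> \<not> (h (r - 1) (c - 1) \<or> v (r - 1) (c - 1))"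
    using h_h[of "r - 1" "c - 1"] h_v[of "r - 1" "c - 1"] h_v'[of "r - 1" "c - 1"]
      v_v[of "r - 1" "c - 1"] by auto
  have "NW r c \<longleftrightarrow> h (r - 1) (c - 1) \<or> v (r - 1) (c - 1)" by (simp add: NW_def)
  moreover have "\<not> NW (r - 1) (c - 1) \<longleftrightarrow> h (r - 1) (c - 2) \<or> v (r - 2) (c - 1)"
    using right[OF assms(2)] down[OF assms(2)] by auto
  ultimately show ?thesis using cover excl by blast
qed

lemma NE_steps: "interior r c \<Longrightarrow> interior (r - int k) (c + int k) \<Longrightarrow> NE (r - int k) (c + int k) \<longleftrightarrow> NE r c"
proof (induction k)
  case (Suc k)
  have i: "interior (r - int k) (c + int k)" using Suc.prems by (auto simp: interior_def)
  have e: "r - int (Suc k) = r - int k - 1" "c + int (Suc k) = c + int k + 1" by auto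
  show ?case using Suc.IH[OF Suc.prems(1) i] NE_step[OF i] Suc.prems(2) unfolding e by simp
qed simp

lemma NW_steps: "interior r c \<Longrightarrow> interior (r - int k) (c - int k) \<Longrightarrow> NW (r - int k) (c - int k) \<longleftrightarrow> NW r c"
proof (induction k)
  case (Suc k)
  have i: "interior (r - int k) (c - int k)" using Suc.prems by (auto simp: interior_def)
  have e: "r - int (Suc k) = r - int k - 1" "c - int (Suc k) = c - int k - 1" by auto
  show ?case using Suc.IH[OF Suc.prems(1) i] NW_step[OF i] Suc.prems(2) unfolding e by simp
qed simp

lemma NE_diagonal:
  assumes "interior r c" "interior r' c'" "r + c = r' + c'"
  shows "NE r c \<longleftrightarrow> NE r' c'"
proof (cases "r' \<le> r")
  case True
  define k where "k = nat (r - r')"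
  have "r - int k = r'" "c + int k = c'" using True assms(3) by (auto simp: k_def)
  thus ?thesis using NE_steps[of r c k] assms(1,2) by simp
next
  case False
  define k where "k = nat (r' - r)"
  have "r' - int k = r" "c' + int k = c" using False assms(3) by (auto simp: k_def)
  thus ?thesis using NE_steps[of r' c' k] assms(1,2) by simp
qed

lemma NW_diagonal:
  assumes "interior r c" "interior r' c'" "r - c = r' - c'"
  shows "NW r c \<longleftrightarrow> NW r' c'"
proof (cases "r' \<le> r")
  case True
  define k where "k = nat (r - r')"
  have "r - int k = r'" "c - int k = c'" using True assms(3) by (auto simp: k_def)
  thus ?thesis using NW_steps[of r c k] assms(1,2) by simp
next
  case False
  define k where "k = nat (r' - r)"
  have "r' - int k = r" "c' - int k = c" using False assms(3) by (auto simp: k_def)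
  thus ?thesis using NW_steps[of r' c' k] assms(1,2) by simp
qed

section \<open>Alternating directions within a strip\<close>

lemma NW_main: "interior r r \<Longrightarrow> \<not> NW r r"
proof -
  assume i: "interior r r"
  have "interior 1 1" using i by (auto simp: interior_def)
  moreover have "\<not> NW 1 1" using corner by (simp add: NW_def bare_def)
  ultimately show ?thesis using NW_diagonal[OF i, of 1 1] by simp
qed

lemma NE_main:
  assumes i: "interior r c" and s: "r + c = n"
  shows "NE r c \<longleftrightarrow> odd n"
proof (cases "even n")
  case True
  have j: "interior 1 (n - 1)" using i s by (auto simp: interior_def)
  moreover have "\<not> NE 1 (n - 1)"
    using corner' True by (simp add: NE_def bare_def)
  ultimately show ?thesis using NE_diagonal[OF i j] True s by simp
next
  case False
  have j: "interior (n - 1) 1" using i s by (auto simp: interior_def)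
  moreover have "NE (n - 1) 1"
    using corner' False left[OF j] down[OF j] by (auto simp: bare_def)
  ultimately show ?thesis using NE_diagonal[OF i j] False s by simp
qed

text \<open>On the main diagonal \<open>NW\<close> fails, so the point (j, j) with 2 j = r + c has
  its hidden edge to the right or below. The other end of this edge lies on the next anti-diagonal
  and sees it from the opposite direction.\<close>

lemma NE_alternate:
  assumes i: "interior r c" "interior r' c'" and s: "r' + c' = r + c + 1" and e: "even (r + c)"
  shows "NE r' c' \<longleftrightarrow> \<not> NE r c"
proof -
  from e obtain j where j: "r + c = 2 * j" by (elim evenE)
  have ij: "interior j j" "interior j (j + 1)" "interior (j + 1) j"
    using i s j by (auto simp: interior_def)
  show ?thesis
  proof (cases "NE j j")
    case True
    hence "v (j - 1) j" using right[OF ij(1)] NW_main[OF ij(1)] by simp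
    hence "\<not> NE j (j + 1)" using left[OF ij(2)] by simp
    thus ?thesis using True NE_diagonal[OF i(1) ij(1)] NE_diagonal[OF i(2) ij(2)] s j by simp
  next
    case False
    hence "h j (j - 1)" using down[OF ij(1)] NW_main[OF ij(1)] by simp
    hence "NE (j + 1) j" using up[OF ij(3)] by simp
    thus ?thesis using False NE_diagonal[OF i(1) ij(1)] NE_diagonal[OF i(2) ij(3)] s j by simp
  qed
qed

text \<open>The reference line is now r + c = n, where \<open>NE\<close> depends on the parity of
  \<open>n\<close>. The same parity decides on which of the two given diagonals this line has a
  point (p, q).\<close>

lemma NW_alternate:
  assumes i: "interior r c" "interior r' c'" and s: "r' - c' = r - c + 1" and e: "even (r - c)"
  shows "NW r' c' \<longleftrightarrow> \<not> NW r c"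
proof (cases "even n")
  case True
  hence "even (n + (r - c))" using e by simp
  then obtain p where p: "n + (r - c) = 2 * p" by (elim evenE)
  define q where "q = n - p"
  have ij: "interior p q" "interior p (q - 1)" "interior (p + 1) q" and d: "p - q = r - c"
    using i s p by (auto simp: interior_def q_def)
  have m: "\<not> NE p q" using NE_main[OF ij(1)] True by (simp add: q_def)
  show ?thesis
  proof (cases "NW p q")
    case True
    hence "v (p - 1) (q - 1)" using left[OF ij(1)] m by simp
    hence "\<not> NW p (q - 1)" using right[OF ij(2)] by simp
    thus ?thesis using True NW_diagonal[OF i(1) ij(1)] NW_diagonal[OF i(2) ij(2)] s d by simp
  next
    case False
    hence "h p (q - 1)" using down[OF ij(1)] m by simp
    hence "NW (p + 1) q" using up[OF ij(3)] by simp
    thus ?thesis using False NW_diagonal[OF i(1) ij(1)] NW_diagonal[OF i(2) ij(3)] s d by simp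
  qed
next
  case False
  hence "even (n + (r' - c'))" using e s by simp
  then obtain p where p: "n + (r' - c') = 2 * p" by (elim evenE)
  define q where "q = n - p"
  have ij: "interior p q" "interior p (q + 1)" "interior (p - 1) q" and d: "p - q = r' - c'"
    using i s p by (auto simp: interior_def q_def)
  have m: "NE p q" using NE_main[OF ij(1)] False by (simp add: q_def)
  show ?thesis
  proof (cases "NW p q")
    case True
    hence "h (p - 1) (q - 1)" using up[OF ij(1)] m by simp
    hence "\<not> NW (p - 1) q" using down[OF ij(3)] by simp
    thus ?thesis using True NW_diagonal[OF i(2) ij(1)] NW_diagonal[OF i(1) ij(3)] s d by simp
  next
    case False
    hence "v (p - 1) q" using right[OF ij(1)] m by simp
    hence "NW p (q + 1)" using left[OF ij(2)] by simp
    thus ?thesis using False NW_diagonal[OF i(2) ij(1)] NW_diagonal[OF i(1) ij(2)] s d by simp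
  qed
qed

definition anti_flip :: "int \<Rightarrow> bool" where
  "anti_flip e \<longleftrightarrow> (\<exists>r c. interior r c \<and> (r + c = e \<and> NE r c \<or> r + c = e + 1 \<and> \<not> NE r c))"

definition main_flip :: "int \<Rightarrow> bool" where
  "main_flip d \<longleftrightarrow> (\<exists>r c. interior r c \<and> (r - c = d \<and> NW r c \<or> r - c = d + 1 \<and> \<not> NW r c))"

lemma NE_even: "interior r c \<Longrightarrow> even (r + c) \<Longrightarrow> NE r c \<longleftrightarrow> anti_flip (r + c)"
  unfolding anti_flip_def using NE_diagonal NE_alternate by metis

lemma NE_odd:
  assumes "interior r c" "odd (r + c)"
  shows "NE r c \<longleftrightarrow> \<not> anti_flip (r + c - 1)"
proof
  assume ne: "NE r c"
  show "\<not> anti_flip (r + c - 1)"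
  proof
    assume "anti_flip (r + c - 1)"
    then obtain r' c' where i: "interior r' c'"
      and "r' + c' = r + c - 1 \<and> NE r' c' \<or> r' + c' = r + c \<and> \<not> NE r' c'"
      by (auto simp: anti_flip_def)
    from this(2) show False
    proof
      assume *: "r' + c' = r + c - 1 \<and> NE r' c'"
      hence "even (r' + c')" using assms(2) by presburger
      with NE_alternate[OF i assms(1)] * ne show False by simp
    qed (use ne NE_diagonal[OF assms(1) i] in auto)
  qed
next
  assume "\<not> anti_flip (r + c - 1)"
  thus "NE r c" using assms by (auto simp: anti_flip_def)
qed

lemma NW_even: "interior r c \<Longrightarrow> even (r - c) \<Longrightarrow> NW r c \<longleftrightarrow> main_flip (r - c)"
  unfolding main_flip_def using NW_diagonal NW_alternate by metis

lemma NW_odd: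
  assumes "interior r c" "odd (r - c)"
  shows "NW r c \<longleftrightarrow> \<not> main_flip (r - c - 1)"
proof
  assume nw: "NW r c"
  show "\<not> main_flip (r - c - 1)"
  proof
    assume "main_flip (r - c - 1)"
    then obtain r' c' where i: "interior r' c'"
      and "r' - c' = r - c - 1 \<and> NW r' c' \<or> r' - c' = r - c \<and> \<not> NW r' c'"
      by (auto simp: main_flip_def)
    from this(2) show False
    proof
      assume *: "r' - c' = r - c - 1 \<and> NW r' c'"
      hence "even (r' - c')" using assms(2) by presburger
      with NW_alternate[OF i assms(1)] * nw show False by simp
    qed (use nw NW_diagonal[OF assms(1) i] in auto)
  qed
next
  assume "\<not> main_flip (r - c - 1)"
  thus "NW r c" using assms by (auto simp: main_flip_def)
qed

section \<open>Unflipped corner strips and the absence of crossings\<close>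

lemma main_flip_zero: "\<not> main_flip 0"
proof
  assume "main_flip 0"
  then obtain r c where "interior r c" by (auto simp: main_flip_def)
  hence "interior 1 1" by (auto simp: interior_def)
  with NW_even[OF this] NW_main[OF this] \<open>main_flip 0\<close> show False by simp
qed

lemma anti_flip_middle: "\<not> anti_flip (if even n then n else n - 1)"
proof
  assume a: "anti_flip (if even n then n else n - 1)"
  then obtain r c where "interior r c" by (auto simp: anti_flip_def)
  hence i: "interior 1 (n - 1)" by (auto simp: interior_def)
  show False using a NE_main[OF i] NE_even[OF i] NE_odd[OF i] by (auto split: if_splits)
qed

text \<open>A crossing at (r, c) hides the edge below (r + 1, c), which is the edge above (r + 2,
  c). Hence there is a crossing at (r + 2, c) as well, and so on down to the main diagonal, whose
  strip is not flipped.\<close>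

lemma no_cross_above:
  assumes "0 \<le> r" "r + 2 * int k = c" "1 \<le> c" "c < n"
  shows "\<not> (anti_flip (r + c) \<and> main_flip (r - c))"
  using assms
proof (induction k arbitrary: r)
  case 0
  thus ?case using main_flip_zero by simp
next
  case (Suc k)
  show ?case
  proof
    assume F: "anti_flip (r + c) \<and> main_flip (r - c)"
    have i: "interior (r + 1) c" "interior (r + 2) c" using Suc.prems by (auto simp: interior_def)
    have "even (r + c)" using Suc.prems by auto
    hence "even (r - c)" by simp
    have "\<not> NE (r + 1) c" "\<not> NW (r + 1) c"
      using NE_odd[OF i(1)] NW_odd[OF i(1)] F \<open>even (r + c)\<close> by auto
    hence "h (r + 1) (c - 1)" using down[OF i(1)] by simp
    hence "NE (r + 2) c" "NW (r + 2) c" using up[OF i(2)] by (simp_all add: add.commute)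
    hence "anti_flip (r + 2 + c)" "main_flip (r + 2 - c)"
      using NE_even[OF i(2)] NW_even[OF i(2)] \<open>even (r + c)\<close> by auto
    thus False using Suc.IH[of "r + 2"] Suc.prems by simp
  qed
qed

lemma no_cross_below:
  assumes "r = c + 2 * int k" "r < n" "1 \<le> c" "c < n"
  shows "\<not> (anti_flip (r + c) \<and> main_flip (r - c))"
  using assms
proof (induction k arbitrary: r)
  case 0
  thus ?case using main_flip_zero by simp
next
  case (Suc k)
  show ?case
  proof
    assume F: "anti_flip (r + c) \<and> main_flip (r - c)"
    have i: "interior (r - 1) c" "interior r c" using Suc.prems by (auto simp: interior_def)
    have "even (r + c)" using Suc.prems by auto
    hence "NE r c" "NW r c"
      using NE_even[OF i(2)] NW_even[OF i(2)] F by auto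
    hence "h (r - 1) (c - 1)" using up[OF i(2)] by simp
    hence "\<not> NE (r - 1) c" "\<not> NW (r - 1) c" using down[OF i(1)] by simp_all
    hence "anti_flip (r - 2 + c)" "main_flip (r - 2 - c)"
      using NE_odd[OF i(1)] NW_odd[OF i(1)] \<open>even (r + c)\<close> by (auto simp: algebra_simps)
    thus False using Suc.IH[of "r - 2"] Suc.prems by simp
  qed
qed

lemma no_cross_interior:
  assumes "0 \<le> r" "r < n" "1 \<le> c" "c < n" "even (r + c)"
  shows "\<not> (anti_flip (r + c) \<and> main_flip (r - c))"
proof (cases "r \<le> c")
  case True
  from assms have "even (c - r)" by simp
  then obtain k where "c - r = 2 * k" by (elim evenE)
  with True no_cross_above[of r "nat k" c] assms show ?thesis by simp
next
  case False
  from assms have "even (r - c)" by simp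
  then obtain k where "r - c = 2 * k" by (elim evenE)
  with False no_cross_below[of r c "nat k"] assms show ?thesis by simp
qed

text \<open>On the left side a crossing would force vertical dominoes at rows r - 1 and r of the
  first column, and these overlap. The directions used for this are fixed by the absence of
  crossings in column 1.\<close>

lemma no_cross_left:
  assumes "0 \<le> r" "r < n" "even r"
  shows "\<not> (anti_flip r \<and> main_flip r)"
proof
  assume F: "anti_flip r \<and> main_flip r"
  have "r \<noteq> 0" using F main_flip_zero by auto
  have "r \<noteq> n - 1" using F anti_flip_middle assms by (auto split: if_splits)
  have i: "interior r 1" "interior (r + 1) 1"
    using assms \<open>r \<noteq> 0\<close> \<open>r \<noteq> n - 1\<close> by (auto simp: interior_def)
  have "\<not> main_flip (r - 2)"
    using no_cross_interior[of "r - 1" 1] F assms \<open>r \<noteq> 0\<close> i by (auto simp: interior_def)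
  hence "v (r - 1) 0"
    using left[OF i(1)] NE_odd[OF i(1)] NW_odd[OF i(1)] F assms by simp
  have "\<not> anti_flip (r + 2)"
    using no_cross_interior[of "r + 1" 1] F assms i by (auto simp: interior_def add.commute)
  hence "v r 0"
    using left[OF i(2)] NE_even[OF i(2)] NW_even[OF i(2)] F assms by (simp add: add.commute)
  with \<open>v (r - 1) 0\<close> v_v show False by blast
qed

lemma no_cross_right:
  assumes "0 \<le> r" "r < n" "even (r + n)"
  shows "\<not> (anti_flip (r + n) \<and> main_flip (r - n))"
proof
  assume F: "anti_flip (r + n) \<and> main_flip (r - n)"
  have "r \<noteq> 0"
  proof
    assume "r = 0"
    with F show False by (auto simp: main_flip_def interior_def)
  qed
  have "r \<noteq> n - 1" using assms by auto
  have i: "interior r (n - 1)" "interior (r + 1) (n - 1)"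
    using assms \<open>r \<noteq> 0\<close> \<open>r \<noteq> n - 1\<close> by (auto simp: interior_def)
  have "\<not> anti_flip (r + n - 2)"
    using no_cross_interior[of "r - 1" "n - 1"] F assms \<open>r \<noteq> 0\<close> i by (auto simp: interior_def algebra_simps)
  hence "v (r - 1) (n - 1)"
    using right[OF i(1)] NE_odd[OF i(1)] NW_odd[OF i(1)] F assms by (simp add: algebra_simps)
  have "\<not> main_flip (r - n + 2)"
    using no_cross_interior[of "r + 1" "n - 1"] F assms i by (auto simp: interior_def algebra_simps)
  hence "v r (n - 1)"
    using right[OF i(2)] NE_even[OF i(2)] NW_even[OF i(2)] F assms by (simp add: algebra_simps)
  with \<open>v (r - 1) (n - 1)\<close> v_v show False by blast
qed

lemma no_cross:
  assumes "0 \<le> r" "r < n" "0 \<le> c" "c \<le> n" "even (r + c)"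
  shows "\<not> (anti_flip (r + c) \<and> main_flip (r - c))"
proof -
  consider "c = 0" | "c = n" | "1 \<le> c" "c < n" using assms by linarith
  thus ?thesis
    using assms no_cross_left[of r] no_cross_right[of r] no_cross_interior[of r c] by cases auto
qed

section \<open>The two index sets of a covering\<close>

definition anti_set :: "int set" where
  "anti_set = {l \<in> {1..n - 2}. anti_flip (if even l then l else 2 * n - 1 - l)}"

definition main_set :: "int set" where
  "main_set = {l \<in> {1..n - 2}. main_flip (if even (l - n) then l - n else n - 1 - l)}"

text \<open>Strips outside of the index range are never flipped: index \<open>n - 1\<close> is the
  strip through a bare corner, and the others contain no interior point.\<close>

lemma anti_strip_mem:
  assumes "even e"
  shows "anti_strip n e \<in> anti_set \<longleftrightarrow> anti_flip e"
proof (cases "2 \<le> e \<and> e \<le> 2 * n - 2")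
  case True
  show ?thesis
  proof (cases "e = n \<or> e = n - 1")
    case True
    hence "anti_strip n e = n - 1" by (auto simp: anti_strip_def)
    moreover have "\<not> anti_flip e" using anti_flip_middle True assms by (auto split: if_splits)
    ultimately show ?thesis by (simp add: anti_set_def)
  next
    case False
    show ?thesis
    proof (cases "e \<le> n - 1")
      case True
      with False \<open>2 \<le> e \<and> _\<close> assms show ?thesis by (auto simp: anti_strip_def anti_set_def)
    next
      case False
      hence "anti_strip n e = 2 * n - 1 - e" by (simp add: anti_strip_def)
      with False \<open>\<not> (e = n \<or> e = n - 1)\<close> \<open>2 \<le> e \<and> _\<close> assms show ?thesis by (auto simp: anti_set_def)
    qed
  qed
next
  case False
  moreover from False have "\<not> anti_flip e"
    using assms by (auto simp: anti_flip_def interior_def)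
  moreover from False assms have "\<not> (1 \<le> anti_strip n e \<and> anti_strip n e \<le> n - 2)"
    by (auto simp: anti_strip_def elim!: evenE)
  ultimately show ?thesis by (auto simp: anti_set_def)
qed

lemma main_strip_mem:
  assumes "even d"
  shows "main_strip n d \<in> main_set \<longleftrightarrow> main_flip d"
proof (cases "d = 0")
  case True
  thus ?thesis using main_flip_zero by (simp add: main_strip_def main_set_def)
next
  case False
  show ?thesis
  proof (cases "1 - n \<le> d \<and> d \<le> n - 2")
    case True
    show ?thesis
    proof (cases "d < 0")
      case True
      hence "main_strip n d = n + d" using assms by (auto simp: main_strip_def elim!: evenE)
      with True \<open>1 - n \<le> d \<and> _\<close> assms show ?thesis by (auto simp: main_set_def)
    next
      case False
      hence "main_strip n d = n - 1 - d" by (simp add: main_strip_def)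
      with False \<open>d \<noteq> 0\<close> \<open>1 - n \<le> d \<and> _\<close> assms show ?thesis by (auto simp: main_set_def)
    qed
  next
    case False
    hence "\<not> main_flip d" by (auto simp: main_flip_def interior_def)
    moreover from False have "\<not> 1 \<le> main_strip n d" by (auto simp: main_strip_def)
    ultimately show ?thesis by (auto simp: main_set_def)
  qed
qed

text \<open>The strips e and d cross at the point ((e + d) / 2, (e - d) / 2). In all parity cases,
  indices with \<open>a + b > n - 2\<close> place this point in the range where crossings are
  excluded.\<close>

lemma admissible_sets: "admissible n anti_set main_set"
  unfolding admissible_def
proof (intro conjI ballI)
  fix a b assume ab: "a \<in> anti_set" "b \<in> main_set"
  define e where "e = (if even a then a else 2 * n - 1 - a)"
  define d where "d = (if even (b - n) then b - n else n - 1 - b)"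
  have F: "anti_flip e" "main_flip d" and ev: "even e" "even d"
    and range: "1 \<le> a" "a \<le> n - 2" "1 \<le> b" "b \<le> n - 2"
    using ab by (auto simp: e_def d_def anti_set_def main_set_def)
  from ev obtain x y where xy: "e = 2 * x" "d = 2 * y" by (elim evenE)
  show "a + b \<le> n - 2"
  proof (rule ccontr)
    assume "\<not> a + b \<le> n - 2"
    hence "0 \<le> x + y \<and> x + y < n \<and> 0 \<le> x - y \<and> x - y \<le> n"
      using range xy unfolding e_def d_def by (auto split: if_splits)
    with no_cross[of "x + y" "x - y"] F xy show False by auto
  qed
qed (auto simp: anti_set_def main_set_def)

text \<open>The domino is read off at the left end of its hidden edge, or at the right end in the
  first column, where the left end is not interior. Since strips do not cross, the two bits reduce
  to one flip condition.\<close>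

theorem v_pattern: "v r c \<longleftrightarrow> pattern_v n anti_set main_set r c"
proof (cases "0 \<le> r \<and> r + 1 < n \<and> 0 \<le> c \<and> c < n")
  case True
  have "v r c \<longleftrightarrow> (if odd (r + c) then anti_flip (r + c + 1) else main_flip (r - c))"
  proof (cases "c = 0")
    case True
    with \<open>0 \<le> r \<and> _\<close> have i: "interior (r + 1) 1" by (auto simp: interior_def)
    show ?thesis
    proof (cases "even r")
      case True
      with NE_even[OF i] NW_even[OF i] left[OF i] no_cross[of "r + 1" 1] \<open>c = 0\<close> \<open>0 \<le> r \<and> _\<close>
      show ?thesis by (auto simp: algebra_simps)
    next
      case False
      with NE_odd[OF i] NW_odd[OF i] left[OF i] no_cross[of r 1] \<open>c = 0\<close> \<open>0 \<le> r \<and> _\<close>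
      show ?thesis by (auto simp: algebra_simps)
    qed
  next
    case False
    with \<open>0 \<le> r \<and> _\<close> have i: "interior (r + 1) c" by (auto simp: interior_def)
    show ?thesis
    proof (cases "even (r + c)")
      case True
      with NE_odd[OF i] NW_odd[OF i] right[OF i] no_cross[of r c] \<open>0 \<le> r \<and> _\<close>
      show ?thesis by (auto simp: algebra_simps)
    next
      case False
      with NE_even[OF i] NW_even[OF i] right[OF i] no_cross[of "r + 1" c] \<open>0 \<le> r \<and> _\<close>
      show ?thesis by (auto simp: algebra_simps)
    qed
  qed
  thus ?thesis using True anti_strip_mem[of "r + c + 1"] main_strip_mem[of "r - c"]
    by (auto simp: pattern_v_def)
next
  case False
  thus ?thesis using v_range[of r c] by (auto simp: pattern_v_def)
qed

theorem h_pattern: "h r c \<longleftrightarrow> pattern_h n anti_set main_set r c"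
proof (cases "0 \<le> r \<and> r < n \<and> 0 \<le> c \<and> c + 1 < n")
  case True
  have "h r c \<longleftrightarrow> odd (r + c) \<and> \<not> anti_flip (r + c + 1) \<and> \<not> main_flip (r - c - 1)"
  proof (cases "r = 0")
    case True
    with \<open>0 \<le> r \<and> _\<close> have i: "interior 1 (c + 1)" by (auto simp: interior_def)
    show ?thesis
    proof (cases "even c")
      case True
      with NE_even[OF i] NW_even[OF i] up[OF i] no_cross[of 1 "c + 1"] \<open>r = 0\<close> \<open>0 \<le> r \<and> _\<close>
      show ?thesis by (auto simp: algebra_simps)
    next
      case False
      with NE_odd[OF i] NW_odd[OF i] up[OF i] \<open>r = 0\<close> \<open>0 \<le> r \<and> _\<close>
      show ?thesis by (auto simp: algebra_simps)
    qed
  next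
    case False
    with \<open>0 \<le> r \<and> _\<close> have i: "interior r (c + 1)" by (auto simp: interior_def)
    show ?thesis
    proof (cases "even (r + c)")
      case True
      with NE_odd[OF i] NW_odd[OF i] down[OF i] no_cross[of "r - 1" "c + 1"] False \<open>0 \<le> r \<and> _\<close>
      show ?thesis by (auto simp: algebra_simps)
    next
      case False
      with NE_even[OF i] NW_even[OF i] down[OF i]
      show ?thesis by (auto simp: algebra_simps)
    qed
  qed
  thus ?thesis using True anti_strip_mem[of "r + c + 1"] main_strip_mem[of "r - c - 1"]
    by (auto simp: pattern_h_def)
next
  case False
  thus ?thesis using h_range[of r c] by (auto simp: pattern_h_def)
qed

end


section \<open>Coverings from admissible pairs of sets\<close>

locale admissible_pattern =
  fixes n :: int and A B :: "int set"
  assumes n_pos: "1 \<le> n" and admissible: "admissible n A B"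
begin

abbreviation "h \<equiv> pattern_h n A B"
abbreviation "v \<equiv> pattern_v n A B"

lemma range_A: "a \<in> A \<Longrightarrow> 1 \<le> a \<and> a \<le> n - 2"
  using admissible by (auto simp: admissible_def)

lemma range_B: "b \<in> B \<Longrightarrow> 1 \<le> b \<and> b \<le> n - 2"
  using admissible by (auto simp: admissible_def)

lemma disjoint_strips:
  assumes "even (r + c)" "0 \<le> r" "r < n" "0 \<le> c" "c \<le> n" "anti_strip n (r + c) \<in> A"
  shows "main_strip n (r - c) \<notin> B"
proof
  assume "main_strip n (r - c) \<in> B"
  hence "anti_strip n (r + c) + main_strip n (r - c) \<le> n - 2"
    using assms admissible by (auto simp: admissible_def)
  moreover have "r + c \<noteq> 2 * n - 1" using assms(1) by presburger
  ultimately show False using assms by (auto simp: anti_strip_def main_strip_def min_def split: if_splits)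
qed

lemma disjoint_strips_odd:
  assumes "odd (r + c)" "0 \<le> r" "r < n" "0 \<le> c" "c < n" "anti_strip n (r + c + 1) \<in> A"
  shows "main_strip n (r - c - 1) \<notin> B"
  using disjoint_strips[of r "c + 1"] assms by (simp add: algebra_simps)

sublocale domino_grid n h v
proof
  fix r c
  show "v r c \<Longrightarrow> \<not> v (r - 1) c"
  proof (cases "even (r + c)")
    case True
    thus "v r c \<Longrightarrow> \<not> v (r - 1) c" using disjoint_strips[of r c] by (auto simp: pattern_v_def)
  next
    case False
    thus "v r c \<Longrightarrow> \<not> v (r - 1) c"
      using disjoint_strips_odd[of r c] by (auto simp: pattern_v_def algebra_simps)
  qed
  show "h r c \<Longrightarrow> \<not> v r c \<and> \<not> v (r - 1) c"
    by (auto simp: pattern_v_def pattern_h_def algebra_simps)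
  show "h r (c - 1) \<Longrightarrow> \<not> v r c \<and> \<not> v (r - 1) c"
    by (auto simp: pattern_v_def pattern_h_def algebra_simps)
qed (use n_pos in \<open>auto simp: pattern_v_def pattern_h_def\<close>)

lemma block_covered:
  assumes "1 \<le> r" "r < n" "1 \<le> c" "c < n"
  shows "h (r - 1) (c - 1) \<or> h r (c - 1) \<or> v (r - 1) (c - 1) \<or> v (r - 1) c"
  using assms by (cases "even (r + c)") (auto simp: pattern_v_def pattern_h_def algebra_simps)

lemma degree_one:
  assumes "x \<in> {1..<n} \<times> {1..<n}"
  shows "degree x = 1"
proof -
  obtain r c where x: "x = (r, c)" by (cases x)
  have r: "1 \<le> r" "r < n" "1 \<le> c" "c < n" using assms x by auto
  have "\<not> (h (r - 1) (c - 1) \<and> h r (c - 1))"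
    by (auto simp: pattern_h_def)
  moreover have "\<not> (v (r - 1) (c - 1) \<and> v (r - 1) c)"
  proof (cases "even (r + c)")
    case True
    thus ?thesis using disjoint_strips[of r c] r
      disjoint_strips_odd[of r "c - 1"] by (auto simp: pattern_v_def algebra_simps)
  next
    case False
    thus ?thesis using disjoint_strips[of "r - 1" c] r
      by (auto simp: pattern_v_def algebra_simps)
  qed
  moreover have hv: "\<not> (h a b \<and> v r' c')" if "a = r' \<or> a = r' + 1" "b = c' \<or> b + 1 = c'" for a b r' c'
    using that by (auto simp: pattern_v_def pattern_h_def algebra_simps)
  have "\<not> (h (r - 1) (c - 1) \<and> v (r - 1) (c - 1))" "\<not> (h (r - 1) (c - 1) \<and> v (r - 1) c)"
    "\<not> (h r (c - 1) \<and> v (r - 1) (c - 1))" "\<not> (h r (c - 1) \<and> v (r - 1) c)"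
    by (intro hv; simp)+
  ultimately show ?thesis using block_covered[OF r] by (auto simp: x degree_def)
qed

text \<open>The pattern assigns a domino to every cell; it is missing only if it would stick out of
  the grid, which happens at the boundary alone.\<close>

lemma weight_bare: "x \<in> bare_cells \<Longrightarrow> cell_weight n x = 1"
proof -
  assume x: "x \<in> bare_cells"
  obtain r c where [simp]: "x = (r, c)" by (cases x)
  from x have b: "bare r c" by (simp add: bare_cells_def)
  have "r = 0 \<or> r = n - 1 \<or> c = 0 \<or> c = n - 1"
  proof (cases "even (r + c)")
    case True
    thus ?thesis using b
      by (auto simp: bare_def pattern_v_def pattern_h_def algebra_simps split: if_splits)
  next
    case False
    thus ?thesis using b
      by (auto simp: bare_def pattern_v_def pattern_h_def algebra_simps split: if_splits)
  qed
  thus ?thesis using b by (auto simp: cell_weight_def bare_def)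
qed

text \<open>The weight identity read backwards: all degrees are 1, so the bare cells weigh
  \<open>n\<close> together, and each weighs 1.\<close>

lemma card_bare: "int (card bare_cells) = n"
  using weight_identity weight_bare degree_one by simp

lemma corner: "bare 0 0"
proof -
  have "n - 1 \<notin> B" using range_B by force
  thus ?thesis using n_pos by (auto simp: bare_def pattern_v_def pattern_h_def main_strip_def)
qed

lemma corner': "if even n then bare 0 (n - 1) else bare (n - 1) 0"
proof -
  have "n - 1 \<notin> A" using range_A by force
  thus ?thesis using n_pos by (auto simp: bare_def pattern_v_def pattern_h_def anti_strip_def)
qed

sublocale tatami_grid n h v
  using block_covered card_bare corner corner' by unfold_locales auto

section \<open>Counting dominoes strip by strip\<close>

definition anti_part :: "int \<Rightarrow> (int \<times> int) set" where
  "anti_part a = {(r, c). 0 \<le> r \<and> r + 1 < n \<and> 0 \<le> c \<and> c < n \<and> odd (r + c) \<and> anti_strip n (r + c + 1) = a}"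

definition main_part :: "int \<Rightarrow> (int \<times> int) set" where
  "main_part b = {(r, c). 0 \<le> r \<and> r + 1 < n \<and> 0 \<le> c \<and> c < n \<and> even (r + c) \<and> main_strip n (r - c) = b}"

text \<open>The parity of \<open>a\<close> selects the side of the center, because the other term of
  the minimum has the wrong parity. So there is one strip with this index, and its dominoes are
  enumerated by their rows.\<close>

lemma card_anti_part:
  assumes "1 \<le> a" "a \<le> n - 2"
  shows "finite (anti_part a) \<and> int (card (anti_part a)) = a"
proof (cases "even a")
  case True
  have "anti_part a = (\<lambda>r. (r, a - 1 - r)) ` {0..<a}"
  proof (intro equalityI subsetI)
    fix x assume "x \<in> anti_part a"
    then obtain r c where x: "x = (r, c)" and r: "0 \<le> r" "0 \<le> c" "odd (r + c)"
      and s: "min (r + c + 1) (2 * n - 1 - (r + c + 1)) = a"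
      by (auto simp: anti_part_def anti_strip_def)
    have "2 * n - 1 - (r + c + 1) \<noteq> a" using True r(3) by presburger
    hence "r + c + 1 = a" using s by linarith
    thus "x \<in> (\<lambda>r. (r, a - 1 - r)) ` {0..<a}" using x r by auto
  qed (use True assms in \<open>auto simp: anti_part_def anti_strip_def\<close>)
  moreover have "inj_on (\<lambda>r. (r, a - 1 - r)) {0..<a}" by (rule inj_onI) simp
  ultimately show ?thesis using assms by (simp add: card_image)
next
  case False
  have "anti_part a = (\<lambda>r. (r, 2 * n - 2 - a - r)) ` {n - 1 - a..<n - 1}"
  proof (intro equalityI subsetI)
    fix x assume "x \<in> anti_part a"
    then obtain r c where x: "x = (r, c)" and r: "r + 1 < n" "c < n" "odd (r + c)"
      and s: "min (r + c + 1) (2 * n - 1 - (r + c + 1)) = a"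
      by (auto simp: anti_part_def anti_strip_def)
    have "r + c + 1 \<noteq> a" using False r(3) by presburger
    hence "r + c + 1 = 2 * n - 1 - a" using s by linarith
    thus "x \<in> (\<lambda>r. (r, 2 * n - 2 - a - r)) ` {n - 1 - a..<n - 1}" using x r by auto
  qed (use False assms in \<open>auto simp: anti_part_def anti_strip_def\<close>)
  moreover have "inj_on (\<lambda>r. (r, 2 * n - 2 - a - r)) {n - 1 - a..<n - 1}" by (rule inj_onI) simp
  ultimately show ?thesis using assms by (simp add: card_image)
qed

lemma card_main_part:
  assumes "1 \<le> b" "b \<le> n - 2"
  shows "finite (main_part b) \<and> int (card (main_part b)) = b"
proof (cases "even (n - b)")
  case True
  have "main_part b = (\<lambda>r. (r, r + n - b)) ` {0..<b}"
  proof (intro equalityI subsetI)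
    fix x assume "x \<in> main_part b"
    then obtain r c where x: "x = (r, c)" and r: "0 \<le> r" "c < n" "even (r + c)"
      and s: "min (n + (r - c)) (n - 1 - (r - c)) = b"
      by (auto simp: main_part_def main_strip_def)
    have "n - 1 - (r - c) \<noteq> b" using True r(3) by presburger
    hence "n + (r - c) = b" using s by linarith
    thus "x \<in> (\<lambda>r. (r, r + n - b)) ` {0..<b}" using x r by auto
  qed (use True assms in \<open>auto simp: main_part_def main_strip_def\<close>)
  moreover have "inj_on (\<lambda>r. (r, r + n - b)) {0..<b}" by (rule inj_onI) simp
  ultimately show ?thesis using assms by (simp add: card_image)
next
  case False
  have "main_part b = (\<lambda>r. (r, r - (n - 1 - b))) ` {n - 1 - b..<n - 1}"
  proof (intro equalityI subsetI)
    fix x assume "x \<in> main_part b"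
    then obtain r c where x: "x = (r, c)" and r: "r + 1 < n" "0 \<le> c" "even (r + c)"
      and s: "min (n + (r - c)) (n - 1 - (r - c)) = b"
      by (auto simp: main_part_def main_strip_def)
    have "n + (r - c) \<noteq> b" using False r(3) by presburger
    hence "n - 1 - (r - c) = b" using s by linarith
    thus "x \<in> (\<lambda>r. (r, r - (n - 1 - b))) ` {n - 1 - b..<n - 1}" using x r by auto
  qed (use False assms in \<open>auto simp: main_part_def main_strip_def\<close>)
  moreover have "inj_on (\<lambda>r. (r, r - (n - 1 - b))) {n - 1 - b..<n - 1}" by (rule inj_onI) simp
  ultimately show ?thesis using assms by (simp add: card_image)
qed

theorem card_vertical: "int (card {(r, c). v r c}) = \<Sum>A + \<Sum>B"
proof -
  have fin: "finite A" "finite B"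
    using range_A range_B by (auto intro: finite_subset[of _ "{1..n - 2}"])
  have eq: "{(r, c). v r c} = (\<Union>a\<in>A. anti_part a) \<union> (\<Union>b\<in>B. main_part b)"
    by (auto simp: pattern_v_def anti_part_def main_part_def)
  have "card {(r, c). v r c} = card (\<Union>a\<in>A. anti_part a) + card (\<Union>b\<in>B. main_part b)"
    unfolding eq using fin card_anti_part card_main_part range_A range_B
    by (intro card_Un_disjoint) (auto simp: anti_part_def main_part_def)
  also have "card (\<Union>a\<in>A. anti_part a) = (\<Sum>a\<in>A. card (anti_part a))"
    using fin card_anti_part range_A by (intro card_UN_disjoint) (auto simp: anti_part_def)
  also have "card (\<Union>b\<in>B. main_part b) = (\<Sum>b\<in>B. card (main_part b))"
    using fin card_main_part range_B by (intro card_UN_disjoint) (auto simp: main_part_def)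
  finally show ?thesis using card_anti_part card_main_part range_A range_B by simp
qed

text \<open>The \<open>n * n - n\<close> cells that are not bare are covered in pairs.\<close>

theorem card_horizontal: "2 * int (card {(r, c). h r c}) + 2 * (\<Sum>A + \<Sum>B) = n * (n - 1)"
  using covered_weight[of "\<lambda>_. 1"] card_bare card_vertical n_pos by (simp add: algebra_simps)

text \<open>Each strip reaches the top or the bottom row, where a single domino witnesses that it is
  flipped. This makes the sets recoverable from the covering.\<close>

lemma mem_A_iff:
  assumes "1 \<le> a" "a \<le> n - 2"
  shows "a \<in> A \<longleftrightarrow> (if even a then v 0 (a - 1) else v (n - 2) (n - a))"
  using assms by (auto simp: pattern_v_def anti_strip_def)

lemma mem_B_iff:
  assumes "1 \<le> b" "b \<le> n - 2"
  shows "b \<in> B \<longleftrightarrow> (if even (n - b) then v 0 (n - b) else v (n - 2) (b - 1))"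
  using assms by (auto simp: pattern_v_def main_strip_def)

end

lemma pattern_inject:
  assumes "1 \<le> n" "admissible n A B" "admissible n A' B'" "pattern_v n A B = pattern_v n A' B'"
  shows "A = A'" "B = B'"
proof -
  interpret P: admissible_pattern n A B using assms by unfold_locales
  interpret Q: admissible_pattern n A' B' using assms by unfold_locales
  show "A = A'"
    using P.mem_A_iff Q.mem_A_iff P.range_A Q.range_A assms(4) by (metis subset_antisym subsetI)
  show "B = B'"
    using P.mem_B_iff Q.mem_B_iff P.range_B Q.range_B assms(4) by (metis subset_antisym subsetI)
qed

section \<open>Passage between domino predicates and sets of tiles\<close>

definition tile_set :: "nat \<Rightarrow> (int \<Rightarrow> int \<Rightarrow> bool) \<Rightarrow> (int \<Rightarrow> int \<Rightarrow> bool) \<Rightarrow> tile set" where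
  "tile_set n h v = {HDom r c | r c. h (int r) (int c)} \<union> {VDom r c | r c. v (int r) (int c)}
     \<union> {Mono r c | r c. domino_grid.bare (int n) h v (int r) (int c)}"

definition maximal_tatami :: "nat \<Rightarrow> tile set \<Rightarrow> bool" where
  "maximal_tatami n T \<longleftrightarrow> covering (grid n) T \<and> tatami T \<and> card {(r, c). Mono r c \<in> T} = n \<and>
     Mono 0 0 \<in> T \<and> (if even n then Mono 0 (n - 1) else Mono (n - 1) 0) \<in> T"

lemma tile_set_simps [simp]:
  "HDom r c \<in> tile_set n h v \<longleftrightarrow> h (int r) (int c)"
  "VDom r c \<in> tile_set n h v \<longleftrightarrow> v (int r) (int c)"
  "Mono r c \<in> tile_set n h v \<longleftrightarrow> domino_grid.bare (int n) h v (int r) (int c)"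
  by (auto simp: tile_set_def)

lemma corner_in_block:
  assumes "(p, q) \<in> corners t"
  obtains r c where "(r, c) \<in> cells t" "r = p \<or> Suc r = p" "c = q \<or> Suc c = q"
proof (cases t)
  case (Mono a b)
  thus ?thesis using assms that[of a b] by auto
next
  case (HDom a b)
  thus ?thesis using assms that[of a b] that[of a "b + 1"] by auto
next
  case (VDom a b)
  thus ?thesis using assms that[of a b] that[of "a + 1" b] by auto
qed

text \<open>Distinct tiles are disjoint, so at most two tiles can meet a set of two cells, and no
  four tiles share the corner.\<close>

lemma tatamiI:
  assumes cov: "covering R T"
    and C: "\<And>p. \<exists>C. finite C \<and> card C \<le> 2 \<and> (\<forall>t\<in>T. p \<in> corners t \<longrightarrow> cells t \<inter> C \<noteq> {})"
  shows "tatami T"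
  unfolding tatami_def
proof
  assume "\<exists>p. \<exists>S\<subseteq>T. card S = 4 \<and> (\<forall>t\<in>S. p \<in> corners t)"
  then obtain p S where S: "S \<subseteq> T" "card S = 4" "\<forall>t\<in>S. p \<in> corners t" by blast
  from C[of p] obtain C where C: "finite C" "card C \<le> 2" "\<forall>t\<in>T. p \<in> corners t \<longrightarrow> cells t \<inter> C \<noteq> {}"
    by blast
  hence "\<forall>t\<in>S. \<exists>x. x \<in> cells t \<inter> C" using S by blast
  then obtain f where f: "\<forall>t\<in>S. f t \<in> cells t \<inter> C" by metis
  have "inj_on f S"
  proof (rule inj_onI)
    fix t u assume "t \<in> S" "u \<in> S" "f t = f u"
    hence "f t \<in> cells t \<inter> cells u" "t \<in> T" "u \<in> T" using f S by auto
    thus "t = u" using cov unfolding covering_def by blast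
  qed
  moreover have "f ` S \<subseteq> C" using f by blast
  ultimately have "card S \<le> card C" using C(1) card_inj_on_le by blast
  thus False using S C by simp
qed

lemma card_nat_pairs:
  assumes "\<And>r c. P r c \<Longrightarrow> 0 \<le> r \<and> 0 \<le> c"
  shows "card {(r, c). P (int r) (int c)} = card {(r, c). P r c}"
proof (rule bij_betw_same_card)
  show "bij_betw (map_prod int int) {(r, c). P (int r) (int c)} {(r, c). P r c}"
    by (rule bij_betw_byWitness[where f' = "map_prod nat nat"]) (use assms in fastforce)+
qed

context tatami_grid
begin

lemma cell_owner:
  assumes "int m = n"
  shows "t \<in> tile_set m h v \<and> (r, c) \<in> cells t \<longleftrightarrow>
    t = HDom r c \<and> h (int r) (int c) \<or> t = HDom r (c - 1) \<and> 1 \<le> c \<and> h (int r) (int c - 1) \<or>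
    t = VDom r c \<and> v (int r) (int c) \<or> t = VDom (r - 1) c \<and> 1 \<le> r \<and> v (int r - 1) (int c) \<or>
    t = Mono r c \<and> bare (int r) (int c)"
  using assms by (cases t) (auto simp: of_nat_diff)

lemma covering_tile_set:
  assumes m: "int m = n"
  shows "covering (grid m) (tile_set m h v)"
  unfolding covering_def
proof (intro conjI ballI impI)
  show "\<Union> (cells ` tile_set m h v) = grid m"
  proof (intro equalityI subsetI)
    fix x assume "x \<in> \<Union> (cells ` tile_set m h v)"
    then obtain t where t: "t \<in> tile_set m h v" "x \<in> cells t" by blast
    obtain r c where "x = (r, c)" by (cases x)
    with t cell_owner[OF m, of t r c] show "x \<in> grid m"
      using m h_range[of "int r" "int c"] h_range[of "int r" "int c - 1"]
        v_range[of "int r" "int c"] v_range[of "int r - 1" "int c"]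
      by (auto simp: grid_def bare_def)
  next
    fix x assume "x \<in> grid m"
    then obtain r c where x: "x = (r, c)" "r < m" "c < m" by (auto simp: grid_def)
    have "\<exists>t. t \<in> tile_set m h v \<and> (r, c) \<in> cells t"
    proof (cases "bare (int r) (int c)")
      case False
      hence "h (int r) (int c) \<or> h (int r) (int c - 1) \<or> v (int r) (int c) \<or> v (int r - 1) (int c)"
        using x m by (auto simp: bare_def)
      moreover have "h (int r) (int c - 1) \<Longrightarrow> 1 \<le> c" "v (int r - 1) (int c) \<Longrightarrow> 1 \<le> r"
        using h_range[of "int r" "int c - 1"] v_range[of "int r - 1" "int c"] by auto
      ultimately show ?thesis unfolding cell_owner[OF m] by blast
    qed (use cell_owner[OF m] in blast)
    thus "x \<in> \<Union> (cells ` tile_set m h v)" using x by blast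
  qed
next
  fix t u assume tu: "t \<in> tile_set m h v" "u \<in> tile_set m h v" "t \<noteq> u"
  show "cells t \<inter> cells u = {}"
  proof (rule ccontr)
    assume "cells t \<inter> cells u \<noteq> {}"
    then obtain r c where "(r, c) \<in> cells t" "(r, c) \<in> cells u" by auto
    with tu have "t \<in> tile_set m h v \<and> (r, c) \<in> cells t" "u \<in> tile_set m h v \<and> (r, c) \<in> cells u" by auto
    hence "t = u"
      unfolding cell_owner[OF m]
      using h_h[of "int r" "int c"] v_v[of "int r" "int c"] h_v[of "int r" "int c"]
        h_v'[of "int r" "int c"] by (elim disjE conjE) (auto simp: bare_def)
    thus False using tu by simp
  qed
qed

lemma tile_unique:
  "int m = n \<Longrightarrow> t \<in> tile_set m h v \<Longrightarrow> u \<in> tile_set m h v \<Longrightarrow> x \<in> cells t \<Longrightarrow> x \<in> cells u \<Longrightarrow> t = u"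
  using covering_tile_set unfolding covering_def by blast

text \<open>A point on the boundary touches at most two cells of the grid. At an interior point, the
  domino that has it as the midpoint of a long side has no corner there and uses up two of the four
  cells.\<close>

lemma tatami_tile_set:
  assumes m: "int m = n"
  shows "tatami (tile_set m h v)"
proof (rule tatamiI[OF covering_tile_set[OF m]])
  fix x :: "nat \<times> nat"
  obtain p q where x: "x = (p, q)" by (cases x)
  let ?B = "{(p - 1, q - 1), (p - 1, q), (p, q - 1), (p, q)}"
  let ?hit = "\<lambda>C. \<forall>t\<in>tile_set m h v. x \<in> corners t \<longrightarrow> cells t \<inter> C \<noteq> {}"
  have in_grid: "r < m \<and> c < m" if "t \<in> tile_set m h v" "(r, c) \<in> cells t" for t r c
  proof -
    have "(r, c) \<in> grid m" using that covering_tile_set[OF m] unfolding covering_def by blast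
    thus ?thesis by (simp add: grid_def)
  qed
  have hit: "?hit C" if C: "\<And>t r c. t \<in> tile_set m h v \<Longrightarrow> x \<in> corners t \<Longrightarrow> (r, c) \<in> cells t \<Longrightarrow>
      r = p \<or> Suc r = p \<Longrightarrow> c = q \<or> Suc c = q \<Longrightarrow> r < m \<Longrightarrow> c < m \<Longrightarrow> (r, c) \<in> C" for C
  proof (intro ballI impI)
    fix t assume t: "t \<in> tile_set m h v" "x \<in> corners t"
    obtain r c where "(r, c) \<in> cells t" "r = p \<or> Suc r = p" "c = q \<or> Suc c = q"
      using corner_in_block[of p q t] t x by blast
    with C[OF t] in_grid[OF t(1)] show "cells t \<inter> C \<noteq> {}" by blast
  qed
  have two: "finite {a, b} \<and> card {a, b} \<le> 2" for a b :: "nat \<times> nat"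
    by (auto simp: card_insert_if)
  consider "p = 0" | "q = 0" | "p \<ge> m" | "q \<ge> m" | "1 \<le> p" "p < m" "1 \<le> q" "q < m" by linarith
  thus "\<exists>C. finite C \<and> card C \<le> 2 \<and> ?hit C"
  proof cases
    case 1
    have "?hit {(0, q - 1), (0, q)}" by (rule hit) (use 1 in auto)
    thus ?thesis using two by blast
  next
    case 2
    have "?hit {(p - 1, 0), (p, 0)}" by (rule hit) (use 2 in auto)
    thus ?thesis using two by blast
  next
    case 3
    have "?hit {(p - 1, q - 1), (p - 1, q)}" by (rule hit) (use 3 in auto)
    thus ?thesis using two by blast
  next
    case 4
    have "?hit {(p - 1, q - 1), (p, q - 1)}" by (rule hit) (use 4 in auto)
    thus ?thesis using two by blast
  next
    case 5
    have "h (int p - 1) (int q - 1) \<or> h (int p) (int q - 1) \<or> v (int p - 1) (int q - 1) \<or> v (int p - 1) (int q)"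
      using 5 m by (intro block) auto
    thus ?thesis
    proof (elim disjE)
      assume "h (int p - 1) (int q - 1)"
      hence d: "HDom (p - 1) (q - 1) \<in> tile_set m h v" using 5 by (simp add: of_nat_diff)
      have "?hit {(p, q - 1), (p, q)}"
      proof (rule hit)
        fix t r c assume t: "t \<in> tile_set m h v" "x \<in> corners t" "(r, c) \<in> cells t"
          "r = p \<or> Suc r = p" "c = q \<or> Suc c = q"
        have "(r, c) \<notin> cells (HDom (p - 1) (q - 1))"
          using tile_unique[OF m t(1) d t(3)] t(2) x 5 by auto
        thus "(r, c) \<in> {(p, q - 1), (p, q)}" using t 5 by auto
      qed
      thus ?thesis using two by blast
    next
      assume "h (int p) (int q - 1)"
      hence d: "HDom p (q - 1) \<in> tile_set m h v" using 5 by (simp add: of_nat_diff)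
      have "?hit {(p - 1, q - 1), (p - 1, q)}"
      proof (rule hit)
        fix t r c assume t: "t \<in> tile_set m h v" "x \<in> corners t" "(r, c) \<in> cells t"
          "r = p \<or> Suc r = p" "c = q \<or> Suc c = q"
        have "(r, c) \<notin> cells (HDom p (q - 1))"
          using tile_unique[OF m t(1) d t(3)] t(2) x 5 by auto
        thus "(r, c) \<in> {(p - 1, q - 1), (p - 1, q)}" using t 5 by auto
      qed
      thus ?thesis using two by blast
    next
      assume "v (int p - 1) (int q - 1)"
      hence d: "VDom (p - 1) (q - 1) \<in> tile_set m h v" using 5 by (simp add: of_nat_diff)
      have "?hit {(p - 1, q), (p, q)}"
      proof (rule hit)
        fix t r c assume t: "t \<in> tile_set m h v" "x \<in> corners t" "(r, c) \<in> cells t"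
          "r = p \<or> Suc r = p" "c = q \<or> Suc c = q"
        have "(r, c) \<notin> cells (VDom (p - 1) (q - 1))"
          using tile_unique[OF m t(1) d t(3)] t(2) x 5 by auto
        thus "(r, c) \<in> {(p - 1, q), (p, q)}" using t 5 by auto
      qed
      thus ?thesis using two by blast
    next
      assume "v (int p - 1) (int q)"
      hence d: "VDom (p - 1) q \<in> tile_set m h v" using 5 by (simp add: of_nat_diff)
      have "?hit {(p - 1, q - 1), (p, q - 1)}"
      proof (rule hit)
        fix t r c assume t: "t \<in> tile_set m h v" "x \<in> corners t" "(r, c) \<in> cells t"
          "r = p \<or> Suc r = p" "c = q \<or> Suc c = q"
        have "(r, c) \<notin> cells (VDom (p - 1) q)"
          using tile_unique[OF m t(1) d t(3)] t(2) x 5 by auto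
        thus "(r, c) \<in> {(p - 1, q - 1), (p, q - 1)}" using t 5 by auto
      qed
      thus ?thesis using two by blast
    qed
  qed
qed

theorem maximal_tatami_tile_set:
  assumes m: "int m = n"
  shows "maximal_tatami m (tile_set m h v)"
proof -
  have "card {(r, c). Mono r c \<in> tile_set m h v} = card bare_cells"
    unfolding bare_cells_def tile_set_simps m
    by (rule card_nat_pairs) (simp add: bare_def)
  hence "card {(r, c). Mono r c \<in> tile_set m h v} = m" using card_bare_cells m by simp
  moreover have "even n \<longleftrightarrow> even m" "int (m - 1) = n - 1" using m n_pos by auto
  ultimately show ?thesis
    using covering_tile_set[OF m] tatami_tile_set[OF m] corner corner'
    by (simp add: maximal_tatami_def m)
qed

end

lemma (in domino_grid) tile_set_eqI:
  assumes m: "int m = n" and cov: "covering (grid m) T"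
    and H: "\<And>r c. HDom r c \<in> T \<longleftrightarrow> h (int r) (int c)"
    and V: "\<And>r c. VDom r c \<in> T \<longleftrightarrow> v (int r) (int c)"
    and M: "\<And>r c. Mono r c \<in> T \<longleftrightarrow> bare (int r) (int c)"
  shows "T = tile_set m h v"
proof (intro set_eqI)
  fix t show "t \<in> T \<longleftrightarrow> t \<in> tile_set m h v"
    using m by (cases t) (simp_all add: H V M)
qed

lemma maximal_tatami_pattern:
  assumes n: "1 \<le> n" and max: "maximal_tatami n T"
  shows "\<exists>A B. admissible (int n) A B \<and> T = tile_set n (pattern_h (int n) A B) (pattern_v (int n) A B)"
proof -
  define h where "h r c \<longleftrightarrow> 0 \<le> r \<and> 0 \<le> c \<and> HDom (nat r) (nat c) \<in> T" for r c :: int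
  define v where "v r c \<longleftrightarrow> 0 \<le> r \<and> 0 \<le> c \<and> VDom (nat r) (nat c) \<in> T" for r c :: int
  have cov: "covering (grid n) T" and tat: "tatami T" using max by (auto simp: maximal_tatami_def)
  have in_grid: "cells t \<subseteq> grid n" if "t \<in> T" for t
    using cov that unfolding covering_def by blast
  have unique: "t = u" if "t \<in> T" "u \<in> T" "x \<in> cells t" "x \<in> cells u" for t u x
    using cov that unfolding covering_def by blast
  have step: "nat r = Suc (nat (r - 1))" if "0 \<le> r - 1" for r using that by simp
  interpret domino_grid "int n" h v
  proof
    fix r c
    show "h r c \<Longrightarrow> 0 \<le> r \<and> r < int n \<and> 0 \<le> c \<and> c + 1 < int n"
      using in_grid[of "HDom (nat r) (nat c)"] by (auto simp: h_def grid_def)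
    show "v r c \<Longrightarrow> 0 \<le> r \<and> r + 1 < int n \<and> 0 \<le> c \<and> c < int n"
      using in_grid[of "VDom (nat r) (nat c)"] by (auto simp: v_def grid_def)
    show "h r c \<Longrightarrow> \<not> h r (c - 1)"
      using unique[of "HDom (nat r) (nat c)" "HDom (nat r) (nat (c - 1))" "(nat r, nat c)"] step[of c]
      by (auto simp: h_def)
    show "v r c \<Longrightarrow> \<not> v (r - 1) c"
      using unique[of "VDom (nat r) (nat c)" "VDom (nat (r - 1)) (nat c)" "(nat r, nat c)"] step[of r]
      by (auto simp: v_def)
    show "h r c \<Longrightarrow> \<not> v r c \<and> \<not> v (r - 1) c"
      using unique[of "HDom (nat r) (nat c)" "VDom (nat (r - 1)) (nat c)" "(nat r, nat c)"] step[of r]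
        unique[of "HDom (nat r) (nat c)" "VDom (nat r) (nat c)" "(nat r, nat c)"]
      by (auto simp: h_def v_def)
    show "h r (c - 1) \<Longrightarrow> \<not> v r c \<and> \<not> v (r - 1) c"
      using unique[of "HDom (nat r) (nat (c - 1))" "VDom (nat (r - 1)) (nat c)" "(nat r, nat c)"] step[of r]
        unique[of "HDom (nat r) (nat (c - 1))" "VDom (nat r) (nat c)" "(nat r, nat c)"] step[of c]
      by (auto simp: h_def v_def)
  qed (use n in simp)
  have bare: "bare (int r) (int c) \<longleftrightarrow> Mono r c \<in> T" for r c
  proof
    assume b: "bare (int r) (int c)"
    hence "(r, c) \<in> \<Union> (cells ` T)" using cov by (auto simp: covering_def bare_def grid_def)
    then obtain t where t: "t \<in> T" "(r, c) \<in> cells t" by blast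
    show "Mono r c \<in> T"
    proof (cases t)
      case (HDom a b')
      with t b show ?thesis by (auto simp: bare_def h_def)
    next
      case (VDom a b')
      with t b show ?thesis by (auto simp: bare_def v_def)
    qed (use t in auto)
  next
    assume M: "Mono r c \<in> T"
    have "r < n" "c < n" using in_grid[OF M] by (auto simp: grid_def)
    moreover have "\<not> h (int r) (int c)" "\<not> v (int r) (int c)"
      using unique[OF M, of "HDom r c" "(r, c)"] unique[OF M, of "VDom r c" "(r, c)"]
      by (auto simp: h_def v_def)
    moreover have "\<not> h (int r) (int c - 1)"
      using unique[OF M, of "HDom r (c - 1)" "(r, c)"] by (auto simp: h_def nat_diff_distrib)
    moreover have "\<not> v (int r - 1) (int c)"
      using unique[OF M, of "VDom (r - 1) c" "(r, c)"] by (auto simp: v_def nat_diff_distrib)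
    ultimately show "bare (int r) (int c)" by (simp add: bare_def)
  qed
  have bare_cells: "bare_cells = map_prod int int ` {(r, c). Mono r c \<in> T}"
  proof (intro equalityI subsetI)
    fix x assume "x \<in> bare_cells"
    then obtain r c where x: "x = (r, c)" "bare r c" by (auto simp: bare_cells_def)
    hence "0 \<le> r" "0 \<le> c" by (auto simp: bare_def)
    with x bare[of "nat r" "nat c"] show "x \<in> map_prod int int ` {(r, c). Mono r c \<in> T}"
      by (intro image_eqI[of _ _ "(nat r, nat c)"]) auto
  qed (auto simp: bare_cells_def bare)
  have "inj_on (map_prod int int) {(r, c). Mono r c \<in> T}" by (auto intro: inj_onI)
  hence "card bare_cells = n"
    using max by (simp add: bare_cells card_image maximal_tatami_def)
  interpret tatami_grid "int n" h v
  proof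
    fix r c :: int assume rc: "1 \<le> r" "r < int n" "1 \<le> c" "c < int n"
    define p where "p = nat r - 1"
    define q where "q = nat c - 1"
    have pq: "r = int (Suc p)" "c = int (Suc q)" using rc by (auto simp: p_def q_def)
    show "h (r - 1) (c - 1) \<or> h r (c - 1) \<or> v (r - 1) (c - 1) \<or> v (r - 1) c"
    proof (rule ccontr)
      assume "\<not> ?thesis"
      \<comment> \<open>The only use of the tatami condition: without such a domino, the four cells
        around the point belong to four distinct tiles which all have a corner there.\<close>
      hence none: "HDom p q \<notin> T" "HDom (Suc p) q \<notin> T" "VDom p q \<notin> T" "VDom p (Suc q) \<notin> T"
        by (auto simp: h_def v_def pq nat_add_distrib)
      have "\<exists>t\<in>T. x \<in> cells t" if "x \<in> {p, Suc p} \<times> {q, Suc q}" for x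
        using that rc pq cov by (auto simp: covering_def grid_def set_eq_iff)
      then obtain t1 t2 t3 t4 where t: "t1 \<in> T" "t2 \<in> T" "t3 \<in> T" "t4 \<in> T"
        "(p, q) \<in> cells t1" "(p, Suc q) \<in> cells t2" "(Suc p, q) \<in> cells t3" "(Suc p, Suc q) \<in> cells t4"
        by (meson SigmaI insertI1 insertI2)
      have corners: "(Suc p, Suc q) \<in> corners t1" "(Suc p, Suc q) \<in> corners t2"
        "(Suc p, Suc q) \<in> corners t3" "(Suc p, Suc q) \<in> corners t4"
        subgoal using t(1,5) none by (cases t1) auto
        subgoal using t(2,6) none by (cases t2) auto
        subgoal using t(3,7) none by (cases t3) auto
        subgoal using t(4,8) none by (cases t4) auto
        done
      have "t1 \<noteq> t2" using t(1,5,6) none by (cases t1) auto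
      moreover have "t1 \<noteq> t3" using t(1,5,7) none by (cases t1) auto
      moreover have "t1 \<noteq> t4" using t(1,5,8) none by (cases t1) auto
      moreover have "t2 \<noteq> t3" using t(2,6,7) none by (cases t2) auto
      moreover have "t2 \<noteq> t4" using t(2,6,8) none by (cases t2) auto
      moreover have "t3 \<noteq> t4" using t(3,7,8) none by (cases t3) auto
      ultimately have "card {t1, t2, t3, t4} = 4" by simp
      moreover have "{t1, t2, t3, t4} \<subseteq> T" using t by simp
      moreover have "\<forall>t\<in>{t1, t2, t3, t4}. (Suc p, Suc q) \<in> corners t" using corners by simp
      ultimately show False using tat unfolding tatami_def by blast
    qed
  qed (use \<open>card bare_cells = n\<close> bare[of 0 0] bare[of 0 "n - 1"] bare[of "n - 1" 0] max n
      in \<open>auto simp: maximal_tatami_def of_nat_diff\<close>)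
  have hv: "h = pattern_h (int n) anti_set main_set" "v = pattern_v (int n) anti_set main_set"
    using h_pattern v_pattern by (auto intro!: ext)
  have "T = tile_set n h v"
    by (rule tile_set_eqI[OF _ cov]) (auto simp: bare h_def v_def)
  thus ?thesis using admissible_sets hv by metis
qed

theorem maximal_tatami_iff:
  assumes "1 \<le> n"
  shows "maximal_tatami n T \<longleftrightarrow>
    (\<exists>A B. admissible (int n) A B \<and> T = tile_set n (pattern_h (int n) A B) (pattern_v (int n) A B))"
proof
  assume "\<exists>A B. admissible (int n) A B \<and> T = tile_set n (pattern_h (int n) A B) (pattern_v (int n) A B)"
  then obtain A B where AB: "admissible (int n) A B"
    "T = tile_set n (pattern_h (int n) A B) (pattern_v (int n) A B)" by blast
  interpret admissible_pattern "int n" A B using assms AB by unfold_locales auto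
  show "maximal_tatami n T" unfolding AB(2) by (rule maximal_tatami_tile_set) simp
qed (use maximal_tatami_pattern assms in blast)


section \<open>Transposition, counting and lookup of tiles\<close>

fun transpose_tile :: "tile \<Rightarrow> tile" where
  "transpose_tile (Mono r c) = Mono c r"
| "transpose_tile (HDom r c) = VDom c r"
| "transpose_tile (VDom r c) = HDom c r"

lemma transpose_transpose [simp]: "transpose_tile (transpose_tile t) = t"
  by (cases t) auto

lemma transpose_image_transpose [simp]: "transpose_tile ` transpose_tile ` T = T"
  by (simp add: image_image)

lemma inj_transpose: "inj transpose_tile"
  by (metis injI transpose_transpose)

lemma mem_transpose_image: "t \<in> transpose_tile ` T \<longleftrightarrow> transpose_tile t \<in> T"
  by (metis image_iff transpose_transpose)

lemma cells_transpose: "cells (transpose_tile t) = prod.swap ` cells t"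
  by (cases t) auto

lemma corners_transpose: "corners (transpose_tile t) = prod.swap ` corners t"
  by (cases t) auto

lemma covering_transpose:
  assumes "covering (grid n) T"
  shows "covering (grid n) (transpose_tile ` T)"
proof -
  have "prod.swap ` grid n = grid n" by (auto simp: grid_def)
  moreover have "(\<Union>t\<in>transpose_tile ` T. cells t) = prod.swap ` (\<Union>t\<in>T. cells t)"
    by (auto simp: cells_transpose)
  moreover have "prod.swap ` cells t \<inter> prod.swap ` cells u = {}"
    if "t \<in> T" "u \<in> T" "transpose_tile t \<noteq> transpose_tile u" for t u
    using that assms unfolding covering_def by (metis image_Int image_empty inj_swap)
  ultimately show ?thesis using assms by (auto simp: covering_def cells_transpose)
qed

lemma tatami_transpose:
  assumes "tatami T"
  shows "tatami (transpose_tile ` T)"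
  unfolding tatami_def
proof
  assume "\<exists>p. \<exists>S\<subseteq>transpose_tile ` T. card S = 4 \<and> (\<forall>t\<in>S. p \<in> corners t)"
  then obtain p S where S: "S \<subseteq> transpose_tile ` T" "card S = 4" "\<forall>t\<in>S. p \<in> corners t" by blast
  have "transpose_tile ` S \<subseteq> T" using S(1) by auto
  moreover have "card (transpose_tile ` S) = 4"
    using S(2) by (simp add: card_image inj_on_subset[OF inj_transpose])
  moreover have "\<forall>t\<in>transpose_tile ` S. prod.swap p \<in> corners t"
    using S(3) by (simp add: corners_transpose)
  ultimately show False using assms unfolding tatami_def by blast
qed

lemma card_swap: "card {(r, c). P c r} = card {(r, c). P r c}"
proof -
  have "{(r, c). P c r} = prod.swap ` {(r, c). P r c}" by auto
  thus ?thesis by (simp add: card_image)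
qed

lemma maximal_tatami_transpose:
  "odd n \<Longrightarrow> maximal_tatami n (transpose_tile ` T) \<longleftrightarrow>
    covering (grid n) T \<and> tatami T \<and> card {(r, c). Mono r c \<in> T} = n \<and> Mono 0 0 \<in> T \<and> Mono 0 (n - 1) \<in> T"
  using covering_transpose[of n T] covering_transpose[of n "transpose_tile ` T"]
    tatami_transpose[of T] tatami_transpose[of "transpose_tile ` T"] card_swap[of "\<lambda>r c. Mono r c \<in> T"]
  by (auto simp: maximal_tatami_def mem_transpose_image)

section \<open>Coverings parametrised by pairs of sets\<close>

definition flip_pairs :: "nat \<Rightarrow> (nat set \<times> nat set) set" where
  "flip_pairs m = {(A, B). A \<subseteq> {1..m} \<and> B \<subseteq> {1..m} \<and> (\<forall>a\<in>A. \<forall>b\<in>B. a + b \<le> m)}"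

definition base_tiling :: "nat \<Rightarrow> nat set \<times> nat set \<Rightarrow> tile set" where
  "base_tiling n = (\<lambda>(A, B). tile_set n (pattern_h (int n) (int ` A) (int ` B))
     (pattern_v (int n) (int ` A) (int ` B)))"

definition tiling :: "nat \<Rightarrow> nat set \<times> nat set \<Rightarrow> tile set" where
  "tiling n P = (if even n then base_tiling n P else transpose_tile ` base_tiling n P)"

lemma admissible_int_image:
  "(A, B) \<in> flip_pairs (n - 2) \<Longrightarrow> admissible (int n) (int ` A) (int ` B)"
  unfolding admissible_def flip_pairs_def by (fastforce simp: subset_iff)

lemma admissible_int_imageE:
  assumes "admissible (int n) A B"
  obtains A' B' where "(A', B') \<in> flip_pairs (n - 2)" "A = int ` A'" "B = int ` B'"
proof
  have rA: "1 \<le> a \<and> a \<le> int n - 2" if "a \<in> A" for a using assms that by (auto simp: admissible_def)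
  have rB: "1 \<le> b \<and> b \<le> int n - 2" if "b \<in> B" for b using assms that by (auto simp: admissible_def)
  show "A = int ` nat ` A" "B = int ` nat ` B" using rA rB by (force simp: image_image)+
  have "nat a + nat b \<le> n - 2" if ab: "a \<in> A" "b \<in> B" for a b
  proof -
    have "a + b \<le> int n - 2" using ab assms by (simp add: admissible_def)
    thus ?thesis using rA[OF ab(1)] rB[OF ab(2)] by linarith
  qed
  moreover have "nat a \<in> {1..n - 2}" if "a \<in> A" for a using rA[OF that] by auto
  moreover have "nat b \<in> {1..n - 2}" if "b \<in> B" for b using rB[OF that] by auto
  ultimately show "(nat ` A, nat ` B) \<in> flip_pairs (n - 2)" by (auto simp: flip_pairs_def)
qed

lemma admissible_patternI:
  "1 \<le> n \<Longrightarrow> (A, B) \<in> flip_pairs (n - 2) \<Longrightarrow> admissible_pattern (int n) (int ` A) (int ` B)"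
  using admissible_int_image by unfold_locales auto

lemma maximal_tatami_base_tiling:
  assumes "1 \<le> n"
  shows "maximal_tatami n T \<longleftrightarrow> T \<in> base_tiling n ` flip_pairs (n - 2)"
proof
  assume "maximal_tatami n T"
  then obtain A B where "admissible (int n) A B"
    and T: "T = tile_set n (pattern_h (int n) A B) (pattern_v (int n) A B)"
    using maximal_tatami_iff[OF assms] by blast
  from this(1) show "T \<in> base_tiling n ` flip_pairs (n - 2)"
    by (rule admissible_int_imageE) (auto simp: T base_tiling_def)
next
  assume "T \<in> base_tiling n ` flip_pairs (n - 2)"
  thus "maximal_tatami n T"
    unfolding maximal_tatami_iff[OF assms] base_tiling_def using admissible_int_image by fastforce
qed

lemma inj_on_base_tiling:
  assumes "1 \<le> n"
  shows "inj_on (base_tiling n) (flip_pairs (n - 2))"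
proof (rule inj_onI, clarify)
  fix A B A' B' assume P: "(A, B) \<in> flip_pairs (n - 2)" "(A', B') \<in> flip_pairs (n - 2)"
    and eq: "base_tiling n (A, B) = base_tiling n (A', B')"
  interpret P: admissible_pattern "int n" "int ` A" "int ` B" by (rule admissible_patternI[OF assms P(1)])
  interpret Q: admissible_pattern "int n" "int ` A'" "int ` B'" by (rule admissible_patternI[OF assms P(2)])
  have "P.v r c = Q.v r c" for r c
  proof (cases "0 \<le> r \<and> 0 \<le> c")
    case True
    have "VDom (nat r) (nat c) \<in> base_tiling n (A, B) \<longleftrightarrow> VDom (nat r) (nat c) \<in> base_tiling n (A', B')"
      using eq by simp
    thus ?thesis using True by (simp add: base_tiling_def)
  qed (auto simp: pattern_v_def)
  hence "P.v = Q.v" by (intro ext)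
  hence "int ` A = int ` A'" "int ` B = int ` B'"
    using pattern_inject[OF P.n_pos P.admissible Q.admissible] by blast+
  thus "A = A' \<and> B = B'" by (auto simp: inj_image_eq_iff)
qed

lemma inj_on_tiling: "1 \<le> n \<Longrightarrow> inj_on (tiling n) (flip_pairs (n - 2))"
  using inj_on_base_tiling[of n] inj_image_eq_iff[OF inj_transpose]
  unfolding inj_on_def tiling_def by (auto split: if_splits)

lemma sum_int_image: "\<Sum>(int ` A) = int (\<Sum>A)"
  by (simp add: sum.reindex)

lemma card_base_tiling:
  assumes "1 \<le> n" "(A, B) \<in> flip_pairs (n - 2)"
  shows "card {(r, c). VDom r c \<in> base_tiling n (A, B)} = \<Sum>A + \<Sum>B"
    "2 * card {(r, c). HDom r c \<in> base_tiling n (A, B)} + 2 * (\<Sum>A + \<Sum>B) = n * (n - 1)"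
proof -
  interpret admissible_pattern "int n" "int ` A" "int ` B" by (rule admissible_patternI[OF assms])
  have "card {(r, c). VDom r c \<in> base_tiling n (A, B)} = card {(r, c). v r c}"
    unfolding base_tiling_def prod.case tile_set_simps
    by (rule card_nat_pairs) (simp add: pattern_v_def)
  hence "int (card {(r, c). VDom r c \<in> base_tiling n (A, B)}) = int (\<Sum>A + \<Sum>B)"
    using card_vertical unfolding sum_int_image of_nat_add by simp
  thus "card {(r, c). VDom r c \<in> base_tiling n (A, B)} = \<Sum>A + \<Sum>B"
    unfolding of_nat_eq_iff .
  have "card {(r, c). HDom r c \<in> base_tiling n (A, B)} = card {(r, c). h r c}"
    unfolding base_tiling_def prod.case tile_set_simps
    by (rule card_nat_pairs) (simp add: pattern_h_def)
  hence "int (2 * card {(r, c). HDom r c \<in> base_tiling n (A, B)} + 2 * (\<Sum>A + \<Sum>B)) = int (n * (n - 1))"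
    using card_horizontal assms(1) unfolding sum_int_image by (simp add: of_nat_diff)
  thus "2 * card {(r, c). HDom r c \<in> base_tiling n (A, B)} + 2 * (\<Sum>A + \<Sum>B) = n * (n - 1)"
    unfolding of_nat_eq_iff .
qed

definition flip_weight :: "nat set \<times> nat set \<Rightarrow> nat" where
  "flip_weight = (\<lambda>(A, B). \<Sum>A + \<Sum>B)"

text \<open>For odd \<open>n\<close> the vertical dominoes are the horizontal ones of the transposed
  pattern, so their number is the complement of the flips among all \<open>n * (n - 1) div 2\<close>
  dominoes.\<close>

theorem V_eq_tilings:
  assumes "1 \<le> n"
  shows "V n k = tiling n ` {P \<in> flip_pairs (n - 2).
    if even n then flip_weight P = k else flip_weight P + k = n * (n - 1) div 2}"
proof (cases "even n")
  case True
  have "V n k = {T. maximal_tatami n T \<and> card {(r, c). VDom r c \<in> T} = k}"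
    using True by (auto simp: V_def maximal_tatami_def)
  thus ?thesis
    using True card_base_tiling(1)[OF assms]
    by (auto simp: maximal_tatami_base_tiling[OF assms] tiling_def flip_weight_def)
next
  case False
  have count: "card {(r, c). VDom r c \<in> T} = card {(r, c). HDom r c \<in> transpose_tile ` T}" for T
    using card_swap[of "\<lambda>r c. VDom r c \<in> T"] by (simp add: mem_transpose_image)
  have tiling: "T = tiling n P \<longleftrightarrow> transpose_tile ` T = base_tiling n P" for T P
    using False unfolding tiling_def by (metis transpose_image_transpose)
  have weight: "card {(r, c). HDom r c \<in> base_tiling n P} = k \<longleftrightarrow> flip_weight P + k = n * (n - 1) div 2"
    if "P \<in> flip_pairs (n - 2)" for P
  proof (cases P)
    case (Pair A B)
    with that have "(A, B) \<in> flip_pairs (n - 2)" by simp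
    from card_base_tiling(2)[OF assms this]
    have "n * (n - 1) = 2 * (card {(r, c). HDom r c \<in> base_tiling n (A, B)} + (\<Sum>A + \<Sum>B))"
      by simp
    hence "n * (n - 1) div 2 = card {(r, c). HDom r c \<in> base_tiling n (A, B)} + (\<Sum>A + \<Sum>B)"
      by (metis nonzero_mult_div_cancel_left zero_neq_numeral)
    thus ?thesis by (auto simp: Pair flip_weight_def)
  qed
  show ?thesis
  proof (intro set_eqI)
    fix T
    have "T \<in> V n k \<longleftrightarrow> maximal_tatami n (transpose_tile ` T) \<and> card {(r, c). HDom r c \<in> transpose_tile ` T} = k"
      using False count[of T] by (auto simp: V_def maximal_tatami_transpose)
    also have "\<dots> \<longleftrightarrow> (\<exists>P\<in>flip_pairs (n - 2). transpose_tile ` T = base_tiling n P \<and>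
        card {(r, c). HDom r c \<in> base_tiling n P} = k)"
      unfolding maximal_tatami_base_tiling[OF assms] by (auto simp del: mem_transpose_image)
    also have "\<dots> \<longleftrightarrow> (\<exists>P\<in>flip_pairs (n - 2). transpose_tile ` T = base_tiling n P \<and>
        flip_weight P + k = n * (n - 1) div 2)"
      by (simp add: weight cong: bex_cong conj_cong)
    finally show "T \<in> V n k \<longleftrightarrow> T \<in> tiling n ` {P \<in> flip_pairs (n - 2).
        if even n then flip_weight P = k else flip_weight P + k = n * (n - 1) div 2}"
      using False tiling by (auto simp: image_iff)
  qed
qed

text \<open>Both kinds of strip index are values of this one fold, at e and at n + d respectively,
  so the lookup program can use the same code for both.\<close>

definition fold_strip :: "nat \<Rightarrow> nat \<Rightarrow> nat" where
  "fold_strip n e = (if e < n then e else 2 * n - 1 - e)"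

text \<open>Adding or subtracting \<open>p\<close> yields the even number of the strip. Odd cells of
  the first kind of strip and even cells of the second kind are upper halves, hence the test
  \<open>a = (p = 1)\<close>. A cell whose partner would lie outside of the grid is a
  monomino.\<close>

definition base_lookup :: "nat \<Rightarrow> nat set \<Rightarrow> nat set \<Rightarrow> nat \<Rightarrow> nat \<Rightarrow> tile" where
  "base_lookup n A B i j =
     (let p = (i + j) mod 2; a = (fold_strip n (i + j + p) \<in> A); b = (fold_strip n (n + i - j - p) \<in> B)
      in if a \<or> b then
           if a = (p = 1) then if i = n - 1 then Mono i j else VDom i j
           else if i = 0 then Mono i j else VDom (i - 1) j
         else if p = 1 then if j = n - 1 then Mono i j else HDom i j
         else if j = 0 then Mono i j else HDom i (j - 1))"

lemma base_lookup:
  assumes n: "1 \<le> n" and P: "(A, B) \<in> flip_pairs (n - 2)" and ij: "i < n" "j < n"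
  shows "base_lookup n A B i j \<in> base_tiling n (A, B)" "(i, j) \<in> cells (base_lookup n A B i j)"
proof -
  interpret admissible_pattern "int n" "int ` A" "int ` B" by (rule admissible_patternI[OF n P])
  define p where "p = (i + j) mod 2"
  define a where "a \<longleftrightarrow> fold_strip n (i + j + p) \<in> A"
  define b where "b \<longleftrightarrow> fold_strip n (n + i - j - p) \<in> B"
  have p: "p = 0 \<and> even (i + j) \<or> p = 1 \<and> odd (i + j)" unfolding p_def by presburger
  have sum: "i + j + p \<le> 2 * n - 2 + p" and "i + j + p \<noteq> 2 * n"
    using ij p by auto
  have "anti_strip (int n) (int (i + j + p)) = int (fold_strip n (i + j + p))"
    using ij p by (auto simp: anti_strip_def fold_strip_def)
  hence a: "anti_strip (int n) (int i + int j + int p) \<in> int ` A \<longleftrightarrow> a"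
    by (simp add: a_def image_iff)
  have "main_strip (int n) (int i - int j - int p) = int (fold_strip n (n + i - j - p))"
    using ij p by (auto simp: main_strip_def fold_strip_def)
  hence b: "main_strip (int n) (int i - int j - int p) \<in> int ` B \<longleftrightarrow> b"
    by (simp add: b_def image_iff)
  have shift: "int i - 1 + int j + 1 = int i + int j" "int i + (int j - 1) + 1 = int i + int j"
    "int i - 1 - int j = int i - int j - 1" "int i - (int j - 1) - 1 = int i - int j" by simp_all
  have even_p: "even (int i + int j)" "a \<longleftrightarrow> anti_strip (int n) (int i + int j) \<in> int ` A"
    "b \<longleftrightarrow> main_strip (int n) (int i - int j) \<in> int ` B" if "p = 0"
    using that p a b by simp_all
  have odd_p: "odd (int i + int j)" "a \<longleftrightarrow> anti_strip (int n) (int i + int j + 1) \<in> int ` A"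
    "b \<longleftrightarrow> main_strip (int n) (int i - int j - 1) \<in> int ` B" if "p = 1"
    using that p a b by simp_all
  have range: "int i < int n" "int j < int n" "int i + 1 < int n \<longleftrightarrow> i + 1 < n" "int j + 1 < int n \<longleftrightarrow> j + 1 < n"
    "0 \<le> int i - 1 \<longleftrightarrow> 1 \<le> i" "0 \<le> int j - 1 \<longleftrightarrow> 1 \<le> j"
    using ij by auto
  have H: "h (int i) (int j) \<longleftrightarrow> j + 1 < n \<and> p = 1 \<and> \<not> a \<and> \<not> b"
    using range p even_p(1) odd_p unfolding pattern_h_def by (cases "p = 1") simp_all
  have H': "h (int i) (int j - 1) \<longleftrightarrow> 1 \<le> j \<and> p = 0 \<and> \<not> a \<and> \<not> b"
    using range p even_p odd_p(1) unfolding pattern_h_def shift by (cases "p = 1") simp_all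
  have V: "v (int i) (int j) \<longleftrightarrow> i + 1 < n \<and> (if p = 1 then a else b)"
    using range p even_p odd_p unfolding pattern_v_def by (cases "p = 1") simp_all
  have V': "v (int i - 1) (int j) \<longleftrightarrow> 1 \<le> i \<and> (if p = 1 then b else a)"
    using range p even_p odd_p unfolding pattern_v_def shift by (cases "p = 1") simp_all
  have ab: "\<not> (a \<and> b)"
    using disjoint_strips[of "int i" "int j"] disjoint_strips_odd[of "int i" "int j"] range p even_p odd_p
    by (cases "p = 1") simp_all
  have eq: "base_lookup n A B i j =
      (if a \<or> b then
         if a = (p = 1) then if i = n - 1 then Mono i j else VDom i j
         else if i = 0 then Mono i j else VDom (i - 1) j
       else if p = 1 then if j = n - 1 then Mono i j else HDom i j
       else if j = 0 then Mono i j else HDom i (j - 1))"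
    by (simp add: base_lookup_def a_def b_def p_def Let_def)
  have H'': "h (int i) (int (j - 1)) \<longleftrightarrow> p = 0 \<and> \<not> a \<and> \<not> b" if "j \<noteq> 0"
    using that H' by (simp add: of_nat_diff)
  have V'': "v (int (i - 1)) (int j) \<longleftrightarrow> (if p = 1 then b else a)" if "i \<noteq> 0"
    using that V' by (simp add: of_nat_diff)
  have M: "bare (int i) (int j) \<longleftrightarrow> \<not> (j + 1 < n \<and> p = 1 \<and> \<not> a \<and> \<not> b) \<and> \<not> (1 \<le> j \<and> p = 0 \<and> \<not> a \<and> \<not> b)
      \<and> \<not> (i + 1 < n \<and> (if p = 1 then a else b)) \<and> \<not> (1 \<le> i \<and> (if p = 1 then b else a))"
    unfolding bare_def H H' V V' using ij by simp
  have last: "i = n - 1 \<longleftrightarrow> \<not> i + 1 < n" "j = n - 1 \<longleftrightarrow> \<not> j + 1 < n" using ij by auto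
  have p01: "p \<noteq> 1 \<longleftrightarrow> p = 0" using p by auto
  show "base_lookup n A B i j \<in> base_tiling n (A, B)"
  proof (cases "a \<or> b")
    case True
    show ?thesis
    proof (cases "a = (p = 1)")
      case y: True
      hence "(if p = 1 then a else b)" "\<not> (if p = 1 then b else a)" using True ab by auto
      thus ?thesis unfolding eq base_tiling_def prod.case last using True y V M by simp
    next
      case y: False
      hence "(if p = 1 then b else a)" "\<not> (if p = 1 then a else b)" using True ab by auto
      thus ?thesis unfolding eq base_tiling_def prod.case using True y V'' M by (cases "i = 0") simp_all
    qed
  next
    case False
    hence *: "\<not> (if p = 1 then a else b)" "\<not> (if p = 1 then b else a)" by auto
    show ?thesis
    proof (cases "p = 1")
      case True
      thus ?thesis unfolding eq base_tiling_def prod.case last using False * H M by simp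
    next
      case q: False
      thus ?thesis unfolding eq base_tiling_def prod.case using False * H'' M p01 by (cases "j = 0") simp_all
    qed
  qed
  show "(i, j) \<in> cells (base_lookup n A B i j)"
    unfolding eq by auto
qed


section \<open>A tree of sets with equal sums\<close>

text \<open>
  \<open>g\<close> is the least positive gap of \<open>A\<close> and \<open>x\<close> the largest gap below the maximum \<open>M\<close>, with \<open>x = 0\<close>
  if there is none. In this case \<open>A = {1..M}\<close> and \<open>g = M + 1\<close>. A set with \<open>g < x\<close> has as parent the
  set in which \<open>g - 1\<close> moves to \<open>g\<close> and \<open>x + 1\<close> moves to \<open>x\<close>,
  where an element 0 may be created or removed at will.
\<close>

definition gaps :: "nat set \<Rightarrow> nat \<Rightarrow> nat \<Rightarrow> nat \<Rightarrow> bool" where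
  "gaps A g x M \<longleftrightarrow> A \<subseteq> {1..M} \<and> (0 < M \<longrightarrow> M \<in> A) \<and> 1 \<le> g \<and> g \<notin> A \<and> {1..<g} \<subseteq> A \<and>
     x \<le> M \<and> x \<notin> A \<and> {x<..M} \<subseteq> A"

definition spread :: "nat set \<Rightarrow> nat \<Rightarrow> nat \<Rightarrow> nat set" where
  "spread A g x = A - {g, x} \<union> ({g - 1, x + 1} - {0})"

definition unspread :: "nat set \<Rightarrow> nat \<Rightarrow> nat \<Rightarrow> nat set" where
  "unspread A g x = A - {g - 1, x + 1} \<union> {g, x}"

lemma gaps_unique:
  assumes "gaps A g x M" "gaps A g' x' M'"
  shows "g = g' \<and> x = x' \<and> M = M'"
proof -
  have M: "M = M'"
  proof (rule antisym)
    show "M \<le> M'" using assms unfolding gaps_def by (cases "M = 0") fastforce+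
    show "M' \<le> M" using assms unfolding gaps_def by (cases "M' = 0") fastforce+
  qed
  have "g = g'" using assms unfolding gaps_def
    by (metis atLeastLessThan_iff linorder_neqE_nat subsetD)
  moreover have "x = x'" using assms M unfolding gaps_def
    by (metis greaterThanAtMost_iff linorder_neqE_nat subsetD)
  ultimately show ?thesis using M by simp
qed

lemma gaps_exist:
  assumes "finite A" "0 \<notin> A"
  obtains g x M where "gaps A g x M"
proof -
  define M where "M = Max (insert 0 A)"
  define g where "g = (LEAST g. 1 \<le> g \<and> g \<notin> A)"
  define x where "x = Max {x. x \<le> M \<and> x \<notin> A}"
  have M: "a \<le> M" if "a \<in> A" for a using assms that by (simp add: M_def)
  have "M \<in> insert 0 A" unfolding M_def using assms by (intro Max_in) auto
  have "1 \<le> Suc M \<and> Suc M \<notin> A" using M by fastforce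
  hence g: "1 \<le> g \<and> g \<notin> A" unfolding g_def by (rule LeastI)
  have "a \<in> A" if "1 \<le> a" "a < g" for a
    using not_less_Least[of a "\<lambda>g. 1 \<le> g \<and> g \<notin> A"] that by (auto simp: g_def)
  moreover have fin: "finite {x. x \<le> M \<and> x \<notin> A}" by simp
  moreover have "x \<in> {x. x \<le> M \<and> x \<notin> A}" unfolding x_def using assms by (intro Max_in[OF fin]) auto
  moreover have "a \<in> A" if "x < a" "a \<le> M" for a
    using Max_ge[OF fin, of a] that by (fastforce simp: x_def)
  moreover have "1 \<le> a" if "a \<in> A" for a using assms that by (cases a) auto
  ultimately have "gaps A g x M"
    using M g \<open>M \<in> insert 0 A\<close> by (auto simp: gaps_def)
  thus ?thesis by (rule that)
qed

lemma gaps_finite: "gaps A g x M \<Longrightarrow> finite A"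
  unfolding gaps_def by (meson finite_atLeastAtMost finite_subset)

lemma gaps_zero: "gaps A g x M \<Longrightarrow> 0 \<notin> A"
  unfolding gaps_def by auto

lemma gaps_le: "gaps A g x M \<Longrightarrow> a \<in> A \<Longrightarrow> a \<le> M"
  unfolding gaps_def by auto

text \<open>After the move everything in \<open>{1..<g}\<close> must be filled, which leaves only
  \<open>g = 1\<close> and \<open>g = G + 1\<close>; the same holds above \<open>x\<close>. The
  places of the move thus are the extreme gaps of the result, so the result remembers how it
  arose.\<close>

lemma gaps_spread:
  assumes A: "gaps A G X M" and g: "g \<in> A" "g = 1 \<or> g = G + 1" and x: "x \<in> A" "x = M \<or> x + 1 = X"
    and "g < x"
  shows "gaps (spread A g x) g x (max M (x + 1))"
proof -
  have "x \<le> M" "1 \<le> g" using gaps_le[OF A x(1)] gaps_zero[OF A] g by (cases g; auto)+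
  have "X \<noteq> M \<or> M = 0" using A by (auto simp: gaps_def)
  have 1: "spread A g x \<subseteq> {1..max M (x + 1)}"
    using A \<open>x \<le> M\<close> gaps_le[OF A g(1)] by (auto simp: gaps_def spread_def)
  have 2: "max M (x + 1) \<in> spread A g x"
    using A x g \<open>x \<le> M\<close> \<open>g < x\<close> by (auto simp: gaps_def spread_def max_def)
  have 3: "{1..<g} \<subseteq> spread A g x"
    using A g \<open>g < x\<close> by (auto simp: gaps_def spread_def)
  have 4: "{x<..max M (x + 1)} \<subseteq> spread A g x"
  proof
    fix a assume "a \<in> {x<..max M (x + 1)}"
    thus "a \<in> spread A g x"
      using A x \<open>g < x\<close> by (cases "a = x + 1") (auto simp: gaps_def spread_def)
  qed
  show ?thesis
    using 1 2 3 4 \<open>1 \<le> g\<close> \<open>g < x\<close> by (auto simp: gaps_def) (auto simp: spread_def)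
qed

lemma spread_fresh:
  assumes A: "gaps A G X M" and g: "g \<in> A" "g = 1 \<or> g = G + 1" and x: "x \<in> A" "x = M \<or> x + 1 = X"
  shows "g - 1 \<notin> A" "x + 1 \<notin> A"
proof -
  show "g - 1 \<notin> A" using A g gaps_zero[OF A] by (auto simp: gaps_def)
  show "x + 1 \<notin> A"
  proof
    assume "x + 1 \<in> A"
    thus False using A x gaps_le[OF A \<open>x + 1 \<in> A\<close>] by (auto simp: gaps_def)
  qed
qed

text \<open>The hypothesis on \<open>f 0\<close> absorbs an element that moves to 0 and is dropped.
  The lemma serves sums and sums of squares.\<close>

lemma sum_spread:
  fixes f :: "nat \<Rightarrow> nat"
  assumes "finite A" "g \<in> A" "x \<in> A" "g < x" "g - 1 \<notin> A" "x + 1 \<notin> A" "f 0 = 0" "1 \<le> g"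
  shows "sum f (spread A g x) + f g + f x = sum f A + f (g - 1) + f (x + 1)"
proof -
  have "sum f A = sum f (A - {g, x}) + f g + f x"
    using assms sum.subset_diff[of "{g, x}" A f] by simp
  moreover have "sum f (spread A g x) = sum f (A - {g, x}) + sum f ({g - 1, x + 1} - {0})"
    unfolding spread_def using assms by (intro sum.union_disjoint) auto
  moreover have "sum f ({g - 1, x + 1} - {0}) = f (g - 1) + f (x + 1)"
    using assms by (cases "g - 1 = 0") (auto simp: insert_Diff_if)
  ultimately show ?thesis by simp
qed

lemma unspread_spread:
  assumes "g \<in> A" "x \<in> A" "g - 1 \<notin> A" "x + 1 \<notin> A" "g < x" "1 \<le> g"
  shows "unspread (spread A g x) g x = A"
  using assms by (auto simp: unspread_def spread_def)

lemma spread_unspread: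
  assumes Q: "gaps Q g x M" and "g < x"
  shows "spread (unspread Q g x) g x = Q"
proof -
  have "x < M" using Q \<open>g < x\<close> by (cases "x = M") (auto simp: gaps_def)
  hence "x + 1 \<in> Q" using Q by (auto simp: gaps_def)
  moreover have "a \<in> Q" if "1 \<le> a" "a < g" for a using Q that by (auto simp: gaps_def)
  from this[of "g - 1"] have "g - 1 = 0 \<or> g - 1 \<in> Q" by linarith
  ultimately show ?thesis using Q gaps_zero[OF Q] \<open>g < x\<close> by (auto simp: unspread_def spread_def gaps_def)
qed

text \<open>Every set with \<open>g < x\<close> arises by a legal move. Its parent has no larger
  maximum, so the bound \<open>m\<close> survives the way up.\<close>

lemma gaps_unspread:
  assumes Q: "gaps Q g x M" and "g < x"
  obtains G X M' where "gaps (unspread Q g x) G X M'" "g = 1 \<or> g = G + 1" "x = M' \<or> x + 1 = X"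
    "M' \<le> M" "M = max M' (x + 1)"
proof -
  let ?A = "unspread Q g x"
  have "x < M" "1 \<le> g" using Q \<open>g < x\<close> by (cases "x = M"; auto simp: gaps_def)+
  have fin: "finite ?A" "0 \<notin> ?A"
    using gaps_finite[OF Q] gaps_zero[OF Q] \<open>1 \<le> g\<close> \<open>g < x\<close> by (auto simp: unspread_def)
  then obtain G X M' where A: "gaps ?A G X M'" by (rule gaps_exist)
  have "a \<le> M" if "a \<in> ?A" for a
    using that gaps_le[OF Q] \<open>x < M\<close> \<open>g < x\<close> by (auto simp: unspread_def)
  moreover have "M' = 0 \<or> M' \<in> ?A" using A by (auto simp: gaps_def)
  ultimately have "M' \<le> M" by auto
  have xA: "x \<in> ?A" "g \<in> ?A" by (auto simp: unspread_def)
  have fresh: "g - 1 \<notin> ?A" "x + 1 \<notin> ?A" using \<open>1 \<le> g\<close> \<open>g < x\<close> by (auto simp: unspread_def)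
  have "g = 1 \<or> g = G + 1"
  proof (rule ccontr)
    assume "\<not> ?thesis"
    hence "2 \<le> g" "G \<noteq> g - 1" using \<open>1 \<le> g\<close> by auto
    have "a \<in> Q" if "1 \<le> a" "a < g" for a using Q that by (auto simp: gaps_def)
    hence "{1..<g - 1} \<subseteq> ?A" using \<open>g < x\<close> by (auto simp: unspread_def)
    hence "G = g - 1" using A fresh(1) \<open>2 \<le> g\<close> unfolding gaps_def
      by (metis One_nat_def Suc_leI atLeastLessThan_iff linorder_neqE_nat nat_1_add_1 plus_1_eq_Suc subsetD
          zero_less_diff Suc_le_lessD)
    with \<open>G \<noteq> g - 1\<close> show False by simp
  qed
  moreover have "(x = M' \<or> x + 1 = X) \<and> M = max M' (x + 1)"
  proof (cases "M = x + 1")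
    case True
    have "a \<le> x" if "a \<in> ?A" for a
      using that gaps_le[OF Q, of a] True \<open>g < x\<close> by (cases "a = x + 1") (auto simp: unspread_def)
    hence "M' = x" using xA(1) gaps_le[OF A xA(1)] \<open>M' = 0 \<or> M' \<in> ?A\<close> by fastforce
    thus ?thesis using True by simp
  next
    case False
    hence "x + 1 < M" using \<open>x < M\<close> by simp
    hence "M \<in> ?A" using Q \<open>g < x\<close> by (auto simp: gaps_def unspread_def)
    hence "M' = M" using gaps_le[OF A] \<open>M' \<le> M\<close> by fastforce
    have "{x + 1<..M} \<subseteq> ?A" using Q \<open>g < x\<close> by (auto simp: gaps_def unspread_def)
    hence "\<not> x + 1 < X" using A \<open>M' = M\<close> by (auto simp: gaps_def)
    moreover have "a \<in> ?A" if "X < a" "a \<le> M" for a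
      using A that \<open>M' = M\<close> by (auto simp: gaps_def)
    hence "\<not> X < x + 1" using fresh(2) \<open>x + 1 < M\<close> by fastforce
    ultimately have "X = x + 1" by simp
    with \<open>M' = M\<close> \<open>x + 1 < M\<close> show ?thesis by simp
  qed
  ultimately show ?thesis using that A \<open>M' \<le> M\<close> by blast
qed

text \<open>
  A node carries the two sets together with their least gaps, largest gaps and maxima. The index 0
  belongs to the first set of a pair, the index 1 to the second set. The kids are numbered by
  \<open>4 * side + 2 * low + high\<close>: the low bit decides whether a move starts at 1 or right above the least
  gap, the high bit whether it starts at the maximum or right below the largest gap.
\<close>

type_synonym node = "(nat \<Rightarrow> nat set) \<times> (nat \<Rightarrow> nat) \<times> (nat \<Rightarrow> nat) \<times> (nat \<Rightarrow> nat)"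

definition side :: "nat \<Rightarrow> nat" where "side c = c div 4"

definition low :: "nat \<Rightarrow> node \<Rightarrow> nat" where
  "low c = (\<lambda>(S, G, X, M). if c div 2 mod 2 = 0 then 1 else G (side c) + 1)"

definition high :: "nat \<Rightarrow> node \<Rightarrow> nat" where
  "high c = (\<lambda>(S, G, X, M). if c mod 2 = 0 then M (side c) else X (side c) - 1)"

text \<open>The second set may move only while the first one is compact,
  \<open>X 0 \<le> G 0\<close>, whereas a move of the first set leaves it non-compact. So a node
  reveals which set moved last. An even \<open>c\<close> raises a maximum by one, hence the last
  condition.\<close>

definition has_kid :: "nat \<Rightarrow> nat \<Rightarrow> node \<Rightarrow> bool" where
  "has_kid m c v = (case v of (S, G, X, M) \<Rightarrow> low c v \<in> S (side c) \<and> high c v \<in> S (side c) \<and> low c v < high c v \<and>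
     (side c = 0 \<or> X 0 \<le> G 0) \<and> (c mod 2 = 0 \<longrightarrow> M 0 + M 1 + 1 \<le> m))"

definition kid :: "nat \<Rightarrow> node \<Rightarrow> node" where
  "kid c v = (case v of (S, G, X, M) \<Rightarrow>
     (S(side c := spread (S (side c)) (low c v) (high c v)), G(side c := low c v), X(side c := high c v),
      if c mod 2 = 0 then M(side c := high c v + 1) else M))"

definition sets :: "node \<Rightarrow> nat set \<times> nat set" where
  "sets v = (case v of (S, G, X, M) \<Rightarrow> (S 0, S 1))"

definition proper :: "nat \<Rightarrow> node \<Rightarrow> bool" where
  "proper m v = (case v of (S, G, X, M) \<Rightarrow>
     gaps (S 0) (G 0) (X 0) (M 0) \<and> gaps (S 1) (G 1) (X 1) (M 1) \<and> M 0 + M 1 \<le> m)"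

definition kids :: "nat \<Rightarrow> node \<Rightarrow> node list" where
  "kids m v = map (\<lambda>c. kid c v) (filter (\<lambda>c. has_kid m c v) [0..<8])"

text \<open>
  The second argument bounds the depth. Each move increases the sum of the squares, so \<open>2 * m ^ 3\<close>
  is enough.
\<close>

fun subtree :: "nat \<Rightarrow> nat \<Rightarrow> node \<Rightarrow> node list" where
  "subtree m 0 v = [v]"
| "subtree m (Suc f) v = v # concat (map (subtree m f) (kids m v))"

definition squares :: "nat set \<times> nat set \<Rightarrow> nat" where
  "squares = (\<lambda>(A, B). (\<Sum>a\<in>A. a\<^sup>2) + (\<Sum>b\<in>B. b\<^sup>2))"

definition weights :: "nat set \<times> nat set \<Rightarrow> nat \<times> nat" where
  "weights = (\<lambda>(A, B). (\<Sum>A, \<Sum>B))"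

text \<open>Two elements \<open>g < x\<close> move apart by one each, which keeps the sum and
  increases the squares. This orients the tree and bounds its height.\<close>

lemma square_spread:
  assumes "gaps A G X M" "g \<in> A" "g = 1 \<or> g = G + 1" "x \<in> A" "x = M \<or> x + 1 = X" "g < x"
  shows "\<Sum>(spread A g x) = \<Sum>A" "(\<Sum>a\<in>A. a\<^sup>2) < (\<Sum>a\<in>spread A g x. a\<^sup>2)"
proof -
  have "1 \<le> g" using gaps_zero[OF assms(1)] assms(2) by (cases g) auto
  note fresh = spread_fresh[OF assms(1-5)]
  have "\<Sum>(spread A g x) + g + x = \<Sum>A + (g - 1) + (x + 1)"
    using sum_spread[of A g x "\<lambda>a. a"] fresh assms gaps_finite \<open>1 \<le> g\<close> by auto
  thus "\<Sum>(spread A g x) = \<Sum>A" using \<open>1 \<le> g\<close> by simp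
  have "(\<Sum>a\<in>spread A g x. a\<^sup>2) + g\<^sup>2 + x\<^sup>2 = (\<Sum>a\<in>A. a\<^sup>2) + (g - 1)\<^sup>2 + (x + 1)\<^sup>2"
    using sum_spread[of A g x "\<lambda>a. a\<^sup>2"] fresh assms gaps_finite \<open>1 \<le> g\<close> by auto
  moreover obtain g' where "g = g' + 1" using \<open>1 \<le> g\<close> by (metis add.commute le_Suc_ex)
  ultimately show "(\<Sum>a\<in>A. a\<^sup>2) < (\<Sum>a\<in>spread A g x. a\<^sup>2)"
    using \<open>g < x\<close> by (simp add: power2_eq_square)
qed

section \<open>Kids and the uniqueness of the parent\<close>

lemma side_cases: "c < 8 \<Longrightarrow> side c = 0 \<or> side c = 1"
  unfolding side_def by auto

lemma kid_gaps:
  assumes v: "proper m v" and c: "c < 8" "has_kid m c v" and eq: "v = (S, G, X, M)"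
  shows "gaps (S (side c)) (G (side c)) (X (side c)) (M (side c))"
    "low c v = 1 \<or> low c v = G (side c) + 1" "high c v = M (side c) \<or> high c v + 1 = X (side c)"
    "low c v \<in> S (side c)" "high c v \<in> S (side c)" "low c v < high c v"
proof -
  show 1: "gaps (S (side c)) (G (side c)) (X (side c)) (M (side c))"
    using v side_cases[OF c(1)] unfolding eq proper_def by auto
  show "low c v \<in> S (side c)" and 2: "high c v \<in> S (side c)" "low c v < high c v"
    using c(2) unfolding eq has_kid_def by auto
  show "low c v = 1 \<or> low c v = G (side c) + 1" unfolding eq low_def by simp
  show "high c v = M (side c) \<or> high c v + 1 = X (side c)"
    using 2 unfolding eq high_def by auto
qed

lemma kid_max:
  assumes v: "proper m v" and c: "c < 8" "has_kid m c v" and eq: "v = (S, G, X, M)"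
  shows "(if c mod 2 = 0 then high c v + 1 else M (side c)) = max (M (side c)) (high c v + 1)"
proof (cases "c mod 2 = 0")
  case True
  thus ?thesis unfolding eq high_def by simp
next
  case False
  hence "high c v + 1 = X (side c)" using kid_gaps(6)[OF assms] unfolding eq high_def by auto
  moreover have "X (side c) \<le> M (side c)" using kid_gaps(1)[OF assms] by (simp add: gaps_def)
  ultimately show ?thesis using False by simp
qed

lemma proper_kid:
  assumes v: "proper m v" and c: "c < 8" "has_kid m c v"
  shows "proper m (kid c v)"
proof -
  obtain S G X M where eq: "v = (S, G, X, M)" by (cases v) auto
  note k = kid_gaps[OF v c eq]
  have g: "gaps (spread (S (side c)) (low c v) (high c v)) (low c v) (high c v)
      (if c mod 2 = 0 then high c v + 1 else M (side c))"
    unfolding kid_max[OF v c eq] by (rule gaps_spread[OF k(1) k(4) k(2) k(5) k(3) k(6)])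
  have h: "c mod 2 = 0 \<Longrightarrow> high c v = M (side c) \<and> M 0 + M 1 + 1 \<le> m"
    using c(2) unfolding eq has_kid_def high_def by auto
  from side_cases[OF c(1)] show ?thesis
  proof
    assume "side c = 0"
    thus ?thesis using g h v unfolding kid_def eq proper_def by (cases "c mod 2 = 0") auto
  next
    assume "side c = 1"
    thus ?thesis using g h v unfolding kid_def eq proper_def by (cases "c mod 2 = 0") auto
  qed
qed

lemma kid_weights:
  assumes v: "proper m v" and c: "c < 8" "has_kid m c v"
  shows "weights (sets (kid c v)) = weights (sets v)" "squares (sets v) < squares (sets (kid c v))"
proof -
  obtain S G X M where eq: "v = (S, G, X, M)" by (cases v) auto
  note k = kid_gaps[OF v c eq]
  note s = square_spread[OF k(1) k(4) k(2) k(5) k(3) k(6)]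
  show "weights (sets (kid c v)) = weights (sets v)"
    using s(1) side_cases[OF c(1)] unfolding kid_def eq sets_def weights_def by auto
  show "squares (sets v) < squares (sets (kid c v))"
    using s(2) side_cases[OF c(1)] unfolding kid_def eq sets_def squares_def by auto
qed

lemma three_digits_inject:
  fixes c c' :: nat
  assumes "(c div 2 mod 2 = 0) = (c' div 2 mod 2 = 0)" "(c mod 2 = 0) = (c' mod 2 = 0)" "c div 4 = c' div 4"
  shows "c = c'"
proof -
  have binary: "k = 4 * (k div 4) + 2 * (k div 2 mod 2) + k mod 2" for k :: nat
  proof -
    have "k = 2 * (k div 2) + k mod 2" "k div 2 = 2 * (k div 2 div 2) + k div 2 mod 2"
      by simp_all
    moreover have "k div 2 div 2 = k div 4" by (simp flip: div_mult2_eq)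
    ultimately show ?thesis by linarith
  qed
  have digit: "k mod 2 = k' mod 2" if "(k mod 2 = 0) = (k' mod 2 = 0)" for k k' :: nat
    using that by (metis not_mod_2_eq_0_eq_1)
  have "c = 4 * (c div 4) + 2 * (c div 2 mod 2) + c mod 2" by (rule binary)
  also have "\<dots> = 4 * (c' div 4) + 2 * (c' div 2 mod 2) + c' mod 2"
    by (simp only: digit[OF assms(1)] digit[OF assms(2)] assms(3))
  also have "\<dots> = c'" by (rule binary[symmetric])
  finally show ?thesis .
qed

text \<open>The set of a kid determines its parent: the side that was changed is the first one whose
  extreme gaps differ, and these gaps are the places where elements have been moved.\<close>

lemma kid_inject:
  assumes v: "proper m v" and c: "c < 8" "has_kid m c v"
    and v': "proper m v'" and c': "c' < 8" "has_kid m c' v'"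
    and eq: "sets (kid c v) = sets (kid c' v')"
  shows "sets v = sets v' \<and> c = c'"
proof -
  obtain S G X M where veq: "v = (S, G, X, M)" by (cases v) auto
  obtain S' G' X' M' where veq': "v' = (S', G', X', M')" by (cases v') auto
  note k = kid_gaps[OF v c veq] and k' = kid_gaps[OF v' c' veq']
  note K = gaps_spread[OF k(1) k(4) k(2) k(5) k(3) k(6)]
    and K' = gaps_spread[OF k'(1) k'(4) k'(2) k'(5) k'(3) k'(6)]
  have first: "side c = 1 \<Longrightarrow> X 0 \<le> G 0 \<and> gaps (S 0) (G 0) (X 0) (M 0)"
    "side c' = 1 \<Longrightarrow> X' 0 \<le> G' 0 \<and> gaps (S' 0) (G' 0) (X' 0) (M' 0)"
    using c c' v v' unfolding veq veq' has_kid_def proper_def by auto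
  have sd: "side c = side c'"
  proof (rule ccontr)
    assume "side c \<noteq> side c'"
    with side_cases[OF c(1)] side_cases[OF c'(1)]
    consider "side c = 0" "side c' = 1" | "side c = 1" "side c' = 0" by auto
    thus False
    proof cases
      case 1
      with eq have "spread (S 0) (low c v) (high c v) = S' 0"
        unfolding kid_def veq veq' sets_def by simp
      with K gaps_unique[of "S' 0"] first(2) 1 k(6) show False by fastforce
    next
      case 2
      with eq have "spread (S' 0) (low c' v') (high c' v') = S 0"
        unfolding kid_def veq veq' sets_def by simp
      with K' gaps_unique[of "S 0"] first(1) 2 k'(6) show False by fastforce
    qed
  qed
  have same: "spread (S (side c)) (low c v) (high c v) = spread (S' (side c')) (low c' v') (high c' v')"
    using eq sd side_cases[OF c(1)] unfolding kid_def veq veq' sets_def by auto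
  have gx: "low c v = low c' v'" "high c v = high c' v'"
    using gaps_unique[OF K K'[folded same]] by simp_all
  have "1 \<le> low c v" using k(4) gaps_zero[OF k(1)] by (cases "low c v") auto
  have "unspread (spread (S (side c)) (low c v) (high c v)) (low c v) (high c v) = S (side c)"
    using unspread_spread[OF k(4,5) spread_fresh[OF k(1) k(4) k(2) k(5) k(3)] k(6) \<open>1 \<le> low c v\<close>] .
  moreover have "unspread (spread (S' (side c')) (low c' v') (high c' v')) (low c v) (high c v) = S' (side c')"
    using unspread_spread[OF k'(4,5) spread_fresh[OF k'(1) k'(4) k'(2) k'(5) k'(3)] k'(6)] \<open>1 \<le> low c v\<close>
    unfolding gx by simp
  ultimately have S: "S (side c) = S' (side c)" using same sd by metis
  have other: "S t = S' t" if "t \<noteq> side c" "t = 0 \<or> t = 1" for t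
    using eq that sd unfolding kid_def veq veq' sets_def by auto
  have "S 0 = S' 0" "S 1 = S' 1" using S other[of 0] other[of 1] by metis+
  hence sets: "sets v = sets v'" unfolding veq veq' sets_def by simp
  have "gaps (S (side c)) (G' (side c)) (X' (side c)) (M' (side c))" using k'(1) S sd by simp
  with k(1) have GXM: "G (side c) = G' (side c)" "X (side c) = X' (side c)" "M (side c) = M' (side c)"
    using gaps_unique by blast+
  have GX: "1 \<le> G (side c)" "X (side c) \<le> M (side c)" using k(1) by (auto simp: gaps_def)
  have low: "low c v = (if c div 2 mod 2 = 0 then 1 else G (side c) + 1)"
    "low c' v' = (if c' div 2 mod 2 = 0 then 1 else G (side c) + 1)"
    using GXM sd by (simp_all add: low_def veq veq')
  have high: "high c v = (if c mod 2 = 0 then M (side c) else X (side c) - 1)"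
    "high c' v' = (if c' mod 2 = 0 then M (side c) else X (side c) - 1)"
    using GXM sd by (simp_all add: high_def veq veq')
  have "(c div 2 mod 2 = 0) = (c' div 2 mod 2 = 0)"
    using gx(1) GX(1) unfolding low by (cases "c div 2 mod 2 = 0"; cases "c' div 2 mod 2 = 0") simp_all
  moreover have "(c mod 2 = 0) = (c' mod 2 = 0)"
  proof -
    have "X (side c) - 1 \<noteq> M (side c)" using GX(2) k(6) high(1) by (cases "X (side c)"; cases "c mod 2 = 0") auto
    thus ?thesis using gx(2) unfolding high by (cases "c mod 2 = 0"; cases "c' mod 2 = 0") simp_all
  qed
  moreover have "c div 4 = c' div 4" using sd by (simp add: side_def)
  ultimately have "c = c'" by (rule three_digits_inject)
  with sets show ?thesis by simp
qed

text \<open>Nodes cannot be compared directly, as their functions are arbitrary beyond the indices 0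
  and 1. But the sets determine gaps and maxima, so the parent relation can live on pairs of
  sets.\<close>

lemma proper_same_sets:
  assumes "proper m (S, G, X, M)" "proper m (S', G', X', M')" "sets (S, G, X, M) = sets (S', G', X', M')"
    and "c < 8"
  shows "has_kid m c (S, G, X, M) \<longleftrightarrow> has_kid m c (S', G', X', M')"
    "sets (kid c (S, G, X, M)) = sets (kid c (S', G', X', M'))"
proof -
  have "S 0 = S' 0" "S 1 = S' 1" using assms(3) by (auto simp: sets_def)
  moreover have "gaps (S 0) (G 0) (X 0) (M 0)" "gaps (S 1) (G 1) (X 1) (M 1)"
    "gaps (S' 0) (G' 0) (X' 0) (M' 0)" "gaps (S' 1) (G' 1) (X' 1) (M' 1)"
    using assms(1,2) by (simp_all add: proper_def)
  ultimately have zero: "S 0 = S' 0" "G 0 = G' 0" "X 0 = X' 0" "M 0 = M' 0"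
    and one: "S 1 = S' 1" "G 1 = G' 1" "X 1 = X' 1" "M 1 = M' 1"
    using gaps_unique by metis+
  have sd: "S (side c) = S' (side c)" "G (side c) = G' (side c)" "X (side c) = X' (side c)"
    "M (side c) = M' (side c)"
    using side_cases[OF assms(4)] zero one by (elim disjE; simp)+
  have lh: "low c (S, G, X, M) = low c (S', G', X', M')" "high c (S, G, X, M) = high c (S', G', X', M')"
    unfolding low_def high_def prod.case sd by simp_all
  show "has_kid m c (S, G, X, M) \<longleftrightarrow> has_kid m c (S', G', X', M')"
    unfolding has_kid_def prod.case lh sd zero one ..
  show "sets (kid c (S, G, X, M)) = sets (kid c (S', G', X', M'))"
    unfolding kid_def sets_def prod.case lh sd using zero(1) one(1) by simp
qed

section \<open>The forest spanned by the parent relation\<close>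

definition parent_rel :: "nat \<Rightarrow> ((nat set \<times> nat set) \<times> (nat set \<times> nat set)) set" where
  "parent_rel m = {(sets (kid c v), sets v) | c v. proper m v \<and> c < 8 \<and> has_kid m c v}"

lemma parent_relI:
  "proper m v \<Longrightarrow> c < 8 \<Longrightarrow> has_kid m c v \<Longrightarrow> (sets (kid c v), sets v) \<in> parent_rel m"
  unfolding parent_rel_def by blast

lemma parent_relE:
  assumes "(p, q) \<in> parent_rel m"
  obtains c v where "p = sets (kid c v)" "q = sets v" "proper m v" "c < 8" "has_kid m c v"
  using assms unfolding parent_rel_def by auto

lemma single_valued_parent_rel: "single_valued (parent_rel m)"
proof (rule single_valuedI)
  fix p q q' assume q: "(p, q) \<in> parent_rel m" and q': "(p, q') \<in> parent_rel m"
  obtain c v where v: "p = sets (kid c v)" "q = sets v" "proper m v" "c < 8" "has_kid m c v"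
    using q by (rule parent_relE)
  obtain c' v' where v': "p = sets (kid c' v')" "q' = sets v'" "proper m v'" "c' < 8" "has_kid m c' v'"
    using q' by (rule parent_relE)
  have "sets (kid c v) = sets (kid c' v')" using v(1) v'(1) by simp
  thus "q = q'" using kid_inject[OF v(3-5) v'(3-5)] v(2) v'(2) by simp
qed

lemma parent_rel_squares:
  assumes "(p, q) \<in> parent_rel m"
  shows "squares q < squares p"
  using assms by (rule parent_relE) (simp add: kid_weights)

lemma parent_rel_weights:
  assumes "(p, q) \<in> parent_rel m"
  shows "weights p = weights q"
  using assms by (rule parent_relE) (simp add: kid_weights)

lemma ancestor_squares: "(p, q) \<in> (parent_rel m)\<^sup>* \<Longrightarrow> squares q \<le> squares p"
  by (induction rule: rtrancl_induct) (auto dest: parent_rel_squares)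

lemma ancestor_weights: "(p, q) \<in> (parent_rel m)\<^sup>* \<Longrightarrow> weights p = weights q"
  by (induction rule: rtrancl_induct) (auto dest: parent_rel_weights)

lemma set_kids: "w \<in> set (kids m v) \<longleftrightarrow> (\<exists>c<8. has_kid m c v \<and> w = kid c v)"
  by (auto simp: kids_def)

lemma kid_parent_rel: "proper m v \<Longrightarrow> w \<in> set (kids m v) \<Longrightarrow> (sets w, sets v) \<in> parent_rel m"
  unfolding set_kids parent_rel_def by blast

lemma proper_kids: "proper m v \<Longrightarrow> w \<in> set (kids m v) \<Longrightarrow> proper m w"
  unfolding set_kids using proper_kid by blast

lemma subtree_ancestor:
  "proper m v \<Longrightarrow> w \<in> set (subtree m f v) \<Longrightarrow> (sets w, sets v) \<in> (parent_rel m)\<^sup>* \<and> proper m w"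
proof (induction f arbitrary: v)
  case (Suc f)
  show ?case
  proof (cases "w = v")
    case False
    then obtain u where u: "u \<in> set (kids m v)" "w \<in> set (subtree m f u)" using Suc.prems by auto
    with Suc.IH[OF proper_kids[OF Suc.prems(1) u(1)] u(2)] kid_parent_rel[OF Suc.prems(1) u(1)]
    show ?thesis by (meson rtrancl.rtrancl_into_rtrancl)
  qed (use Suc.prems in simp)
qed simp

text \<open>Squares grow with each step downwards, so the bound in the last assumption keeps the
  depth argument from cutting off descendants.\<close>

lemma subtree_complete:
  assumes "proper m v" "(p, sets v) \<in> (parent_rel m)\<^sup>*"
    and "\<And>q. (q, sets v) \<in> (parent_rel m)\<^sup>* \<Longrightarrow> squares q \<le> squares (sets v) + f"
  shows "p \<in> sets ` set (subtree m f v)"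
  using assms
proof (induction f arbitrary: v)
  case 0
  show ?case
  proof (cases "p = sets v")
    case False
    with 0(2) obtain q where "(q, sets v) \<in> parent_rel m"
      by (meson rtranclE)
    with 0(3)[of q] parent_rel_squares[OF this] show ?thesis by auto
  qed simp
next
  case (Suc f)
  show ?case
  proof (cases "p = sets v")
    case False
    with Suc.prems(2) obtain q where q: "(p, q) \<in> (parent_rel m)\<^sup>*" "(q, sets v) \<in> parent_rel m"
      by (meson rtranclE)
    from q(2) obtain c v' where c: "q = sets (kid c v')" "sets v = sets v'" "proper m v'" "c < 8" "has_kid m c v'"
      by (rule parent_relE)
    have hk: "has_kid m c v" "q = sets (kid c v)"
      using proper_same_sets[OF _ _ _ c(4)] c Suc.prems(1) by (cases v; cases v'; metis)+
    let ?w = "kid c v"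
    have w: "?w \<in> set (kids m v)" using hk c(4) by (auto simp: set_kids)
    have "p \<in> sets ` set (subtree m f ?w)"
    proof (rule Suc.IH[OF proper_kids[OF Suc.prems(1) w]])
      show "(p, sets ?w) \<in> (parent_rel m)\<^sup>*" using q hk by simp
      fix r assume r: "(r, sets ?w) \<in> (parent_rel m)\<^sup>*"
      hence "(r, sets v) \<in> (parent_rel m)\<^sup>*"
        using kid_parent_rel[OF Suc.prems(1) w] by (rule rtrancl.rtrancl_into_rtrancl)
      from Suc.prems(3)[OF this] parent_rel_squares[OF kid_parent_rel[OF Suc.prems(1) w]]
      show "squares r \<le> squares (sets ?w) + f" by simp
    qed
    thus ?thesis using w by auto
  qed simp
qed

lemma distinct_concat_map:
  assumes "distinct xs" "\<And>x. x \<in> set xs \<Longrightarrow> distinct (f x)"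
    and "\<And>x y. x \<in> set xs \<Longrightarrow> y \<in> set xs \<Longrightarrow> x \<noteq> y \<Longrightarrow> set (f x) \<inter> set (f y) = {}"
  shows "distinct (concat (map f xs))"
  using assms
proof (induction xs)
  case (Cons a xs)
  have "distinct (concat (map f xs))"
    by (rule Cons.IH) (use Cons.prems in auto)
  moreover have "set (f a) \<inter> set (f x) = {}" if "x \<in> set xs" for x
    using Cons.prems(1) Cons.prems(3)[of a x] that by auto
  ultimately show ?case using Cons.prems(2)[of a] by auto
qed simp

lemma distinct_kids:
  assumes "proper m v"
  shows "distinct (map sets (kids m v))"
  unfolding kids_def map_map distinct_map
  using kid_inject[OF assms _ _ assms] by (auto intro!: inj_onI)

text \<open>If two kids had a common descendant, uniqueness of parents would make one of them an
  ancestor of the other. Then \<open>v\<close> would be a descendant of one of its own kids, against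
  the growth of squares.\<close>

lemma distinct_subtree: "proper m v \<Longrightarrow> distinct (map sets (subtree m f v))"
proof (induction f arbitrary: v)
  case (Suc f)
  have anc: "(p, sets w) \<in> (parent_rel m)\<^sup>*" if "w \<in> set (kids m v)" "p \<in> sets ` set (subtree m f w)" for w p
    using subtree_ancestor[OF proper_kids[OF Suc.prems that(1)]] that(2) by blast
  have root: "sets v \<notin> sets ` set (subtree m f w)" if w: "w \<in> set (kids m v)" for w
    using ancestor_squares anc[OF w] parent_rel_squares[OF kid_parent_rel[OF Suc.prems w]]
    by (meson not_le)
  have disj: "sets ` set (subtree m f w) \<inter> sets ` set (subtree m f w') = {}"
    if w: "w \<in> set (kids m v)" and w': "w' \<in> set (kids m v)" and ne: "sets w \<noteq> sets w'" for w w'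
  proof (rule ccontr)
    assume "sets ` set (subtree m f w) \<inter> sets ` set (subtree m f w') \<noteq> {}"
    then obtain p where p: "(p, sets w) \<in> (parent_rel m)\<^sup>*" "(p, sets w') \<in> (parent_rel m)\<^sup>*"
      using anc[OF w] anc[OF w'] by blast
    have no: False if "a \<noteq> b" "(a, b) \<in> (parent_rel m)\<^sup>*" "(a, sets v) \<in> parent_rel m" "(b, sets v) \<in> parent_rel m"
      for a b
    proof -
      from that(1,2) obtain z where "(a, z) \<in> parent_rel m" "(z, b) \<in> (parent_rel m)\<^sup>*"
        by (meson converse_rtranclE)
      moreover from this that(3) have "z = sets v"
        using single_valued_parent_rel by (meson single_valuedD)
      ultimately show False using ancestor_squares parent_rel_squares[OF that(4)] by fastforce
    qed
    from single_valued_confluent[OF single_valued_parent_rel p] show False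
      using no kid_parent_rel[OF Suc.prems w] kid_parent_rel[OF Suc.prems w'] ne by metis
  qed
  have "distinct (concat (map (\<lambda>w. map sets (subtree m f w)) (kids m v)))"
  proof (rule distinct_concat_map)
    show "distinct (kids m v)" using distinct_kids[OF Suc.prems] by (simp add: distinct_map)
    fix w w' assume w: "w \<in> set (kids m v)" "w' \<in> set (kids m v)" "w \<noteq> w'"
    hence "sets w \<noteq> sets w'" using distinct_kids[OF Suc.prems] by (auto simp: distinct_map dest: inj_onD)
    thus "set (map sets (subtree m f w)) \<inter> set (map sets (subtree m f w')) = {}"
      using disj[OF w(1,2)] by simp
  qed (use Suc.IH proper_kids[OF Suc.prems] in blast)
  thus ?case using root by (auto simp: map_concat comp_def)
qed simp


section \<open>Roots of the trees\<close>

text \<open>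
  \<open>(u, x, w, y)\<close> stands for the sets \<open>{1..u} - {x}\<close> and \<open>{1..w} - {y}\<close>. Sets of this shape are the ones
  without a parent, and there is exactly one of them for each sum. The second set of a root is
  determined by the first one, as the total weight is \<open>K\<close>.
\<close>

type_synonym root = "nat \<times> nat \<times> nat \<times> nat"

text \<open>The value \<open>x = 0\<close> means that there is no gap. For positive
  \<open>u\<close>, \<open>x = u\<close> is excluded because removing the maximum leaves
  \<open>{1..u - 1}\<close>, which has its own representation.\<close>

definition compact :: "nat \<Rightarrow> nat \<Rightarrow> bool" where
  "compact u x \<longleftrightarrow> x < u \<or> u = 0 \<and> x = 0"

definition tri :: "nat \<Rightarrow> nat" where "tri u = \<Sum>{1..u}"

definition low_gap :: "nat \<Rightarrow> nat \<Rightarrow> nat" where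
  "low_gap u x = (if x = 0 then u + 1 else x)"

definition root_node :: "root \<Rightarrow> node" where
  "root_node = (\<lambda>(u, x, w, y). (\<lambda>t. if t = 0 then {1..u} - {x} else {1..w} - {y},
     \<lambda>t. if t = 0 then low_gap u x else low_gap w y,
     \<lambda>t. if t = 0 then x else y, \<lambda>t. if t = 0 then u else w))"

section \<open>Compact sets and triangular numbers\<close>

lemma tri_Suc [simp]: "tri (Suc u) = tri u + Suc u"
  by (simp add: tri_def)

lemma tri_0 [simp]: "tri 0 = 0"
  by (simp add: tri_def)

lemma tri_ge: "u \<le> tri u"
  by (induction u) auto

lemma tri_mono: "u \<le> w \<Longrightarrow> tri u \<le> tri w"
  by (induction w) (auto simp: le_Suc_eq)

lemma double_tri: "2 * tri u = u * (u + 1)"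
  by (induction u) auto

lemma compact_le_tri: "compact u x \<Longrightarrow> x \<le> tri u"
  using tri_ge[of u] by (auto simp: compact_def)

lemma sum_compact: "compact u x \<Longrightarrow> \<Sum>({1..u} - {x}) = tri u - x"
  unfolding tri_def by (cases "x = 0") (auto simp: compact_def sum_diff1_nat)

text \<open>With maximum \<open>w\<close> the sums \<open>tri w - y\<close> fill the range above
  \<open>tri (w - 1)\<close> up to \<open>tri w\<close>. These ranges are disjoint, so a sum
  determines its compact set.\<close>

lemma compact_less:
  assumes "compact w y" "u < w"
  shows "tri u < tri w - y"
proof -
  have "tri u \<le> tri (w - 1)" using assms(2) by (intro tri_mono) simp
  moreover have "tri w = tri (w - 1) + w" using assms(2) by (cases w) auto
  ultimately show ?thesis using assms by (auto simp: compact_def)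
qed

lemma compact_unique:
  assumes "compact u x" "compact w y" "tri u - x = tri w - y"
  shows "u = w \<and> x = y"
proof -
  have "\<not> u < w" using compact_less[OF assms(2), of u] assms(3) by auto
  moreover have "\<not> w < u" using compact_less[OF assms(1), of w] assms(3) by auto
  ultimately have "u = w" by simp
  thus ?thesis using assms compact_le_tri[OF assms(1)] compact_le_tri[OF assms(2)] by auto
qed

lemma gaps_compact: "compact u x \<Longrightarrow> gaps ({1..u} - {x}) (low_gap u x) x u"
  by (auto simp: gaps_def compact_def low_gap_def)

lemma compact_gaps:
  assumes "gaps A g x M" "x \<le> g"
  shows "A = {1..M} - {x} \<and> compact M x"
proof -
  have "a \<in> A" if "1 \<le> a" "a \<le> M" "a \<noteq> x" for a
  proof (cases "a < x")
    case True
    thus ?thesis using assms that by (auto simp: gaps_def)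
  next
    case False
    thus ?thesis using assms that by (auto simp: gaps_def)
  qed
  hence "{1..M} - {x} \<subseteq> A" by (metis DiffE atLeastAtMost_iff singletonI subsetI)
  moreover have "x < M \<or> M = 0 \<and> x = 0" using assms by (cases "x = M") (auto simp: gaps_def)
  moreover have "A \<subseteq> {1..M} - {x}" using assms(1) by (auto simp: gaps_def)
  ultimately show ?thesis unfolding compact_def by blast
qed

lemma proper_root_node:
  "compact u x \<Longrightarrow> compact w y \<Longrightarrow> u + w \<le> m \<Longrightarrow> proper m (root_node (u, x, w, y))"
  using gaps_compact[of u x] gaps_compact[of w y] by (simp add: proper_def root_node_def)

lemma sets_root_node: "sets (root_node (u, x, w, y)) = ({1..u} - {x}, {1..w} - {y})"
  by (simp add: sets_def root_node_def)

lemma weights_root_node: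
  "compact u x \<Longrightarrow> compact w y \<Longrightarrow> weights (sets (root_node (u, x, w, y))) = (tri u - x, tri w - y)"
  using sum_compact[of u x] sum_compact[of w y] by (simp add: sets_root_node weights_def)


lemma unspread_parent:
  assumes v: "proper m (S, G, X, M)" and t: "t = 0 \<or> t = 1 \<and> X 0 \<le> G 0" and noncompact: "G t < X t"
  shows "\<exists>v'. proper m v' \<and> (sets (S, G, X, M), sets v') \<in> parent_rel m"
proof -
  have gt: "gaps (S t) (G t) (X t) (M t)" using v t by (auto simp: proper_def)
  obtain g x k where A: "gaps (unspread (S t) (G t) (X t)) g x k" and low: "G t = 1 \<or> G t = g + 1"
    and high: "X t = k \<or> X t + 1 = x" and k: "k \<le> M t" "M t = max k (X t + 1)"
    using gt noncompact by (rule gaps_unspread)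
  \<comment> \<open>The number of the kid is read off from the undone move: its bits say which
    alternatives hold in \<open>low\<close> and \<open>high\<close>.\<close>
  define c where "c = 4 * t + (if G t = 1 then 0 else 2) + (if X t = k then 0 else 1)"
  have c: "c < 8" "side c = t" "c div 2 mod 2 = 0 \<longleftrightarrow> G t = 1" "c mod 2 = 0 \<longleftrightarrow> X t = k"
    using t unfolding c_def side_def by auto
  define v' where "v' = (S(t := unspread (S t) (G t) (X t)), G(t := g), X(t := x), M(t := k))"
  have p: "proper m v'"
    using v A k t unfolding v'_def proper_def by auto
  have lh: "low c v' = G t" "high c v' = X t"
    using c low high unfolding low_def high_def v'_def by auto
  have "G t \<in> unspread (S t) (G t) (X t)" "X t \<in> unspread (S t) (G t) (X t)"
    by (auto simp: unspread_def)
  moreover have "c mod 2 = 0 \<Longrightarrow> (M(t := k)) 0 + (M(t := k)) 1 + 1 \<le> m"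
    using c(4) k v t unfolding proper_def by auto
  ultimately have hk: "has_kid m c v'"
    using t noncompact c(2) lh unfolding has_kid_def v'_def prod.case by auto
  have "spread (unspread (S t) (G t) (X t)) (G t) (X t) = S t"
    using gt noncompact by (rule spread_unspread)
  hence "sets (kid c v') = sets (S, G, X, M)"
    unfolding kid_def lh unfolding v'_def sets_def prod.case c(2) using t by auto
  thus ?thesis using parent_relI[OF p c(1) hk] p by metis
qed

lemma descends_to_root:
  "proper m v \<Longrightarrow> \<exists>u x w y. compact u x \<and> compact w y \<and> u + w \<le> m \<and>
    (sets v, sets (root_node (u, x, w, y))) \<in> (parent_rel m)\<^sup>*"
proof (induction "squares (sets v)" arbitrary: v rule: less_induct)
  case less
  obtain S G X M where v: "v = (S, G, X, M)" by (cases v) auto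
  show ?case
  proof (cases "X 0 \<le> G 0 \<and> X 1 \<le> G 1")
    case True
    have g: "gaps (S 0) (G 0) (X 0) (M 0)" "gaps (S 1) (G 1) (X 1) (M 1)" "M 0 + M 1 \<le> m"
      using less.prems unfolding v proper_def by auto
    have "S 0 = {1..M 0} - {X 0} \<and> compact (M 0) (X 0)" "S 1 = {1..M 1} - {X 1} \<and> compact (M 1) (X 1)"
      using compact_gaps[OF g(1)] compact_gaps[OF g(2)] True by blast+
    moreover from this have "sets v = sets (root_node (M 0, X 0, M 1, X 1))"
      unfolding v sets_root_node by (simp add: sets_def)
    ultimately show ?thesis using g(3) by (metis rtrancl.rtrancl_refl)
  next
    case False
    then obtain t where "t = 0 \<or> t = 1 \<and> X 0 \<le> G 0" "G t < X t"
      by (cases "X 0 \<le> G 0") (auto simp: not_le)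
    then obtain v' where v': "proper m v'" "(sets v, sets v') \<in> parent_rel m"
      using unspread_parent less.prems unfolding v by blast
    with less.hyps[OF parent_rel_squares[OF v'(2)] v'(1)] show ?thesis
      by (meson converse_rtrancl_into_rtrancl)
  qed
qed

lemma proper_flip_pairs:
  assumes "proper m v"
  shows "sets v \<in> flip_pairs m"
proof -
  obtain S G X M where v: "v = (S, G, X, M)" by (cases v) auto
  have "S 0 \<subseteq> {1..M 0}" "S 1 \<subseteq> {1..M 1}" "M 0 + M 1 \<le> m"
    using assms unfolding v proper_def by (auto simp: gaps_def)
  thus ?thesis unfolding v sets_def flip_pairs_def by (fastforce simp: subset_iff)
qed

text \<open>The condition on all pairs of elements is one on the two maxima, where an empty set has
  maximum 0.\<close>

lemma flip_pairs_proper: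
  assumes "p \<in> flip_pairs m"
  obtains v where "proper m v" "sets v = p"
proof -
  obtain A B where p: "p = (A, B)" by (cases p)
  have AB: "A \<subseteq> {1..m}" "B \<subseteq> {1..m}" and le: "\<forall>a\<in>A. \<forall>b\<in>B. a + b \<le> m"
    using assms by (auto simp: p flip_pairs_def)
  have "finite A" "0 \<notin> A" "finite B" "0 \<notin> B"
    using AB by (auto intro: finite_subset)
  then obtain g x M g' x' M' where d: "gaps A g x M" "gaps B g' x' M'"
    using gaps_exist by metis
  have "M = 0 \<or> M \<in> A" "M' = 0 \<or> M' \<in> B" using d by (auto simp: gaps_def)
  hence "M + M' \<le> m" using AB le by (elim disjE) auto
  with d have "proper m (\<lambda>t. if t = 0 then A else B, \<lambda>t. if t = 0 then g else g',
      \<lambda>t. if t = 0 then x else x', \<lambda>t. if t = 0 then M else M')"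
    by (simp add: proper_def)
  thus ?thesis by (rule that) (simp add: sets_def p)
qed

section \<open>Families of pairs with fixed sums\<close>

definition family :: "nat \<Rightarrow> nat \<times> nat \<Rightarrow> (nat set \<times> nat set) set" where
  "family m PQ = {p \<in> flip_pairs m. weights p = PQ}"

lemma family_root:
  assumes "p \<in> family m PQ"
  obtains u x w y where "compact u x" "compact w y" "u + w \<le> m" "PQ = (tri u - x, tri w - y)"
    "(p, sets (root_node (u, x, w, y))) \<in> (parent_rel m)\<^sup>*"
proof -
  from assms have p: "p \<in> flip_pairs m" "weights p = PQ" by (auto simp: family_def)
  from p(1) obtain v where v: "proper m v" "sets v = p" by (rule flip_pairs_proper)
  from descends_to_root[OF v(1)] obtain u x w y where r: "compact u x" "compact w y" "u + w \<le> m"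
    "(p, sets (root_node (u, x, w, y))) \<in> (parent_rel m)\<^sup>*" unfolding v(2) by blast
  from ancestor_weights[OF r(4)] weights_root_node[OF r(1,2)] p(2) r that show ?thesis by auto
qed

text \<open>Every member of the family climbs to some root without changing the two sums, and these
  sums determine the compact sets of the root.\<close>

lemma descendants_root:
  assumes "compact u x" "compact w y" "u + w \<le> m"
  shows "{p. (p, sets (root_node (u, x, w, y))) \<in> (parent_rel m)\<^sup>*} = family m (tri u - x, tri w - y)"
proof (intro equalityI subsetI)
  fix p assume "p \<in> {p. (p, sets (root_node (u, x, w, y))) \<in> (parent_rel m)\<^sup>*}"
  hence p: "(p, sets (root_node (u, x, w, y))) \<in> (parent_rel m)\<^sup>*" by simp
  have "weights p = (tri u - x, tri w - y)"
    using ancestor_weights[OF p] weights_root_node[OF assms(1,2)] by simp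
  moreover from p have "p \<in> flip_pairs m"
  proof (cases rule: converse_rtranclE)
    case base
    thus ?thesis using proper_flip_pairs[OF proper_root_node[OF assms]] by simp
  next
    case (step q)
    from step(1) obtain c v where "p = sets (kid c v)" "proper m v" "c < 8" "has_kid m c v"
      by (rule parent_relE)
    thus ?thesis using proper_flip_pairs[OF proper_kid] by simp
  qed
  ultimately show "p \<in> family m (tri u - x, tri w - y)" by (simp add: family_def)
next
  fix p assume "p \<in> family m (tri u - x, tri w - y)"
  then obtain u' x' w' y' where r: "compact u' x'" "compact w' y'" "(tri u - x, tri w - y) = (tri u' - x', tri w' - y')"
    "(p, sets (root_node (u', x', w', y'))) \<in> (parent_rel m)\<^sup>*" by (rule family_root) blast
  have "u' = u \<and> x' = x" "w' = w \<and> y' = y"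
    using compact_unique[OF r(1) assms(1)] compact_unique[OF r(2) assms(2)] r(3) by auto
  thus "p \<in> {p. (p, sets (root_node (u, x, w, y))) \<in> (parent_rel m)\<^sup>*}" using r(4) by simp
qed

lemma squares_bound:
  assumes "p \<in> flip_pairs m"
  shows "squares p \<le> 2 * m ^ 3"
proof -
  obtain A B where p: "p = (A, B)" by (cases p)
  have *: "(\<Sum>a\<in>A. a\<^sup>2) \<le> m ^ 3" if "A \<subseteq> {1..m}" for A
  proof -
    have "(\<Sum>a\<in>A. a\<^sup>2) \<le> (\<Sum>a\<in>A. m\<^sup>2)" using that by (intro sum_mono power_mono) auto
    also have "\<dots> \<le> m * m\<^sup>2" using card_mono[OF _ that] by simp
    finally show ?thesis by (simp add: power2_eq_square power3_eq_cube)
  qed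
  show ?thesis using assms *[of A] *[of B] by (auto simp: p flip_pairs_def squares_def)
qed

definition root_subtree :: "nat \<Rightarrow> root \<Rightarrow> node list" where
  "root_subtree m r = subtree m (2 * m ^ 3) (root_node r)"

lemma root_subtree:
  assumes "compact u x" "compact w y" "u + w \<le> m"
  shows "sets ` set (root_subtree m (u, x, w, y)) = family m (tri u - x, tri w - y)"
    "distinct (map sets (root_subtree m (u, x, w, y)))"
proof -
  let ?r = "root_node (u, x, w, y)"
  have r: "proper m ?r" by (rule proper_root_node[OF assms])
  show "distinct (map sets (root_subtree m (u, x, w, y)))"
    unfolding root_subtree_def by (rule distinct_subtree[OF r])
  have bound: "squares q \<le> squares (sets ?r) + 2 * m ^ 3" if "(q, sets ?r) \<in> (parent_rel m)\<^sup>*" for q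
  proof -
    have "q \<in> family m (tri u - x, tri w - y)" using that descendants_root[OF assms] by blast
    hence "squares q \<le> 2 * m ^ 3" using squares_bound by (auto simp: family_def)
    thus ?thesis by simp
  qed
  show "sets ` set (root_subtree m (u, x, w, y)) = family m (tri u - x, tri w - y)"
    unfolding descendants_root[OF assms, symmetric] root_subtree_def
    using subtree_ancestor[OF r] subtree_complete[OF r _ bound] by blast
qed

section \<open>The sequence of roots\<close>

definition root_weight :: "root \<Rightarrow> nat" where
  "root_weight = (\<lambda>(u, x, w, y). tri u - x)"

text \<open>This raises the sum by one: a gap moves down, and \<open>{1..u}\<close> is followed by
  \<open>{1..u + 1} - {u}\<close>.\<close>

definition succ_compact :: "nat \<Rightarrow> nat \<Rightarrow> nat \<times> nat" where
  "succ_compact u x = (if 0 < x then (u, x - 1) else (u + 1, u))"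

definition pred_compact :: "nat \<Rightarrow> nat \<Rightarrow> nat \<times> nat" where
  "pred_compact w y = (if y + 1 < w then (w, y + 1) else (w - 1, 0))"

text \<open>
  If the two sets are too large for each other, the second one has to shrink until its maximum
  drops, and the sum of the first one can jump by the same amount.
\<close>

definition next_root :: "nat \<Rightarrow> nat \<Rightarrow> root \<Rightarrow> root option" where
  "next_root m K = (\<lambda>(u, x, w, y).
     if K < 2 * (tri u - x + 1) then None else
     let (u', x') = succ_compact u x; (w', y') = pred_compact w y in
     if u' + w' \<le> m then Some (u', x', w', y') else
     if x' < w' - y' \<or> K < 2 * (tri u - x + 1 + (w' - y')) then None
     else Some (u', x' - (w' - y'), w' - 1, 0))"

fun roots :: "nat \<Rightarrow> nat \<Rightarrow> nat \<Rightarrow> root \<Rightarrow> root list" where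
  "roots m K 0 r = [r]"
| "roots m K (Suc f) r = r # (case next_root m K r of None \<Rightarrow> [] | Some r' \<Rightarrow> roots m K f r')"

definition root_inv :: "nat \<Rightarrow> nat \<Rightarrow> root \<Rightarrow> bool" where
  "root_inv m K = (\<lambda>(u, x, w, y). compact u x \<and> compact w y \<and> u + w \<le> m \<and>
     tri u - x + (tri w - y) = K \<and> 2 * (tri u - x) \<le> K)"

text \<open>Some root of a nonempty family fits into \<open>m\<close>, and it must be the given one,
  since the sums determine it.\<close>

lemma family_emptyI:
  assumes "compact u x" "compact w y" "m < u + w"
  shows "family m (tri u - x, tri w - y) = {}"
proof (rule ccontr)
  assume "family m (tri u - x, tri w - y) \<noteq> {}"
  then obtain p where "p \<in> family m (tri u - x, tri w - y)" by blast
  then obtain u' x' w' y' where r: "compact u' x'" "compact w' y'" "u' + w' \<le> m"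
    "(tri u - x, tri w - y) = (tri u' - x', tri w' - y')" by (rule family_root) blast
  with compact_unique[OF assms(1) r(1)] compact_unique[OF assms(2) r(2)] assms(3) show False by auto
qed

text \<open>Convexity: under the constraint \<open>a + b \<le> m\<close>, pulling the smaller size
  down to \<open>u\<close> and the larger one up to \<open>m - u\<close> cannot lower the
  total.\<close>

lemma tri_balance:
  assumes "u < a" "a \<le> b" "a + b \<le> m"
  shows "tri a + tri b \<le> tri u + tri (m - u)"
proof -
  obtain d where d: "a = u + d" using assms(1) by (metis less_imp_add_positive)
  have "u * d \<le> b * d" using assms(2) d by simp
  moreover have "a * (a + 1) + b * (b + 1) + 2 * (b * d) = u * (u + 1) + (b + d) * (b + d + 1) + 2 * (u * d)"
    unfolding d by (simp add: algebra_simps)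
  ultimately have "a * (a + 1) + b * (b + 1) \<le> u * (u + 1) + (b + d) * (b + d + 1)" by linarith
  hence "tri a + tri b \<le> tri u + tri (b + d)"
    using double_tri[of a] double_tri[of b] double_tri[of u] double_tri[of "b + d"] by linarith
  also have "tri (b + d) \<le> tri (m - u)" using assms d by (intro tri_mono) simp
  finally show ?thesis by simp
qed

lemma succ_compact:
  assumes "compact u x" "succ_compact u x = (u', x')"
  shows "compact u' x'" "tri u' - x' = tri u - x + 1" "u' \<le> u + 1"
  using assms compact_le_tri[OF assms(1)] by (auto simp: compact_def succ_compact_def split: if_splits)

lemma pred_compact:
  assumes "compact w y" "0 < w" "pred_compact w y = (w', y')"
  shows "compact w' y'" "tri w' - y' + 1 = tri w - y" "w' \<le> w"
proof -
  have "tri w = tri (w - 1) + w" using assms(2) by (cases w) auto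
  thus "compact w' y'" "tri w' - y' + 1 = tri w - y" "w' \<le> w"
    using assms by (auto simp: compact_def pred_compact_def split: if_splits)
qed

text \<open>While \<open>d\<close> grows, the gap of the first set moves down and that of the second
  set moves up. As long as neither runs out, the maxima stay the same and remain too large.\<close>

lemma compact_empty_gap:
  assumes "compact u x" "compact w y" "m < u + w" "d < w - y" "d \<le> x"
  shows "family m (tri u - x + d, tri w - y - d) = {}"
proof -
  have c: "compact u (x - d)" using assms(1) by (auto simp: compact_def)
  have c': "compact w (y + d)" using assms(4) by (simp add: compact_def less_diff_conv add.commute)
  have "tri u - (x - d) = tri u - x + d" using assms(5) compact_le_tri[OF assms(1)] by simp
  moreover have "tri w - (y + d) = tri w - y - d" by simp
  ultimately show ?thesis using family_emptyI[OF c c' assms(3)] by simp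
qed

text \<open>An overshoot of the maxima is by one, so it is repaired as soon as the second maximum
  drops. If the gap of the first set runs out before that, the first maximum has to grow, and
  \<open>tri_balance\<close> shows that no later pair of sizes can carry the weight
  \<open>K\<close>.\<close>

lemma next_root:
  assumes r: "root_inv m K r"
  shows "case next_root m K r of
      None \<Rightarrow> \<forall>P. root_weight r < P \<and> 2 * P \<le> K \<longrightarrow> family m (P, K - P) = {}
    | Some r' \<Rightarrow> root_inv m K r' \<and> root_weight r < root_weight r' \<and>
        (\<forall>P. root_weight r < P \<and> P < root_weight r' \<longrightarrow> family m (P, K - P) = {})"
proof -
  obtain u x w y where r_eq: "r = (u, x, w, y)" by (cases r)
  from r have c: "compact u x" "compact w y" "u + w \<le> m" and K: "tri u - x + (tri w - y) = K"
    and P: "2 * (tri u - x) \<le> K" by (auto simp: root_inv_def r_eq)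
  define P' where "P' = tri u - x + 1"
  show ?thesis
  proof (cases "K < 2 * P'")
    case True
    hence "next_root m K r = None" by (simp add: next_root_def r_eq P'_def)
    thus ?thesis using True by (auto simp: root_weight_def r_eq P'_def)
  next
    case False
    have "0 < w" using K P False by (cases w) (auto simp: P'_def)
    obtain u' x' where su: "succ_compact u x = (u', x')" by (cases "succ_compact u x")
    obtain w' y' where pr: "pred_compact w y = (w', y')" by (cases "pred_compact w y")
    have A: "compact u' x'" "tri u' - x' = P'" and "u' \<le> u + 1"
      using succ_compact[OF c(1) su] by (simp_all add: P'_def)
    have B: "compact w' y'" "tri w' - y' + 1 = tri w - y" "w' \<le> w"
      using pred_compact[OF c(2) \<open>0 < w\<close> pr] by simp_all
    have K': "P' + (tri w' - y') = K" using B(2) K by (simp add: P'_def)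
    have le: "2 * P' \<le> K" using False by simp
    have nr: "next_root m K r = (if u' + w' \<le> m then Some (u', x', w', y') else
        if x' < w' - y' \<or> K < 2 * (P' + (w' - y')) then None else Some (u', x' - (w' - y'), w' - 1, 0))"
      using False by (simp add: next_root_def r_eq P'_def su pr)
    show ?thesis
    proof (cases "u' + w' \<le> m")
      case True
      have "root_inv m K (u', x', w', y')" using True A B(1) K' le by (simp add: root_inv_def)
      moreover have "root_weight (u', x', w', y') = root_weight r + 1"
        using A(2) by (simp add: root_weight_def r_eq P'_def)
      moreover have "next_root m K r = Some (u', x', w', y')" using True by (simp add: nr)
      ultimately show ?thesis by auto
    next
      case over: False
      \<comment> \<open>The gap of the second set has to climb from \<open>y'\<close> to
        \<open>w'\<close> for its maximum to drop.\<close>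
      define d where "d = w' - y'"
      have "u' + w' = m + 1" using over \<open>u' \<le> u + 1\<close> B(3) c(3) by simp
      have "1 \<le> P'" by (simp add: P'_def)
      hence "tri w' - y' \<noteq> 0" using K' le by auto
      hence "0 < w'" by (cases w') auto
      hence d: "0 < d" "d \<le> w'" "d + y' = w'" using B(1) by (auto simp: d_def compact_def)
      have tw: "tri w' = tri (w' - 1) + w'" using \<open>0 < w'\<close> by (cases w') auto
      have empty: "family m (P, K - P) = {}" if "P' \<le> P" "P < P' + d" "P \<le> P' + x'" for P
      proof -
        have "family m (tri u' - x' + (P - P'), tri w' - y' - (P - P')) = {}"
          using that over d by (intro compact_empty_gap[OF A(1) B(1)]) (auto simp: d_def)
        moreover have "tri w' - y' - (P - P') = K - P" using K' that(1) by simp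
        ultimately show ?thesis using A(2) that(1) by simp
      qed
      show ?thesis
      proof (cases "x' < d \<or> K < 2 * (P' + d)")
        case True
        have "family m (P, K - P) = {}" if P: "P' \<le> P" "2 * P \<le> K" for P
        proof (cases "P < P' + d \<and> P \<le> P' + x'")
          case True
          thus ?thesis using empty P by blast
        next
          case False
          hence "x' < d" "P' + x' < P" using True P by auto
          show ?thesis
          proof (rule ccontr)
            assume "family m (P, K - P) \<noteq> {}"
            then obtain p where "p \<in> family m (P, K - P)" by blast
            then obtain a z b z' where f: "compact a z" "compact b z'" "a + b \<le> m"
              "(P, K - P) = (tri a - z, tri b - z')" by (rule family_root) blast
            have "tri u' < tri a - z"
              using \<open>P' + x' < P\<close> A(2) compact_le_tri[OF A(1)] f(4) by simp
            hence "u' < a" using tri_mono[of a u'] by (meson diff_le_self leI le_trans not_less)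
            \<comment> \<open>The first set carries at most half of the weight, but a compact set
              with a larger maximum would be heavier.\<close>
            have "a \<le> b"
            proof (rule ccontr)
              assume "\<not> a \<le> b"
              hence "tri b < tri a - z" using compact_less[OF f(1), of b] by simp
              thus False using f(4) P(2) by auto
            qed
            have "K \<le> tri a + tri b" using f(4) P(2) by auto
            also have "\<dots> \<le> tri u' + tri (m - u')"
              by (rule tri_balance[OF \<open>u' < a\<close> \<open>a \<le> b\<close> f(3)])
            also have "m - u' = w' - 1" using \<open>u' + w' = m + 1\<close> \<open>0 < w'\<close> by simp
            \<comment> \<open>The second set loses \<open>d\<close> on its way to
              \<open>{1..w' - 1}\<close>, while the first one can gain at most \<open>x'\<close> on
              its way to \<open>{1..u'}\<close>, and \<open>x' < d\<close>.\<close>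
            also have "tri u' + tri (w' - 1) < K"
              using K' A(2) compact_le_tri[OF A(1)] tw d \<open>x' < d\<close> by simp
            finally show False by simp
          qed
        qed
        moreover have "root_weight r < P \<longleftrightarrow> P' \<le> P" for P
          by (auto simp: root_weight_def r_eq P'_def)
        ultimately show ?thesis using over True by (simp add: nr d_def)
      next
        case False
        let ?r = "(u', x' - d, w' - 1, 0)"
        have dx: "d \<le> x'" "2 * (P' + d) \<le> K" using False by auto
        have some: "next_root m K r = Some ?r" using over False by (simp add: nr d_def)
        have P'd: "tri u' - (x' - d) = P' + d" using dx A(2) compact_le_tri[OF A(1)] by simp
        have "compact u' (x' - d)" "compact (w' - 1) 0" using A(1) by (auto simp: compact_def)
        moreover have "P' + d + tri (w' - 1) = K" using K' tw d by simp
        moreover have "u' + (w' - 1) \<le> m" using \<open>u' + w' = m + 1\<close> \<open>0 < w'\<close> by simp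
        ultimately have inv: "root_inv m K ?r" using P'd dx(2) by (simp add: root_inv_def)
        have wt: "root_weight ?r = P' + d" "root_weight r + 1 = P'"
          using P'd by (simp_all add: root_weight_def r_eq P'_def)
        have "family m (P, K - P) = {}" if "root_weight r < P" "P < P' + d" for P
          using that dx(1) wt(2) by (intro empty) auto
        thus ?thesis using some inv wt d(1) by auto
      qed
    qed
  qed
qed

text \<open>The weights of the roots increase strictly and pass only over empty families. As they
  never exceed \<open>K\<close>, the assumption on \<open>f\<close> prevents an early end.\<close>

lemma roots_correct:
  assumes "root_inv m K r" "K \<le> root_weight r + f"
  shows "(\<forall>r'\<in>set (roots m K f r). root_inv m K r' \<and> root_weight r \<le> root_weight r') \<and>
    distinct (map root_weight (roots m K f r)) \<and>
    (\<forall>P. root_weight r \<le> P \<and> 2 * P \<le> K \<and> family m (P, K - P) \<noteq> {} \<longrightarrow>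
      P \<in> root_weight ` set (roots m K f r))"
  using assms
proof (induction f arbitrary: r)
  case 0
  thus ?case by (auto simp: root_inv_def root_weight_def split: prod.splits)
next
  case (Suc f)
  show ?case
  proof (cases "next_root m K r")
    case None
    thus ?thesis using next_root[OF Suc.prems(1)] Suc.prems(1) by (auto simp: le_less)
  next
    case (Some r')
    with next_root[OF Suc.prems(1)] have r': "root_inv m K r'" "root_weight r < root_weight r'"
      "\<And>P. root_weight r < P \<Longrightarrow> P < root_weight r' \<Longrightarrow> family m (P, K - P) = {}" by auto
    have IH: "\<forall>q\<in>set (roots m K f r'). root_inv m K q \<and> root_weight r' \<le> root_weight q"
      "distinct (map root_weight (roots m K f r'))"
      "\<And>P. root_weight r' \<le> P \<Longrightarrow> 2 * P \<le> K \<Longrightarrow> family m (P, K - P) \<noteq> {} \<Longrightarrow>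
        P \<in> root_weight ` set (roots m K f r')"
      using Suc.IH[OF r'(1)] Suc.prems(2) r'(2) by auto
    have "P \<in> root_weight ` set (roots m K (Suc f) r)"
      if "root_weight r \<le> P" "2 * P \<le> K" "family m (P, K - P) \<noteq> {}" for P
    proof (cases "P = root_weight r")
      case False
      hence "root_weight r' \<le> P" using that r'(3)[of P] by (meson le_less not_le)
      thus ?thesis using IH(3)[of P] that Some by auto
    qed (simp add: Some)
    thus ?thesis using IH(1,2) r'(2) Suc.prems(1) Some by fastforce
  qed
qed

text \<open>
  Only roots whose first set has at most half of the weight are listed. The other pairs arise by
  swapping the components.
\<close>

definition visits :: "nat \<Rightarrow> root \<Rightarrow> node \<Rightarrow> (nat set \<times> nat set) list" where
  "visits K r v = (if 2 * root_weight r < K then [sets v, prod.swap (sets v)] else [sets v])"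

definition generation :: "nat \<Rightarrow> nat \<Rightarrow> root \<Rightarrow> (nat set \<times> nat set) list" where
  "generation m K r = concat (map (visits K r) (root_subtree m r))"

lemma swap_flip_pairs: "prod.swap p \<in> flip_pairs m \<longleftrightarrow> p \<in> flip_pairs m"
proof -
  have "(B, A) \<in> flip_pairs m" if "(A, B) \<in> flip_pairs m" for A B
    using that unfolding flip_pairs_def by (simp, metis add.commute)
  thus ?thesis by (cases p) auto
qed

lemma weights_swap: "weights (prod.swap p) = prod.swap (weights p)"
  by (cases p) (simp add: weights_def)

lemma swap_family: "prod.swap p \<in> family m (a, b) \<longleftrightarrow> p \<in> family m (b, a)"
  by (cases "weights p") (auto simp: family_def swap_flip_pairs weights_swap)

text \<open>For \<open>2 * P < K\<close> the two families are disjoint, and swapping maps one onto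
  the other. For \<open>2 * P = K\<close> they coincide, so a swap would repeat outputs.\<close>

lemma generation_correct:
  assumes r: "root_inv m K r"
  defines "P \<equiv> root_weight r"
  shows "set (generation m K r) = family m (P, K - P) \<union> family m (K - P, P)" "distinct (generation m K r)"
proof -
  obtain u x w y where r_eq: "r = (u, x, w, y)" by (cases r)
  from r have c: "compact u x" "compact w y" "u + w \<le> m" and K: "tri u - x + (tri w - y) = K"
    and P2: "2 * P \<le> K" by (auto simp: root_inv_def r_eq P_def root_weight_def)
  have Q: "tri w - y = K - P" "tri u - x = P" using K by (auto simp: P_def r_eq root_weight_def)
  note sub = root_subtree[OF c, folded r_eq, unfolded Q]
  have swap: "prod.swap ` family m (a, b) = family m (b, a)" for a b
  proof (intro equalityI subsetI)
    fix p assume "p \<in> family m (b, a)"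
    hence "prod.swap p \<in> family m (a, b)" by (simp add: swap_family)
    thus "p \<in> prod.swap ` family m (a, b)" by (metis imageI swap_swap)
  next
    fix p assume "p \<in> prod.swap ` family m (a, b)"
    then obtain q where "p = prod.swap q" "q \<in> family m (a, b)" by blast
    thus "p \<in> family m (b, a)" by (simp only: swap_family)
  qed
  show "set (generation m K r) = family m (P, K - P) \<union> family m (K - P, P)"
  proof (cases "2 * P < K")
    case True
    have "set (generation m K r) = sets ` set (root_subtree m r) \<union> prod.swap ` sets ` set (root_subtree m r)"
      using True unfolding generation_def visits_def P_def by auto
    thus ?thesis unfolding sub(1) swap .
  next
    case False
    have "set (generation m K r) = sets ` set (root_subtree m r)"
      using False unfolding generation_def visits_def P_def by auto
    moreover have "K - P = P" using False P2 by simp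
    ultimately show ?thesis unfolding sub(1) by simp
  qed
  have w: "weights (sets v) = (P, K - P)" if "v \<in> set (root_subtree m r)" for v
    using sub(1) that by (auto simp: family_def)
  have asym: "sets a \<noteq> prod.swap (sets b)"
    if "2 * P < K" "a \<in> set (root_subtree m r)" "b \<in> set (root_subtree m r)" for a b
  proof
    assume "sets a = prod.swap (sets b)"
    hence "(P, K - P) = prod.swap (P, K - P)"
      using w[OF that(2)] w[OF that(3)] weights_swap[of "sets b"] by simp
    hence "P = K - P" by simp
    thus False using that(1) by linarith
  qed
  show "distinct (generation m K r)"
    unfolding generation_def
  proof (rule distinct_concat_map)
    show "distinct (root_subtree m r)" using sub(2) by (simp add: distinct_map)
  next
    fix v assume "v \<in> set (root_subtree m r)"
    thus "distinct (visits K r v)" using asym[of v v] by (simp add: visits_def P_def)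
  next
    fix v v' assume v: "v \<in> set (root_subtree m r)" "v' \<in> set (root_subtree m r)" "v \<noteq> v'"
    have ne: "sets v \<noteq> sets v'" using sub(2) v unfolding distinct_map by (meson inj_onD)
    hence "prod.swap (sets v) \<noteq> prod.swap (sets v')" by (metis swap_swap)
    thus "set (visits K r v) \<inter> set (visits K r v') = {}"
      using ne asym[OF _ v(1,2)] asym[OF _ v(2,1)] by (auto simp: visits_def P_def)
  qed
qed

theorem generate_all:
  assumes "compact w y" "w \<le> m" "tri w - y = K"
  defines "L \<equiv> concat (map (generation m K) (roots m K K (0, 0, w, y)))"
  shows "set L = {p \<in> flip_pairs m. flip_weight p = K}" "distinct L"
proof -
  let ?R = "roots m K K (0, 0, w, y)"
  have "root_inv m K (0, 0, w, y)" using assms by (simp add: root_inv_def compact_def)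
  hence R: "\<forall>r\<in>set ?R. root_inv m K r" "distinct (map root_weight ?R)"
    "\<And>P. 2 * P \<le> K \<Longrightarrow> family m (P, K - P) \<noteq> {} \<Longrightarrow> P \<in> root_weight ` set ?R"
    using roots_correct[of m K "(0, 0, w, y)" K] by (auto simp: root_weight_def)
  have half: "2 * root_weight r \<le> K" if "r \<in> set ?R" for r
    using R(1) that by (auto simp: root_inv_def root_weight_def)
  have fw: "p \<in> family m (P, Q) \<longleftrightarrow> p \<in> flip_pairs m \<and> fst (weights p) = P \<and> snd (weights p) = Q" for p P Q
    by (auto simp: family_def)
  have flip: "flip_weight p = fst (weights p) + snd (weights p)" for p
    by (cases p) (simp add: flip_weight_def weights_def)
  show "set L = {p \<in> flip_pairs m. flip_weight p = K}"
  proof (intro equalityI subsetI)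
    fix p assume "p \<in> set L"
    then obtain r where r: "r \<in> set ?R" "p \<in> set (generation m K r)" by (auto simp: L_def)
    thus "p \<in> {p \<in> flip_pairs m. flip_weight p = K}"
      using generation_correct(1)[of m K r] R(1) half[OF r(1)] by (auto simp: fw flip)
  next
    fix p assume "p \<in> {p \<in> flip_pairs m. flip_weight p = K}"
    hence p: "p \<in> flip_pairs m" "fst (weights p) + snd (weights p) = K" by (auto simp: flip)
    define P where "P = min (fst (weights p)) (snd (weights p))"
    have "p \<in> family m (P, K - P) \<or> p \<in> family m (K - P, P)" and "2 * P \<le> K"
      using p unfolding fw P_def by auto
    moreover have "prod.swap p \<in> family m (P, K - P)" if "p \<in> family m (K - P, P)"
      using that by (auto simp: fw swap_flip_pairs weights_swap)
    ultimately have "family m (P, K - P) \<noteq> {}" by blast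
    then obtain r where r: "r \<in> set ?R" "root_weight r = P" using R(3)[OF \<open>2 * P \<le> K\<close>] by auto
    hence "p \<in> set (generation m K r)"
      using generation_correct(1)[of m K r] R(1) \<open>p \<in> family m (P, K - P) \<or> _\<close> by auto
    thus "p \<in> set L" using r(1) by (auto simp: L_def)
  qed
  show "distinct L" unfolding L_def
  proof (rule distinct_concat_map)
    show "distinct ?R" using R(2) by (simp add: distinct_map)
  next
    fix r r' assume r: "r \<in> set ?R" "r' \<in> set ?R" "r \<noteq> r'"
    hence "root_weight r \<noteq> root_weight r'" using R(2) by (auto simp: distinct_map dest: inj_onD)
    thus "set (generation m K r) \<inter> set (generation m K r') = {}"
      using generation_correct(1)[of m K r] generation_correct(1)[of m K r'] R(1) r half[OF r(1)] half[OF r(2)]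
      by (auto simp: fw)
  qed (use generation_correct(2) R(1) in blast)
qed

text \<open>If even \<open>{1..m}\<close> is too light for the target, there is nothing to generate.
  Splitting \<open>m\<close> into \<open>u + w\<close> only loses weight, as \<open>tri\<close> is
  superadditive.\<close>

lemma flip_weight_bound:
  assumes "p \<in> flip_pairs m"
  shows "flip_weight p \<le> tri m"
proof -
  have bound: "tri u - x + (tri w - y) \<le> tri m" if "u + w \<le> m" for u x w y
  proof -
    have "2 * (tri u + tri w) \<le> 2 * tri (u + w)"
      unfolding distrib_left double_tri by (simp add: algebra_simps)
    hence "tri u + tri w \<le> tri m" using tri_mono[OF that] by simp
    thus ?thesis by simp
  qed
  have "p \<in> family m (weights p)" using assms by (simp add: family_def)
  then obtain u x w y where "u + w \<le> m" "weights p = (tri u - x, tri w - y)" by (rule family_root) blast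
  with bound[of u w x y] show ?thesis by (cases p) (simp add: flip_weight_def weights_def)
qed


section \<open>Loop-free programs and the lookup program\<close>

fun loop_free :: "com \<Rightarrow> bool" where
  "loop_free (Seq p q) \<longleftrightarrow> loop_free p \<and> loop_free q"
| "loop_free (If e p q) \<longleftrightarrow> loop_free p \<and> loop_free q"
| "loop_free (While e p) \<longleftrightarrow> False"
| "loop_free _ \<longleftrightarrow> True"

fun final :: "nat \<Rightarrow> com \<Rightarrow> state \<Rightarrow> state" where
  "final w Skip s = s"
| "final w (Assign x e) s = set_var x (eval_expr w e s) s"
| "final w (Store a d e) s = set_elem a (eval_expr w d s) (eval_expr w e s) s"
| "final w (Seq p q) s = final w q (final w p s)"
| "final w (If e p q) s = (if eval_expr w e s = 0 then final w q s else final w p s)"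
| "final w (While e p) s = s"
| "final w Visit s = s"

fun outputs :: "nat \<Rightarrow> com \<Rightarrow> state \<Rightarrow> state list" where
  "outputs w (Seq p q) s = outputs w p s @ outputs w q (final w p s)"
| "outputs w (If e p q) s = (if eval_expr w e s = 0 then outputs w q s else outputs w p s)"
| "outputs w Visit s = [s]"
| "outputs w _ s = []"

fun cost :: "com \<Rightarrow> nat" where
  "cost (Assign x e) = 1 + expr_cost e"
| "cost (Store a d e) = 1 + expr_cost d + expr_cost e"
| "cost (Seq p q) = cost p + cost q"
| "cost (If e p q) = 1 + expr_cost e + max (cost p) (cost q)"
| "cost _ = 1"

text \<open>Runs of loop-free code can thus be computed by rewriting with \<open>final\<close> and
  \<open>outputs\<close>. Only the three loops of the generator are left to the relational
  semantics.\<close>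

lemma exec_loop_free:
  "loop_free p \<Longrightarrow> \<exists>t\<le>cost p. exec w p s (outputs w p s) t (final w p s)"
proof (induction p arbitrary: s)
  case Skip
  show ?case using exec.Skip[of w s] by auto
next
  case (Assign x e)
  show ?case using exec.Assign[of w x e s] by auto
next
  case (Store a d e)
  show ?case using exec.Store[of w a d e s] by auto
next
  case (Seq p q)
  then obtain t u where "t \<le> cost p" "exec w p s (outputs w p s) t (final w p s)"
    "u \<le> cost q" "exec w q (final w p s) (outputs w q (final w p s)) u (final w q (final w p s))"
    by (meson loop_free.simps(1))
  thus ?case using exec.Seq by (intro exI[of _ "t + u"]) simp
next
  case (If e p q)
  then obtain t u where "t \<le> cost p" "exec w p s (outputs w p s) t (final w p s)"
    "u \<le> cost q" "exec w q s (outputs w q s) u (final w q s)"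
    by (meson loop_free.simps(2))
  note t = this
  show ?case
  proof (cases "eval_expr w e s = 0")
    case True
    show ?thesis using exec.IfFalse[OF True t(4), of p] t(3) True
      by (intro exI[of _ "1 + expr_cost e + u"]) simp
  next
    case False
    show ?thesis using exec.IfTrue[OF False t(2), of q] t(1) False
      by (intro exI[of _ "1 + expr_cost e + t"]) simp
  qed
next
  case Visit
  show ?case using exec.Visit[of w s] by auto
qed simp

fun visit_free :: "com \<Rightarrow> bool" where
  "visit_free (Seq p q) \<longleftrightarrow> visit_free p \<and> visit_free q"
| "visit_free (If e p q) \<longleftrightarrow> visit_free p \<and> visit_free q"
| "visit_free Visit \<longleftrightarrow> False"
| "visit_free _ \<longleftrightarrow> True"

lemma outputs_visit_free: "visit_free p \<Longrightarrow> outputs w p s = []"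
  by (induction p arbitrary: s) auto

lemma vars_set_var [simp]: "vars (set_var x v s) = (vars s)(x := v)"
  by (simp add: set_var_def)

lemma arrs_set_var [simp]: "arrs (set_var x v s) = arrs s"
  by (simp add: set_var_def)

lemma vars_set_elem [simp]: "vars (set_elem a i v s) = vars s"
  by (simp add: set_elem_def)

lemma arrs_set_elem [simp]: "arrs (set_elem a i v s) = (arrs s)(a := (arrs s a)(i := v))"
  by (simp add: set_elem_def)

lemma set_var_twice [simp]: "set_var x a (set_var x b s) = set_var x a s"
  by (simp add: set_var_def)

text \<open>
  \<open>iterates w e p s out T s'\<close>: the loop arrives at \<open>s'\<close> within \<open>T\<close> steps, whether or not it goes on from
  there.
\<close>

definition iterates :: "nat \<Rightarrow> expr \<Rightarrow> com \<Rightarrow> state \<Rightarrow> state list \<Rightarrow> nat \<Rightarrow> state \<Rightarrow> bool" where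
  "iterates w e p s out T s' \<longleftrightarrow>
     (\<forall>out' t' s''. exec w (While e p) s' out' t' s'' \<longrightarrow>
        (\<exists>t\<le>T + t'. exec w (While e p) s (out @ out') t s''))"

lemma iterates_refl: "iterates w e p s [] 0 s"
  by (auto simp: iterates_def)

lemma iterates_trans:
  assumes "iterates w e p s out T s'" "iterates w e p s' out' T' s''"
  shows "iterates w e p s (out @ out') (T + T') s''"
  unfolding iterates_def
proof (intro allI impI)
  fix o3 t3 s3 assume "exec w (While e p) s'' o3 t3 s3"
  then obtain t2 where "t2 \<le> T' + t3" "exec w (While e p) s' (out' @ o3) t2 s3"
    using assms(2) unfolding iterates_def by blast
  then obtain t1 where "t1 \<le> T + t2" "exec w (While e p) s (out @ out' @ o3) t1 s3"
    using assms(1) unfolding iterates_def by blast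
  thus "\<exists>t\<le>T + T' + t3. exec w (While e p) s ((out @ out') @ o3) t s3"
    using \<open>t2 \<le> T' + t3\<close> by (intro exI[of _ t1]) simp
qed

lemma iterates_mono: "iterates w e p s out T s' \<Longrightarrow> T \<le> T' \<Longrightarrow> iterates w e p s out T' s'"
  unfolding iterates_def by (meson add_le_mono1 le_trans)

lemma iterates_once:
  assumes "eval_expr w e s \<noteq> 0" "exec w p s out t s'" "1 + expr_cost e + t \<le> T"
  shows "iterates w e p s out T s'"
  unfolding iterates_def
proof (intro allI impI)
  fix o2 t2 s2 assume "exec w (While e p) s' o2 t2 s2"
  from exec.WhileTrue[OF assms(1,2) this] assms(3)
  show "\<exists>t\<le>T + t2. exec w (While e p) s (out @ o2) t s2"
    by (intro exI[of _ "1 + expr_cost e + t + t2"]) simp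
qed

lemma iterates_body:
  assumes "eval_expr w e s \<noteq> 0" "loop_free p"
  shows "iterates w e p s (outputs w p s) (1 + expr_cost e + cost p) (final w p s)"
proof -
  obtain t where "t \<le> cost p" "exec w p s (outputs w p s) t (final w p s)"
    using exec_loop_free[OF assms(2)] by blast
  thus ?thesis by (intro iterates_once[OF assms(1)]) auto
qed

lemma exec_iterates:
  assumes "iterates w e p s out T s'" "eval_expr w e s' = 0"
  shows "\<exists>t\<le>T + 1 + expr_cost e. exec w (While e p) s out t s'"
  using assms(1) exec.WhileFalse[OF assms(2), of p] unfolding iterates_def by fastforce

section \<open>Locating the tile over a cell\<close>

abbreviation "Plus \<equiv> Op Add"
abbreviation "Minus \<equiv> Op Sub"
abbreviation "Lt \<equiv> Op Less"

fun block :: "com list \<Rightarrow> com" where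
  "block [] = Skip"
| "block [p] = p"
| "block (p # ps) = Seq p (block ps)"

definition Odd :: "expr \<Rightarrow> expr" where "Odd e = Op Rem e (Const 2)"

text \<open>The two sets are interleaved in one array. Array names are fixed in a program, so this
  is what allows a variable to select the set.\<close>

definition cell_index :: "expr \<Rightarrow> expr \<Rightarrow> expr" where
  "cell_index i t = Plus (Plus i i) t"

definition fold_code :: "vname \<Rightarrow> com" where
  "fold_code x = If (Lt (Var x) (Var ''n'')) Skip
     (Assign x (Minus (Minus (Plus (Var ''n'') (Var ''n'')) (Const 1)) (Var x)))"

definition swap_code :: com where
  "swap_code = If (Odd (Var ''n''))
     (block [Assign ''u'' (Var ''row''), Assign ''row'' (Var ''col''), Assign ''col'' (Var ''u'')]) Skip"

text \<open>A strip index 0 is not looked up, because the array is unspecified there. The variable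
  then already has the value 0, which means not flipped.\<close>

definition strip_code :: com where
  "strip_code = block [
     Assign ''p'' (Odd (Plus (Var ''row'') (Var ''col''))),
     Assign ''a'' (Plus (Plus (Var ''row'') (Var ''col'')) (Var ''p'')),
     fold_code ''a'',
     Assign ''b'' (Minus (Minus (Plus (Var ''n'') (Var ''row'')) (Var ''col'')) (Var ''p'')),
     fold_code ''b'',
     If (Var ''a'') (Assign ''a'' (Elem ''S'' (cell_index (Var ''a'') (Var ''s'')))) Skip,
     If (Var ''b'') (Assign ''b'' (Elem ''S'' (cell_index (Var ''b'') (Minus (Const 1) (Var ''s''))))) Skip]"

definition tile_code :: com where
  "tile_code = If (Plus (Var ''a'') (Var ''b''))
     (If (Op Equal (Var ''a'') (Var ''p''))
        (If (Op Equal (Var ''row'') (Minus (Var ''n'') (Const 1))) (Assign ''kind'' (Const 0)) (Assign ''kind'' (Const 2)))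
        (If (Var ''row'') (Seq (Assign ''row'' (Minus (Var ''row'') (Const 1))) (Assign ''kind'' (Const 2)))
           (Assign ''kind'' (Const 0))))
     (If (Var ''p'')
        (If (Op Equal (Var ''col'') (Minus (Var ''n'') (Const 1))) (Assign ''kind'' (Const 0)) (Assign ''kind'' (Const 1)))
        (If (Var ''col'') (Seq (Assign ''col'' (Minus (Var ''col'') (Const 1))) (Assign ''kind'' (Const 1)))
           (Assign ''kind'' (Const 0))))"

definition transpose_code :: com where
  "transpose_code = Seq swap_code
     (If (Odd (Var ''n'')) (If (Var ''kind'') (Assign ''kind'' (Minus (Const 3) (Var ''kind''))) Skip) Skip)"

definition lookup_code :: com where
  "lookup_code = block [swap_code, strip_code, tile_code, transpose_code]"

text \<open>
  The index 0 is exempt, since moving the element 1 downwards writes to this place.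
\<close>

definition bits :: "(nat \<Rightarrow> nat) \<Rightarrow> (nat \<Rightarrow> nat set) \<Rightarrow> bool" where
  "bits f S \<longleftrightarrow> (\<forall>t<2. \<forall>i\<ge>1. f (i + i + t) = of_bool (i \<in> S t))"

text \<open>The variable \<open>s\<close> selects the half of the array that shows the first set. So
  the swapped pair is presented by changing a flag, without touching the arrays.\<close>

definition shows_pair :: "nat \<Rightarrow> state \<Rightarrow> nat set \<times> nat set \<Rightarrow> bool" where
  "shows_pair n s P \<longleftrightarrow> vars s ''n'' = n \<and> vars s ''s'' \<le> 1 \<and>
     bits (arrs s ''S'') (\<lambda>t. if t = vars s ''s'' then fst P else snd P)"

lemma final_swap_code:
  assumes "0 < w" "2 < (2::nat) ^ w"
  shows "final w swap_code s = (if odd (vars s ''n'')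
    then set_var ''col'' (vars s ''row'') (set_var ''row'' (vars s ''col'') (set_var ''u'' (vars s ''row'') s)) else s)"
proof -
  have "vars s ''n'' mod 2 < 2 ^ w" using assms(2) by (rule less_trans[rotated]) simp
  thus ?thesis using assms by (auto simp: swap_code_def Odd_def odd_iff_mod_2_eq_one)
qed

lemma result_tile_swap:
  "result_tile s' = transpose_tile (result_tile s)"
  if "vars s' ''row'' = vars s ''col''" "vars s' ''col'' = vars s ''row''"
    "vars s' ''kind'' = (if vars s ''kind'' = 0 then 0 else 3 - vars s ''kind'')" "vars s ''kind'' \<le> 2"
proof -
  have "vars s ''kind'' = 0 \<or> vars s ''kind'' = 1 \<or> vars s ''kind'' = 2" using that(4) by linarith
  thus ?thesis using that(1-3) by (auto simp: result_tile_def)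
qed

lemma base_lookup_code:
  assumes W: "4 * n + 8 \<le> (2::nat) ^ w" and n: "1 \<le> n" "vars s ''n'' = n"
    and ij: "vars s ''row'' < n" "vars s ''col'' < n" and sw: "vars s ''s'' \<le> 1"
    and bits: "bits (arrs s ''S'') (\<lambda>t. if t = vars s ''s'' then A else B)" and zero: "0 \<notin> A" "0 \<notin> B"
  defines "s' \<equiv> final w (Seq strip_code tile_code) s"
  shows "result_tile s' = base_lookup n A B (vars s ''row'') (vars s ''col'')" "vars s' ''kind'' \<le> 2"
    "vars s' ''n'' = n"
proof -
  define i j where "i = vars s ''row''" and "j = vars s ''col''"
  define p where "p = (i + j) mod 2"
  define a b where "a = fold_strip n (i + j + p)" and "b = fold_strip n (n + i - j - p)"
  define \<alpha> \<beta> where "\<alpha> \<longleftrightarrow> a \<in> A" and "\<beta> \<longleftrightarrow> b \<in> B"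
  define W where "W = (2::nat) ^ w"
  have p: "p \<le> 1" by (simp add: p_def)
  \<comment> \<open>Array indices are therefore at most \<open>4 * n + 1\<close>, within the assumed
    word size.\<close>
  have ab: "a \<le> 2 * n" "b \<le> 2 * n" using ij p by (auto simp: a_def b_def i_def j_def fold_strip_def)
  have Sa: "0 < a \<Longrightarrow> arrs s ''S'' (a + a + vars s ''s'') = of_bool \<alpha>"
    using bits sw by (auto simp: bits_def \<alpha>_def)
  have Sb: "0 < b \<Longrightarrow> arrs s ''S'' (b + b + (1 - vars s ''s'')) = of_bool \<beta>"
  proof -
    assume "0 < b"
    have "1 - vars s ''s'' \<noteq> vars s ''s''" "1 - vars s ''s'' < 2" using sw by arith+
    thus ?thesis using bits \<open>0 < b\<close> by (simp add: bits_def \<beta>_def)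
  qed
  have zero': "a = 0 \<Longrightarrow> \<not> \<alpha>" "b = 0 \<Longrightarrow> \<not> \<beta>" using zero by (auto simp: \<alpha>_def \<beta>_def)
  have W': "4 * n + 8 \<le> W" using W by (simp add: W_def)
  have ijn: "i < n" "j < n" using ij by (auto simp: i_def j_def)
  note eqs = i_def[symmetric] j_def[symmetric] W_def[symmetric] n(2)
  have f: "final w (fold_code x) t = (if vars t x < n then t else set_var x (2 * n - 1 - vars t x) t)"
    if "vars t ''n'' = n" for x t
    using that W' n(1) by (simp add: fold_code_def W_def[symmetric] mult_2)
  define t1 where "t1 = set_var ''p'' p s"
  define t2 where "t2 = set_var ''a'' a t1"
  define t3 where "t3 = set_var ''b'' b t2"
  define t4 where "t4 = set_var ''a'' (of_bool \<alpha>) t3"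
  define t5 where "t5 = set_var ''b'' (of_bool \<beta>) t4"
  have "p < W" using p W' by simp
  have 1: "final w (Assign ''p'' (Odd (Plus (Var ''row'') (Var ''col'')))) s = t1"
    using W' ijn \<open>p < W\<close> by (simp add: Odd_def eqs t1_def p_def)
  have 2: "final w (fold_code ''a'') (final w (Assign ''a'' (Plus (Plus (Var ''row'') (Var ''col'')) (Var ''p''))) t1) = t2"
    using W' ijn p by (simp add: f t2_def t1_def eqs a_def fold_strip_def)
  have 3: "final w (fold_code ''b'') (final w (Assign ''b'' (Minus (Minus (Plus (Var ''n'') (Var ''row'')) (Var ''col'')) (Var ''p''))) t2) = t3"
    using W' ijn p by (simp add: f t3_def t2_def t1_def eqs b_def fold_strip_def)
  have idle: "set_var x (vars s x) s = s" for x s by (simp add: set_var_def)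
  have 4: "final w (If (Var ''a'') (Assign ''a'' (Elem ''S'' (cell_index (Var ''a'') (Var ''s'')))) Skip) t3 = t4"
  proof (cases "a = 0")
    case True
    have "t4 = set_var ''a'' (vars t3 ''a'') t3" using True zero'(1) by (simp add: t4_def t3_def t2_def)
    thus ?thesis using True unfolding idle by (simp add: t3_def t2_def)
  next
    case False
    thus ?thesis using Sa W' ab sw by (simp add: cell_index_def t4_def t3_def t2_def t1_def eqs)
  qed
  have 5: "final w (If (Var ''b'') (Assign ''b'' (Elem ''S'' (cell_index (Var ''b'') (Minus (Const 1) (Var ''s''))))) Skip) t4 = t5"
  proof (cases "b = 0")
    case True
    have "t5 = set_var ''b'' (vars t4 ''b'') t4" using True zero'(2) by (simp add: t5_def t4_def t3_def)
    thus ?thesis using True unfolding idle by (simp add: t4_def t3_def)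
  next
    case False
    thus ?thesis using Sb W' ab sw by (simp add: cell_index_def t5_def t4_def t3_def t2_def t1_def eqs)
  qed
  have strip: "final w strip_code s = t5"
    using 1 2 3 4 5 by (simp add: strip_code_def)
  have t5: "vars t5 ''row'' = i" "vars t5 ''col'' = j" "vars t5 ''p'' = p" "vars t5 ''n'' = n"
      "vars t5 ''a'' = of_bool \<alpha>" "vars t5 ''b'' = of_bool \<beta>"
    by (simp_all add: t5_def t4_def t3_def t2_def t1_def eqs)
  have lookup: "base_lookup n A B i j =
      (if \<alpha> \<or> \<beta> then
         if \<alpha> = (p = 1) then if i = n - 1 then Mono i j else VDom i j
         else if i = 0 then Mono i j else VDom (i - 1) j
       else if p = 1 then if j = n - 1 then Mono i j else HDom i j
       else if j = 0 then Mono i j else HDom i (j - 1))"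
    by (simp add: base_lookup_def \<alpha>_def \<beta>_def a_def b_def p_def Let_def)
  have "p = 0 \<or> p = 1" using p by linarith
  hence "result_tile s' = base_lookup n A B i j \<and> vars s' ''kind'' \<le> 2 \<and> vars s' ''n'' = n"
    unfolding lookup s'_def final.simps strip tile_code_def using W' ijn n(1)
    by (cases \<alpha>; cases \<beta>; elim disjE) (simp_all add: t5 W_def[symmetric] result_tile_def)
  thus "result_tile s' = base_lookup n A B (vars s ''row'') (vars s ''col'')" "vars s' ''kind'' \<le> 2"
    "vars s' ''n'' = n"
    by (simp_all add: i_def j_def)
qed

lemma lookup_code:
  assumes W: "4 * n + 8 \<le> (2::nat) ^ w" and n: "1 \<le> n" and P: "P \<in> flip_pairs (n - 2)"
    and sp: "shows_pair n s P"
  shows "represents w lookup_code (cost lookup_code) n s (tiling n P)"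
  unfolding represents_def
proof (intro allI impI)
  fix r c assume rc: "r < n" "c < n"
  obtain A B where AB: "P = (A, B)" by (cases P)
  have zero: "0 \<notin> A" "0 \<notin> B" using P by (auto simp: AB flip_pairs_def)
  define s0 where "s0 = set_var ''row'' r (set_var ''col'' c s)"
  define i j where "i = (if odd n then c else r)" and "j = (if odd n then r else c)"
  define s1 where "s1 = final w swap_code s0"
  have w: "0 < w" "2 < (2::nat) ^ w" using W by (cases w; simp)+
  have s1: "vars s1 ''row'' = i" "vars s1 ''col'' = j" "vars s1 ''n'' = n" "vars s1 ''s'' = vars s ''s''"
    "arrs s1 = arrs s"
    using sp by (simp_all add: s1_def s0_def final_swap_code[OF w] i_def j_def shows_pair_def)
  define s2 where "s2 = final w (Seq strip_code tile_code) s1"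
  have s2: "result_tile s2 = base_lookup n A B i j" "vars s2 ''kind'' \<le> 2" "vars s2 ''n'' = n"
  proof -
    have "vars s1 ''row'' < n" "vars s1 ''col'' < n" using rc s1 by (simp_all add: i_def j_def)
    moreover have "vars s1 ''s'' \<le> 1" "bits (arrs s1 ''S'') (\<lambda>t. if t = vars s1 ''s'' then A else B)"
      using sp unfolding shows_pair_def AB fst_conv snd_conv s1 by simp_all
    ultimately show "result_tile s2 = base_lookup n A B i j" "vars s2 ''kind'' \<le> 2" "vars s2 ''n'' = n"
      using base_lookup_code[OF W n s1(3) _ _ _ _ zero] unfolding s2_def s1(1,2) by blast+
  qed
  define s3 where "s3 = final w transpose_code s2"
  have "result_tile s3 = (if odd n then transpose_tile (result_tile s2) else result_tile s2)"
  proof (cases "odd n")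
    case True
    have "result_tile s3 = transpose_tile (result_tile s2)"
      using True s2(2,3) W n
      by (intro result_tile_swap) (auto simp: s3_def transpose_code_def final_swap_code[OF w] Odd_def odd_iff_mod_2_eq_one)
    thus ?thesis using True by simp
  next
    case False
    thus ?thesis using s2(3) w
      by (simp add: s3_def transpose_code_def final_swap_code[OF w] Odd_def even_iff_mod_2_eq_zero)
  qed
  hence tile: "result_tile s3 = (if odd n then transpose_tile (base_lookup n A B i j) else base_lookup n A B i j)"
    by (simp add: s2(1))
  have ij: "i < n" "j < n" using rc by (auto simp: i_def j_def)
  note look = base_lookup[OF n P[unfolded AB] ij]
  have "result_tile s3 \<in> tiling n P"
    using look(1) by (auto simp: tile tiling_def AB)
  moreover have "(r, c) \<in> cells (result_tile s3)"
  proof -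
    have swapped: "(j, i) \<in> prod.swap ` cells (base_lookup n A B i j)"
      using look(2) by (intro image_eqI[of _ _ "(i, j)"]) simp_all
    show ?thesis
    proof (cases "odd n")
      case True
      hence "(r, c) = (j, i)" by (simp add: i_def j_def)
      thus ?thesis using swapped True unfolding tile by (simp only: cells_transpose if_True not_False_eq_True)
    next
      case False
      hence "(r, c) = (i, j)" by (simp add: i_def j_def)
      thus ?thesis using look(2) False unfolding tile by (simp only: if_False not_False_eq_True not_True_eq_False)
    qed
  qed
  moreover have "loop_free lookup_code"
    by (simp add: lookup_code_def swap_code_def strip_code_def tile_code_def transpose_code_def fold_code_def)
  then obtain t where "t \<le> cost lookup_code" "exec w lookup_code s0 (outputs w lookup_code s0) t (final w lookup_code s0)"
    using exec_loop_free by blast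
  moreover have "visit_free lookup_code"
    by (simp add: lookup_code_def swap_code_def strip_code_def tile_code_def transpose_code_def fold_code_def)
  hence "outputs w lookup_code s0 = []" by (rule outputs_visit_free)
  moreover have "final w lookup_code s0 = s3"
    by (simp only: lookup_code_def block.simps final.simps s3_def s2_def s1_def)
  ultimately show "\<exists>t s'. exec w lookup_code (set_var ''row'' r (set_var ''col'' c s)) [] t s' \<and> t \<le> cost lookup_code \<and>
      result_tile s' \<in> tiling n P \<and> (r, c) \<in> cells (result_tile s')"
    unfolding s0_def by metis
qed


section \<open>One step of the traversal\<close>

lemma set_var_same [simp]: "set_var x (vars s x) s = s"
  by (simp add: set_var_def)

lemma bits_cong:
  "(\<And>t i. t < 2 \<Longrightarrow> 1 \<le> i \<Longrightarrow> i \<in> S t \<longleftrightarrow> i \<in> S' t) \<Longrightarrow> bits f S \<Longrightarrow> bits f S'"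
  unfolding bits_def by simp

lemma index_inject:
  fixes i j t u :: nat
  assumes "t < 2" "u < 2"
  shows "i + i + t = j + j + u \<longleftrightarrow> i = j \<and> t = u"
  using assms by presburger

lemma bits_insert:
  assumes "bits f S" "t < 2"
  shows "bits (f(i + i + t := 1)) (S(t := insert i (S t)))"
  using assms index_inject[of _ t] unfolding bits_def by auto

lemma bits_remove:
  assumes "bits f S" "t < 2"
  shows "bits (f(i + i + t := 0)) (S(t := S t - {i}))"
  using assms index_inject[of _ t] unfolding bits_def by auto

lemma eval_cell_index:
  assumes "eval_expr w i s = a" "eval_expr w t s = b" "a + a + b < 2 ^ w"
  shows "eval_expr w (cell_index i t) s = a + a + b"
  using assms by (simp add: cell_index_def)

section \<open>Code of the depth-first walk\<close>

definition select_code :: com where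
  "select_code = block [
     Assign ''t'' (Op Quot (Var ''c'') (Const 4)),
     If (Odd (Op Quot (Var ''c'') (Const 2))) (Assign ''g'' (Plus (Elem ''G'' (Var ''t'')) (Const 1)))
       (Assign ''g'' (Const 1)),
     If (Odd (Var ''c'')) (Assign ''x'' (Minus (Elem ''X'' (Var ''t'')) (Const 1)))
       (Assign ''x'' (Elem ''M'' (Var ''t'')))]"

text \<open>The product is nonzero iff the second set would move although the first is not compact.
  The sum is 0 iff a maximum would grow although the two maxima already add up to at least
  \<open>m\<close>.\<close>

definition member_code :: com where
  "member_code = Seq (Assign ''q'' (Const 0))
     (If (Elem ''S'' (cell_index (Var ''g'') (Var ''t'')))
       (If (Elem ''S'' (cell_index (Var ''x'') (Var ''t'')))
         (If (Lt (Var ''g'') (Var ''x''))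
           (If (Op Mul (Var ''t'') (Lt (Elem ''G'' (Const 0)) (Elem ''X'' (Const 0)))) Skip
             (If (Plus (Odd (Var ''c'')) (Lt (Plus (Elem ''M'' (Const 0)) (Elem ''M'' (Const 1))) (Var ''m'')))
               (Assign ''q'' (Const 1)) Skip))
           Skip) Skip) Skip)"

text \<open>The number of the kid and three old values suffice. The set is not copied, since the
  places of the move are the extreme gaps of the kid and can be read there on the way back.\<close>

definition push_code :: com where
  "push_code = block [
     Store ''a'' (Var ''d'') (Var ''c''), Store ''b'' (Var ''d'') (Elem ''G'' (Var ''t'')),
     Store ''e'' (Var ''d'') (Elem ''X'' (Var ''t'')), Store ''f'' (Var ''d'') (Elem ''M'' (Var ''t'')),
     Assign ''d'' (Plus (Var ''d'') (Const 1))]"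

definition spread_code :: com where
  "spread_code = block [
     Store ''S'' (cell_index (Var ''g'') (Var ''t'')) (Const 0),
     Store ''S'' (cell_index (Minus (Var ''g'') (Const 1)) (Var ''t'')) (Const 1),
     Store ''S'' (cell_index (Var ''x'') (Var ''t'')) (Const 0),
     Store ''S'' (cell_index (Plus (Var ''x'') (Const 1)) (Var ''t'')) (Const 1)]"

definition move_code :: com where
  "move_code = block [
     Store ''G'' (Var ''t'') (Var ''g''), Store ''X'' (Var ''t'') (Var ''x''),
     If (Odd (Var ''c'')) Skip (Store ''M'' (Var ''t'') (Plus (Var ''x'') (Const 1))),
     Assign ''c'' (Const 0)]"

definition visit_code :: com where
  "visit_code = Seq Visit (If (Var ''z'') (block [Assign ''s'' (Const 1), Visit, Assign ''s'' (Const 0)]) Skip)"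

definition try_code :: com where
  "try_code = block [select_code, member_code,
     If (Var ''q'') (block [push_code, spread_code, move_code, visit_code])
       (Assign ''c'' (Plus (Var ''c'') (Const 1)))]"

definition unspread_code :: com where
  "unspread_code = block [
     Store ''S'' (cell_index (Minus (Var ''g'') (Const 1)) (Var ''t'')) (Const 0),
     Store ''S'' (cell_index (Plus (Var ''x'') (Const 1)) (Var ''t'')) (Const 0),
     Store ''S'' (cell_index (Var ''g'') (Var ''t'')) (Const 1),
     Store ''S'' (cell_index (Var ''x'') (Var ''t'')) (Const 1)]"

definition pop_code :: com where
  "pop_code = block [
     Assign ''d'' (Minus (Var ''d'') (Const 1)), Assign ''c'' (Elem ''a'' (Var ''d'')),
     Assign ''t'' (Op Quot (Var ''c'') (Const 4)),
     Assign ''g'' (Elem ''G'' (Var ''t'')), Assign ''x'' (Elem ''X'' (Var ''t''))]"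

definition restore_code :: com where
  "restore_code = block [
     Store ''G'' (Var ''t'') (Elem ''b'' (Var ''d'')), Store ''X'' (Var ''t'') (Elem ''e'' (Var ''d'')),
     Store ''M'' (Var ''t'') (Elem ''f'' (Var ''d'')), Assign ''c'' (Plus (Var ''c'') (Const 1))]"

definition walk_guard :: expr where
  "walk_guard = Plus (Lt (Var ''c'') (Const 8)) (Lt (Const 0) (Var ''d''))"

definition walk_body :: com where
  "walk_body = If (Lt (Var ''c'') (Const 8)) try_code (block [pop_code, unspread_code, restore_code])"

definition walk_cost :: nat where
  "walk_cost = 1 + expr_cost walk_guard + cost walk_body"

definition holds :: "nat \<Rightarrow> state \<Rightarrow> node \<Rightarrow> bool" where
  "holds m s v \<longleftrightarrow> (case v of (S, G, X, M) \<Rightarrow> vars s ''m'' = m \<and> bits (arrs s ''S'') S \<and>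
     (\<forall>t<2. arrs s ''G'' t = G t \<and> arrs s ''X'' t = X t \<and> arrs s ''M'' t = M t))"

definition frame :: "nat \<Rightarrow> state \<Rightarrow> state \<Rightarrow> bool" where
  "frame D s s' \<longleftrightarrow> (\<forall>y\<in>{''n'', ''K'', ''P'', ''z'', ''s'', ''o''}. vars s' y = vars s y) \<and>
     (\<forall>i<D. \<forall>A\<in>{''a'', ''b'', ''e'', ''f''}. arrs s' A i = arrs s A i)"

definition visits_if :: "bool \<Rightarrow> nat set \<times> nat set \<Rightarrow> (nat set \<times> nat set) list" where
  "visits_if b P = (if b then [P, prod.swap P] else [P])"

lemma frame_refl: "frame D s s"
  by (simp add: frame_def)

lemma frame_trans: "frame D s s' \<Longrightarrow> frame D' s' s'' \<Longrightarrow> D \<le> D' \<Longrightarrow> frame D s s''"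
  unfolding frame_def by auto

lemma gaps_low_le: "gaps A g x M \<Longrightarrow> g \<le> M + 1"
proof (rule ccontr)
  assume g: "gaps A g x M" "\<not> g \<le> M + 1"
  hence "M + 1 \<in> {1..<g}" by simp
  hence "M + 1 \<in> A" using g by (auto simp: gaps_def)
  with gaps_le[OF g(1)] show False by fastforce
qed

lemma proper_bounds:
  assumes "proper m (S, G, X, M)" "t < 2"
  shows "G t \<le> m + 1" "X t \<le> m" "M t \<le> m" "M 0 + M 1 \<le> m" "S t \<subseteq> {1..m}"
proof -
  have g: "gaps (S t) (G t) (X t) (M t)" and m: "M 0 + M 1 \<le> m"
    using assms by (auto simp: proper_def less_2_cases_iff)
  have "M t \<le> M 0 + M 1" using assms(2) by (auto simp: less_2_cases_iff)
  thus "G t \<le> m + 1" "X t \<le> m" "M t \<le> m" "M 0 + M 1 \<le> m" "S t \<subseteq> {1..m}"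
    using gaps_low_le[OF g] g m by (fastforce simp: gaps_def)+
qed

locale machine =
  fixes w m :: nat
  assumes W: "4 * m + 30 \<le> (2::nat) ^ w"
begin

lemma W_pos: "30 \<le> (2::nat) ^ w" "0 < w"
  using W by (auto intro: gr0I)

lemma W_ge: "30 \<le> (2::nat) ^ w" "m + 5 < (2::nat) ^ w"
  using W by auto

lemma final_select:
  assumes h: "holds m s v" and p: "proper m v" and c: "vars s ''c'' = c" "c < 8"
  shows "final w select_code s = set_var ''x'' (high c v) (set_var ''g'' (low c v) (set_var ''t'' (side c) s))"
proof -
  obtain S G X M where v: "v = (S, G, X, M)" by (cases v) auto
  have sd: "side c < 2" using side_cases[OF c(2)] by auto
  have arr: "arrs s ''G'' (side c) = G (side c)" "arrs s ''X'' (side c) = X (side c)" "arrs s ''M'' (side c) = M (side c)"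
    using h sd by (auto simp: holds_def v)
  have c2: "c div 2 < 2 ^ w" "side c < 2 ^ w" "c mod 2 < 2 ^ w" "c div 2 mod 2 < 2 ^ w" "2 < (2::nat) ^ w" "4 < (2::nat) ^ w"
    using W_pos c(2) sd by (simp_all add: side_def)
  have bounds: "Suc (G (side c)) < 2 ^ w" "X (side c) - Suc 0 < 2 ^ w" "Suc 0 < 2 ^ w"
    using proper_bounds[OF p[unfolded v] sd] W_ge by auto
  have 1: "final w (Assign ''t'' (Op Quot (Var ''c'') (Const 4))) s = set_var ''t'' (side c) s"
    using c c2 by (simp add: side_def)
  have 2: "final w (If (Odd (Op Quot (Var ''c'') (Const 2))) (Assign ''g'' (Plus (Elem ''G'' (Var ''t'')) (Const 1)))
       (Assign ''g'' (Const 1))) (set_var ''t'' (side c) s) = set_var ''g'' (low c v) (set_var ''t'' (side c) s)"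
    using c(1) c2 arr bounds W_pos by (simp add: Odd_def low_def v)
  have 3: "final w (If (Odd (Var ''c'')) (Assign ''x'' (Minus (Elem ''X'' (Var ''t'')) (Const 1)))
       (Assign ''x'' (Elem ''M'' (Var ''t'')))) (set_var ''g'' (low c v) (set_var ''t'' (side c) s))
     = set_var ''x'' (high c v) (set_var ''g'' (low c v) (set_var ''t'' (side c) s))"
    using c(1) c2 arr bounds W_pos by (simp add: Odd_def high_def v)
  show ?thesis
    unfolding select_code_def block.simps final.simps(4) 1 2 3 ..
qed

lemma final_test:
  assumes h: "holds m s v" and p: "proper m v" and c: "vars s ''c'' = c" "c < 8"
    and sel: "vars s ''t'' = side c" "vars s ''g'' = low c v" "vars s ''x'' = high c v"
  shows "final w member_code s = set_var ''q'' (of_bool (has_kid m c v)) s"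
proof -
  obtain S G X M where v: "v = (S, G, X, M)" by (cases v) auto
  have sd: "side c < 2" using side_cases[OF c(2)] by auto
  have arr: "arrs s ''G'' t = G t" "arrs s ''X'' t = X t" "arrs s ''M'' t = M t" if "t < 2" for t
    using h that by (auto simp: holds_def v)
  have m: "vars s ''m'' = m" and b: "bits (arrs s ''S'') S" using h by (auto simp: holds_def v)
  have bounds: "low c v \<le> m + 2" "high c v \<le> m"
    using proper_bounds[OF p[unfolded v] sd] by (auto simp: low_def high_def v)
  have "1 \<le> low c v" by (simp add: low_def v)
  hence gS: "arrs s ''S'' (low c v + low c v + side c) = of_bool (low c v \<in> S (side c))"
    using b sd by (simp add: bits_def)
  \<comment> \<open>\<open>high c v\<close> may be 0, where the array is unspecified. The comparison
    with the positive \<open>low c v\<close> excludes this case from a positive answer.\<close>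
  have xS: "arrs s ''S'' (high c v + high c v + side c) = of_bool (high c v \<in> S (side c))" if "low c v < high c v"
    using b sd that by (simp add: bits_def)
  have i1: "eval_expr w (cell_index (Var ''g'') (Var ''t'')) s' = low c v + low c v + side c"
    "eval_expr w (cell_index (Var ''x'') (Var ''t'')) s' = high c v + high c v + side c"
    if "vars s' ''t'' = side c" "vars s' ''g'' = low c v" "vars s' ''x'' = high c v" for s'
    using W bounds sd that by (auto intro!: eval_cell_index)
  have M: "M 0 + M 1 < 2 ^ w" using proper_bounds[OF p[unfolded v] sd] W by simp
  have small: "of_bool q < (2::nat) ^ w" "c mod 2 < 2 ^ w" "c mod 2 + of_bool q < 2 ^ w"
    "side c * of_bool q < 2 ^ w" for q
  proof -
    have "of_bool q \<le> (1::nat)" "c mod 2 \<le> 1" by auto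
    thus "of_bool q < (2::nat) ^ w" "c mod 2 < 2 ^ w" "c mod 2 + of_bool q < 2 ^ w"
      using W_pos by linarith+
    show "side c * of_bool q < 2 ^ w" using sd W_pos by (cases q) auto
  qed
  have tests: "eval_expr w (Op Mul (Var ''t'') (Lt (Elem ''G'' (Const 0)) (Elem ''X'' (Const 0)))) s' = side c * of_bool (G 0 < X 0)"
    "eval_expr w (Plus (Odd (Var ''c'')) (Lt (Plus (Elem ''M'' (Const 0)) (Elem ''M'' (Const 1))) (Var ''m''))) s'
      = c mod 2 + of_bool (M 0 + M 1 < m)"
    if "vars s' ''t'' = side c" "vars s' ''c'' = c" "vars s' ''m'' = m" "arrs s' = arrs s" for s'
    using that arr[of 0] arr[of 1] M W_ge W_pos small(1)[of "G 0 < X 0"] small(2) small(3)[of "M 0 + M 1 < m"]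
      small(4)[of "G 0 < X 0"] small(4)[of True] small(1)[of "M 0 + M 1 < m"] by (simp_all add: Odd_def)
  define s1 where "s1 = set_var ''q'' 0 s"
  have s1: "vars s1 ''t'' = side c" "vars s1 ''g'' = low c v" "vars s1 ''x'' = high c v" "vars s1 ''c'' = c"
    "vars s1 ''m'' = m" "arrs s1 = arrs s"
    using sel c m by (simp_all add: s1_def)
  have q1: "final w (Assign ''q'' (Const 1)) s1 = set_var ''q'' 1 s" using W_pos by (simp add: s1_def)
  have q0: "final w (Assign ''q'' (Const 0)) s = s1" by (simp add: s1_def)
  have e1: "eval_expr w (Elem ''S'' (cell_index (Var ''g'') (Var ''t''))) s1 = of_bool (low c v \<in> S (side c))"
    using i1[OF s1(1-3)] gS s1(6) by simp
  have e2: "eval_expr w (Elem ''S'' (cell_index (Var ''x'') (Var ''t''))) s1 = arrs s ''S'' (high c v + high c v + side c)"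
    using i1[OF s1(1-3)] s1(6) by simp
  have e3: "eval_expr w (Lt (Var ''g'') (Var ''x'')) s1 = of_bool (low c v < high c v)"
    using s1 W_pos by simp
  have kid: "has_kid m c v \<longleftrightarrow> low c v \<in> S (side c) \<and> low c v < high c v \<and> high c v \<in> S (side c) \<and>
      side c * of_bool (G 0 < X 0) = (0::nat) \<and> c mod 2 + of_bool (M 0 + M 1 < m) \<noteq> (0::nat)"
    using sd unfolding has_kid_def v prod.case by (auto simp: not_less)
  show ?thesis
    unfolding member_code_def final.simps(4) q0
    unfolding final.simps(5) e1 e2 e3 tests[OF s1(1) s1(4-6)] q1 kid
    using xS by (cases "low c v < high c v") (auto simp: s1_def)
qed

lemma final_push:
  assumes "vars s ''d'' = D" "D + 1 < 2 ^ w"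
  shows "final w push_code s = set_var ''d'' (D + 1) (set_elem ''f'' D (arrs s ''M'' (vars s ''t''))
     (set_elem ''e'' D (arrs s ''X'' (vars s ''t'')) (set_elem ''b'' D (arrs s ''G'' (vars s ''t''))
     (set_elem ''a'' D (vars s ''c'') s))))"
  using assms W_pos by (simp add: push_code_def)

lemma final_visit:
  assumes "vars s ''s'' = 0"
  shows "final w visit_code s = s"
proof -
  have "set_var ''s'' 0 s = s" using set_var_same[of "''s''" s] assms by simp
  thus ?thesis using W_pos by (simp add: visit_code_def)
qed

lemma outputs_visit:
  assumes h: "holds m s v" and s: "vars s ''s'' = 0" "vars s ''n'' = n" and z: "vars s ''z'' = of_bool b"
  shows "list_all2 (shows_pair n) (outputs w visit_code s) (visits_if b (sets v))"
proof -
  obtain S G X M where v: "v = (S, G, X, M)" by (cases v) auto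
  have b: "bits (arrs s ''S'') S" using h by (simp add: holds_def v)
  have "bits (arrs s ''S'') (\<lambda>t. if t = 0 then fst (sets v) else snd (sets v))"
    by (rule bits_cong[OF _ b]) (auto simp: sets_def v less_2_cases_iff)
  hence "shows_pair n s (sets v)" using s by (simp add: shows_pair_def)
  moreover have "bits (arrs s ''S'') (\<lambda>t. if t = 1 then fst (prod.swap (sets v)) else snd (prod.swap (sets v)))"
    by (rule bits_cong[OF _ b]) (auto simp: sets_def v less_2_cases_iff)
  hence "shows_pair n (set_var ''s'' 1 s) (prod.swap (sets v))" using s by (simp add: shows_pair_def)
  ultimately show ?thesis using z W_pos by (cases b) (simp_all add: visit_code_def visits_if_def)
qed

definition spread_state :: "state \<Rightarrow> nat \<Rightarrow> nat \<Rightarrow> nat \<Rightarrow> state" where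
  "spread_state s t g x = set_elem ''S'' (x + 1 + (x + 1) + t) 1 (set_elem ''S'' (x + x + t) 0
     (set_elem ''S'' (g - 1 + (g - 1) + t) 1 (set_elem ''S'' (g + g + t) 0 s)))"

definition unspread_state :: "state \<Rightarrow> nat \<Rightarrow> nat \<Rightarrow> nat \<Rightarrow> state" where
  "unspread_state s t g x = set_elem ''S'' (x + x + t) 1 (set_elem ''S'' (g + g + t) 1
     (set_elem ''S'' (x + 1 + (x + 1) + t) 0 (set_elem ''S'' (g - 1 + (g - 1) + t) 0 s)))"

lemma final_spread:
  assumes "vars s ''t'' = t" "t < 2" "vars s ''g'' = g" "g \<le> m + 2" "vars s ''x'' = x" "x \<le> m"
  shows "final w spread_code s = spread_state s t g x" "final w unspread_code s = unspread_state s t g x"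
proof -
  have b: "g + g + t < 2 ^ w" "x + x + t < 2 ^ w" "x + 1 + (x + 1) + t < 2 ^ w" "g - 1 + (g - 1) + t < 2 ^ w"
    "x + 1 < 2 ^ w" "g - 1 < 2 ^ w"
    using assms W by auto
  have i: "eval_expr w (cell_index (Var ''g'') (Var ''t'')) s' = g + g + t"
    "eval_expr w (cell_index (Var ''x'') (Var ''t'')) s' = x + x + t"
    "eval_expr w (cell_index (Plus (Var ''x'') (Const 1)) (Var ''t'')) s' = x + 1 + (x + 1) + t"
    "eval_expr w (cell_index (Minus (Var ''g'') (Const 1)) (Var ''t'')) s' = g - 1 + (g - 1) + t"
    if "vars s' = vars s" for s'
    subgoal by (rule eval_cell_index) (use that assms b in simp_all)
    subgoal by (rule eval_cell_index) (use that assms b in simp_all)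
    subgoal by (rule eval_cell_index) (use that assms b W_pos in simp_all)
    subgoal by (rule eval_cell_index) (use that assms b W_pos in simp_all)
    done
  have c: "eval_expr w (Const 0) s' = 0" "eval_expr w (Const 1) s' = 1" for s' using W_pos by simp_all
  show "final w spread_code s = spread_state s t g x"
    unfolding spread_code_def block.simps final.simps spread_state_def c by (simp only: i vars_set_elem)
  show "final w unspread_code s = unspread_state s t g x"
    unfolding unspread_code_def block.simps final.simps unspread_state_def c by (simp only: i vars_set_elem)
qed

lemma bits_spread_state:
  assumes b: "bits (arrs s ''S'') S" and t: "t < 2" and g: "1 \<le> g" "g < x"
  shows "bits (arrs (spread_state s t g x) ''S'') (S(t := spread (S t) g x))"
proof -
  have "bits (arrs (spread_state s t g x) ''S'')
      (S(t := insert (x + 1) (insert (g - 1) (S t - {g}) - {x})))"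
    using bits_insert[OF bits_remove[OF bits_insert[OF bits_remove[OF b t, of g] t, of "g - 1"] t, of x] t, of "x + 1"]
    by (simp add: spread_state_def)
  thus ?thesis
    by (rule bits_cong[rotated]) (use g in \<open>auto simp: spread_def\<close>)
qed

lemma bits_unspread_state:
  assumes b: "bits (arrs s ''S'') S" and t: "t < 2" and g: "1 \<le> g" "g < x"
  shows "bits (arrs (unspread_state s t g x) ''S'') (S(t := unspread (S t) g x))"
proof -
  have "bits (arrs (unspread_state s t g x) ''S'')
      (S(t := insert x (insert g (S t - {g - 1} - {x + 1}))))"
    using bits_insert[OF bits_insert[OF bits_remove[OF bits_remove[OF b t, of "g - 1"] t, of "x + 1"] t, of g] t, of x]
    by (simp add: unspread_state_def)
  thus ?thesis
    by (rule bits_cong[rotated]) (use g in \<open>auto simp: unspread_def\<close>)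
qed

lemma spread_state_other [simp]:
  "vars (spread_state s t g x) = vars s" "a \<noteq> ''S'' \<Longrightarrow> arrs (spread_state s t g x) a = arrs s a"
  "vars (unspread_state s t g x) = vars s" "a \<noteq> ''S'' \<Longrightarrow> arrs (unspread_state s t g x) a = arrs s a"
  by (simp_all add: spread_state_def unspread_state_def)

lemma guard_try: "vars s ''c'' < 8 \<Longrightarrow> eval_expr w walk_guard s \<noteq> 0"
  "vars s ''c'' < 8 \<Longrightarrow> eval_expr w (Lt (Var ''c'') (Const 8)) s \<noteq> 0"
  using W_pos by (auto simp: walk_guard_def)

lemma guard_pop: "vars s ''c'' = 8 \<Longrightarrow> 0 < vars s ''d'' \<Longrightarrow> eval_expr w walk_guard s \<noteq> 0"
  "vars s ''c'' = 8 \<Longrightarrow> eval_expr w (Lt (Var ''c'') (Const 8)) s = 0"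
  using W_pos by (auto simp: walk_guard_def)

lemma guard_stop: "vars s ''c'' = 8 \<Longrightarrow> vars s ''d'' = 0 \<Longrightarrow> eval_expr w walk_guard s = 0"
  using W_pos by (auto simp: walk_guard_def)

lemma loop_free_walk: "loop_free walk_body"
  by (simp add: walk_body_def try_code_def select_code_def member_code_def push_code_def spread_code_def
      move_code_def visit_code_def pop_code_def unspread_code_def restore_code_def)

lemma walk_step:
  assumes "eval_expr w walk_guard s \<noteq> 0"
  shows "iterates w walk_guard walk_body s (outputs w walk_body s) walk_cost (final w walk_body s)"
  using iterates_body[OF assms loop_free_walk] by (simp add: walk_cost_def)

lemma select_visit_free: "visit_free select_code" "visit_free member_code" "visit_free push_code"
  "visit_free spread_code" "visit_free move_code" "visit_free (block [pop_code, unspread_code, restore_code])"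
  by (simp_all add: select_code_def member_code_def push_code_def spread_code_def
      move_code_def pop_code_def unspread_code_def restore_code_def)

lemma selected:
  assumes h: "holds m s v" and p: "proper m v" and c: "vars s ''c'' = c" "c < 8"
  defines "s1 \<equiv> set_var ''q'' (of_bool (has_kid m c v)) (set_var ''x'' (high c v) (set_var ''g'' (low c v) (set_var ''t'' (side c) s)))"
  shows "final w member_code (final w select_code s) = s1" "holds m s1 v"
proof -
  let ?s = "set_var ''x'' (high c v) (set_var ''g'' (low c v) (set_var ''t'' (side c) s))"
  have "holds m ?s v" using h by (simp add: holds_def split: prod.splits)
  from final_test[OF this p _ c(2)] show "final w member_code (final w select_code s) = s1"
    unfolding final_select[OF h p c] s1_def using c(1) by simp
  show "holds m s1 v" using h by (simp add: s1_def holds_def split: prod.splits)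
qed

lemma advance:
  assumes h: "holds m s v" and p: "proper m v" and c: "vars s ''c'' = c" "c < 8" and no: "\<not> has_kid m c v"
  shows "\<exists>s'. iterates w walk_guard walk_body s [] walk_cost s' \<and> holds m s' v \<and> vars s' ''c'' = c + 1 \<and>
    vars s' ''d'' = vars s ''d'' \<and> frame D s s'"
proof -
  define s1 where "s1 = set_var ''q'' (of_bool (has_kid m c v)) (set_var ''x'' (high c v) (set_var ''g'' (low c v) (set_var ''t'' (side c) s)))"
  note sel = selected[OF h p c, folded s1_def]
  define s2 where "s2 = set_var ''c'' (c + 1) s1"
  have q: "vars s1 ''q'' = 0" "vars s1 ''c'' = c" using no c by (simp_all add: s1_def)
  have "final w try_code s = s2"
    unfolding try_code_def block.simps final.simps(4) sel(1)
    using q c(2) W_pos by (simp add: s2_def)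
  moreover have "outputs w try_code s = []"
    unfolding try_code_def block.simps outputs.simps(1) sel(1)
    using q by (simp add: outputs_visit_free select_visit_free)
  ultimately have fo: "final w walk_body s = s2" "outputs w walk_body s = []"
    using guard_try(2)[of s] c unfolding walk_body_def by simp_all
  have "iterates w walk_guard walk_body s [] walk_cost s2"
    using walk_step[OF guard_try(1)[of s]] c unfolding fo by simp
  moreover have "vars s2 ''c'' = c + 1" "vars s2 ''d'' = vars s ''d''" by (simp_all add: s2_def s1_def)
  moreover have "holds m s2 v" using sel(2) by (simp add: s2_def holds_def split: prod.splits)
  moreover have "frame D s s2" by (simp add: frame_def s2_def s1_def)
  ultimately show ?thesis by blast
qed

text \<open>The last four equations describe the stack entry needed for the way back. It survives
  the walk below the kid, which runs at stack height \<open>D + 1\<close> and preserves all lower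
  entries.\<close>

lemma descend:
  assumes h: "holds m s v" and p: "proper m v" and c: "vars s ''c'' = c" "c < 8" and kid: "has_kid m c v"
    and d: "vars s ''d'' = D" "D + 1 < 2 ^ w" and s: "vars s ''s'' = 0" "vars s ''n'' = n" "vars s ''z'' = of_bool b"
    and v: "v = (S, G, X, M)"
  shows "\<exists>s' out. iterates w walk_guard walk_body s out walk_cost s' \<and> holds m s' (kid c v) \<and> vars s' ''c'' = 0 \<and>
    vars s' ''d'' = D + 1 \<and> frame D s s' \<and> list_all2 (shows_pair n) out (visits_if b (sets (kid c v))) \<and>
    arrs s' ''a'' D = c \<and> arrs s' ''b'' D = G (side c) \<and> arrs s' ''e'' D = X (side c) \<and> arrs s' ''f'' D = M (side c)"
proof -
  define s1 where "s1 = set_var ''q'' (of_bool (has_kid m c v)) (set_var ''x'' (high c v) (set_var ''g'' (low c v) (set_var ''t'' (side c) s)))"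
  note sel = selected[OF h p c, folded s1_def]
  have s1: "vars s1 ''q'' = 1" "vars s1 ''c'' = c" "vars s1 ''t'' = side c" "vars s1 ''g'' = low c v" "vars s1 ''x'' = high c v"
    "vars s1 ''d'' = D"
    using kid c d by (simp_all add: s1_def)
  have sd: "side c < 2" using side_cases[OF c(2)] by auto
  have arr: "arrs s1 ''G'' t = G t" "arrs s1 ''X'' t = X t" "arrs s1 ''M'' t = M t" if "t < 2" for t
    using sel(2) that by (auto simp: holds_def v)
  have bS: "bits (arrs s1 ''S'') S" and ms: "vars s1 ''m'' = m" using sel(2) by (auto simp: holds_def v)
  have bounds: "low c v \<le> m + 2" "high c v \<le> m"
    using proper_bounds[OF p[unfolded v] sd] by (auto simp: low_def high_def v)
  have gx: "1 \<le> low c v" "low c v < high c v" using kid by (auto simp: low_def v has_kid_def)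
  define s2 where "s2 = final w push_code s1"
  have s2_eq: "s2 = set_var ''d'' (D + 1) (set_elem ''f'' D (M (side c))
     (set_elem ''e'' D (X (side c)) (set_elem ''b'' D (G (side c)) (set_elem ''a'' D c s1))))"
    unfolding s2_def final_push[OF s1(6) d(2)] using s1 arr[OF sd] by simp
  define s3 where "s3 = spread_state s2 (side c) (low c v) (high c v)"
  have s3: "final w spread_code s2 = s3"
    unfolding s3_def using s1 sd bounds by (intro final_spread) (simp_all add: s2_eq)
  have vars3: "vars s3 = (vars s1)(''d'' := D + 1)" by (simp add: s3_def s2_eq)
  have arrs3: "arrs s3 a = arrs s2 a" if "a \<noteq> ''S''" for a using that by (simp add: s3_def)
  define s4 where "s4 = final w move_code s3"
  have par: "c mod 2 < 2 ^ w" "2 < (2::nat) ^ w" "Suc (high c v) < 2 ^ w" using W_ge bounds by auto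
  have s4: "s4 = set_var ''c'' 0 ((if c mod 2 = 0 then set_elem ''M'' (side c) (high c v + 1) else id)
      (set_elem ''X'' (side c) (high c v) (set_elem ''G'' (side c) (low c v) s3)))"
    unfolding s4_def move_code_def using s1 par W_pos by (simp add: vars3 Odd_def)
  have arrs4: "arrs s4 ''S'' = arrs s3 ''S''" "arrs s4 ''G'' = (arrs s3 ''G'')(side c := low c v)"
    "arrs s4 ''X'' = (arrs s3 ''X'')(side c := high c v)"
    "arrs s4 ''M'' = (if c mod 2 = 0 then (arrs s3 ''M'')(side c := high c v + 1) else arrs s3 ''M'')"
    by (simp_all add: s4)
  have stack4: "arrs s4 a = arrs s2 a" if "a \<in> {''a'', ''b'', ''e'', ''f''}" for a
    using that by (auto simp: s4 arrs3)
  have vars4: "vars s4 = (vars s3)(''c'' := 0)" by (simp add: s4)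
  have "bits (arrs s3 ''S'') (S(side c := spread (S (side c)) (low c v) (high c v)))"
    unfolding s3_def using bS sd gx by (intro bits_spread_state) (simp_all add: s2_eq)
  hence h4: "holds m s4 (kid c v)"
    unfolding holds_def kid_def v prod.case arrs4 vars4 vars3
    using ms arr by (auto simp: v arrs3 s2_eq)
  have io: "vars s4 ''s'' = 0" "vars s4 ''n'' = n" "vars s4 ''z'' = of_bool b"
    using s by (simp_all add: vars4 vars3 s1_def)
  have steps: "final w try_code s = s4" "outputs w try_code s = outputs w visit_code s4"
    unfolding try_code_def block.simps final.simps(4,5) outputs.simps(1,2) sel(1)
    using s1(1) by (simp_all add: s2_def[symmetric] s3 s4_def[symmetric] final_visit[OF io(1)]
        outputs_visit_free select_visit_free)
  hence fo: "final w walk_body s = s4" "outputs w walk_body s = outputs w visit_code s4"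
    using guard_try(2)[of s] c unfolding walk_body_def by simp_all
  have "iterates w walk_guard walk_body s (outputs w visit_code s4) walk_cost s4"
    using walk_step[OF guard_try(1)[of s]] c unfolding fo by simp
  moreover have "vars s4 ''c'' = 0" "vars s4 ''d'' = D + 1" by (simp_all add: vars4 vars3)
  moreover have "frame D s s4"
    unfolding frame_def using stack4 by (auto simp: vars4 vars3 s1_def s2_eq)
  moreover have "arrs s4 ''a'' D = c" "arrs s4 ''b'' D = G (side c)" "arrs s4 ''e'' D = X (side c)" "arrs s4 ''f'' D = M (side c)"
    by (simp_all add: stack4 s2_eq)
  ultimately show ?thesis
    using h4 outputs_visit[OF h4 io] by blast
qed

lemma ascend:
  assumes h: "holds m s (kid c v)" and p: "proper m v" and c: "c < 8" "has_kid m c v" "vars s ''c'' = 8"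
    and d: "vars s ''d'' = D + 1" "D + 1 < 2 ^ w" and v: "v = (S, G, X, M)"
    and st: "arrs s ''a'' D = c" "arrs s ''b'' D = G (side c)" "arrs s ''e'' D = X (side c)" "arrs s ''f'' D = M (side c)"
  shows "\<exists>s'. iterates w walk_guard walk_body s [] walk_cost s' \<and> holds m s' v \<and> vars s' ''c'' = c + 1 \<and>
    vars s' ''d'' = D \<and> frame D s s'"
proof -
  have sd: "side c < 2" using side_cases[OF c(1)] by auto
  note k = kid_gaps[OF p c(1,2) v]
  have bounds: "low c v \<le> m + 2" "high c v \<le> m"
    using proper_bounds[OF p[unfolded v] sd] by (auto simp: low_def high_def v)
  have gx: "1 \<le> low c v" "low c v < high c v" using c(2) by (auto simp: low_def v has_kid_def)
  have ms: "vars s ''m'' = m" and bS: "bits (arrs s ''S'') (S(side c := spread (S (side c)) (low c v) (high c v)))"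
    and top: "arrs s ''G'' (side c) = low c v" "arrs s ''X'' (side c) = high c v"
    using h sd by (auto simp: holds_def kid_def v)
  have arr: "arrs s ''G'' t = G t" "arrs s ''X'' t = X t" "arrs s ''M'' t = M t" if "t < 2" "t \<noteq> side c" for t
    using h that by (auto simp: holds_def kid_def v)
  define s1 where "s1 = set_var ''x'' (high c v) (set_var ''g'' (low c v) (set_var ''t'' (side c) (set_var ''c'' c (set_var ''d'' D s))))"
  have "side c < 2 ^ w" using sd W_pos by simp
  hence s1: "final w pop_code s = s1"
    using d st top W_pos by (simp add: pop_code_def s1_def side_def)
  define s2 where "s2 = unspread_state s1 (side c) (low c v) (high c v)"
  have s2: "final w unspread_code s1 = s2"
    unfolding s2_def using sd bounds by (intro final_spread) (simp_all add: s1_def)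
  have vars2: "vars s2 = vars s1" by (simp add: s2_def)
  have arrs2: "arrs s2 a = arrs s a" if "a \<noteq> ''S''" for a using that by (simp add: s2_def s1_def)
  define s3 where "s3 = set_var ''c'' (c + 1) (set_elem ''M'' (side c) (M (side c)) (set_elem ''X'' (side c) (X (side c)) (set_elem ''G'' (side c) (G (side c)) s2)))"
  have s3: "final w restore_code s2 = s3"
    using c W_pos st by (simp add: restore_code_def s3_def vars2 s1_def arrs2)
  have fo: "final w walk_body s = s3" "outputs w walk_body s = []"
  proof -
    show "final w walk_body s = s3"
      using guard_pop(2)[OF c(3)] unfolding walk_body_def by (simp add: s1 s2 s3)
    have "outputs w walk_body s = outputs w (block [pop_code, unspread_code, restore_code]) s"
      using guard_pop(2)[OF c(3)] unfolding walk_body_def by (simp only: outputs.simps if_True simp_thms)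
    thus "outputs w walk_body s = []" using outputs_visit_free[OF select_visit_free(6)] by simp
  qed
  have "bits (arrs s2 ''S'') (S(side c := spread (S (side c)) (low c v) (high c v), side c :=
      unspread ((S(side c := spread (S (side c)) (low c v) (high c v))) (side c)) (low c v) (high c v)))"
    unfolding s2_def using bS sd gx by (intro bits_unspread_state) (simp_all add: s1_def)
  hence "bits (arrs s2 ''S'') S"
    using unspread_spread[OF k(4,5) spread_fresh[OF k(1) k(4) k(2) k(5) k(3)] gx(2,1)] by simp
  hence "holds m s3 v"
    unfolding holds_def v prod.case using ms arr by (auto simp: s3_def arrs2 vars2 s1_def)
  moreover have "iterates w walk_guard walk_body s [] walk_cost s3"
    using walk_step[OF guard_pop(1)[OF c(3)]] d unfolding fo by simp
  moreover have "vars s3 ''c'' = c + 1" "vars s3 ''d'' = D" by (simp_all add: s3_def vars2 s1_def)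
  moreover have "frame D s s3"
    by (auto simp: frame_def s3_def vars2 s1_def arrs2)
  ultimately show ?thesis by blast
qed

end


section \<open>Traversal of a tree and change of the root\<close>

text \<open>These nodes are still to be visited below \<open>v\<close> when \<open>c\<close> is the
  next number to be tried; they form the invariant of the walk.\<close>

definition nodes_from :: "nat \<Rightarrow> nat \<Rightarrow> nat \<Rightarrow> node \<Rightarrow> node list" where
  "nodes_from m f c v = concat (map (\<lambda>c. subtree m (f - 1) (kid c v)) (filter (\<lambda>c. has_kid m c v) [c..<8]))"

text \<open>The distance to the bound \<open>2 * m ^ 3\<close> on the squares serves as depth
  argument: when it is used up, there are no kids either.\<close>

definition enough :: "nat \<Rightarrow> nat \<Rightarrow> node \<Rightarrow> bool" where
  "enough m f v \<longleftrightarrow> proper m v \<and> 2 * m ^ 3 \<le> squares (sets v) + f"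

lemma enough_kid:
  assumes "enough m f v" "c < 8" "has_kid m c v"
  shows "0 < f" "enough m (f - 1) (kid c v)"
proof -
  have p: "proper m v" and f: "2 * m ^ 3 \<le> squares (sets v) + f" using assms(1) by (auto simp: enough_def)
  have "squares (sets (kid c v)) \<le> 2 * m ^ 3"
    using squares_bound[OF proper_flip_pairs[OF proper_kid[OF p assms(2,3)]]] .
  with kid_weights(2)[OF p assms(2,3)] f show "0 < f" by simp
  with kid_weights(2)[OF p assms(2,3)] f proper_kid[OF p assms(2,3)] show "enough m (f - 1) (kid c v)"
    by (simp add: enough_def)
qed

lemma subtree_nodes_from:
  assumes "enough m f v"
  shows "subtree m f v = v # nodes_from m f 0 v"
proof (cases f)
  case 0
  have "filter (\<lambda>c. has_kid m c v) [0..<8] = []"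
    using enough_kid(1)[OF assms] 0 by (auto simp: filter_empty_conv)
  thus ?thesis using 0 by (simp add: nodes_from_def)
next
  case (Suc f')
  thus ?thesis by (simp add: nodes_from_def kids_def comp_def)
qed

lemma nodes_from_step:
  "c < 8 \<Longrightarrow> nodes_from m f c v = (if has_kid m c v then subtree m (f - 1) (kid c v) else []) @ nodes_from m f (c + 1) v"
  unfolding nodes_from_def by (subst upt_rec) simp

lemma nodes_from_8 [simp]: "nodes_from m f 8 v = []"
  by (simp add: nodes_from_def)

context machine
begin

text \<open>The outer induction on \<open>f\<close> treats the subtree of a kid, the inner one the
  numbers not yet tried. As \<open>f\<close> also bounds the further growth of the stack, its height
  stays within a word.\<close>

theorem walk:
  assumes "enough m f v" "holds m s v" "vars s ''c'' = c" "c \<le> 8" "vars s ''d'' = D" "D + f + 1 < 2 ^ w"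
    "vars s ''s'' = 0" "vars s ''n'' = n" "vars s ''z'' = of_bool b"
  shows "\<exists>s' out. iterates w walk_guard walk_body s out (walk_cost * (8 - c + 10 * length (nodes_from m f c v))) s' \<and>
    holds m s' v \<and> vars s' ''c'' = 8 \<and> vars s' ''d'' = D \<and> frame D s s' \<and>
    list_all2 (shows_pair n) out (concat (map (\<lambda>u. visits_if b (sets u)) (nodes_from m f c v)))"
  using assms
proof (induction f arbitrary: v s c D rule: less_induct)
  case (less f)
  have p: "proper m v" using less.prems(1) by (simp add: enough_def)
  note outer = less.IH
  note en = less.prems(1) and dd = less.prems(6)
  from less.prems show ?case
  proof (induction "8 - c" arbitrary: c s)
    case 0
    hence "c = 8" by simp
    thus ?case using 0 iterates_refl frame_refl
      by (intro exI[of _ s] exI[of _ "[]"]) auto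
  next
    case (Suc k)
    have c: "c < 8" using Suc.hyps(2) by simp
    show ?case
    proof (cases "has_kid m c v")
      case False
      obtain s1 where s1: "iterates w walk_guard walk_body s [] walk_cost s1" "holds m s1 v" "vars s1 ''c'' = c + 1"
        "vars s1 ''d'' = D" "frame D s s1"
        using advance[OF Suc.prems(2) p Suc.prems(3) c False, of D] Suc.prems(5) by auto
      have io: "vars s1 ''s'' = 0" "vars s1 ''n'' = n" "vars s1 ''z'' = of_bool b"
        using s1(5) Suc.prems(7-9) by (simp_all add: frame_def)
      have "k = 8 - (c + 1)" using Suc.hyps(2) by simp
      then obtain s2 out where s2: "iterates w walk_guard walk_body s1 out (walk_cost * (8 - (c + 1) + 10 * length (nodes_from m f (c + 1) v))) s2"
        "holds m s2 v" "vars s2 ''c'' = 8" "vars s2 ''d'' = D" "frame D s1 s2"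
        "list_all2 (shows_pair n) out (concat (map (\<lambda>u. visits_if b (sets u)) (nodes_from m f (c + 1) v)))"
        using Suc.hyps(1)[of "c + 1" s1] en s1 c dd io by (auto simp: Suc_le_eq)
      have "iterates w walk_guard walk_body s out (walk_cost * (8 - c + 10 * length (nodes_from m f c v))) s2"
      proof (rule iterates_mono)
        show "iterates w walk_guard walk_body s out (walk_cost + walk_cost * (8 - (c + 1) + 10 * length (nodes_from m f (c + 1) v))) s2"
          using iterates_trans[OF s1(1) s2(1)] by simp
        have "8 - c = Suc (8 - (c + 1))" using c by simp
        thus "walk_cost + walk_cost * (8 - (c + 1) + 10 * length (nodes_from m f (c + 1) v))
          \<le> walk_cost * (8 - c + 10 * length (nodes_from m f c v))"
          using False by (simp add: nodes_from_step[OF c] algebra_simps)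
      qed
      thus ?thesis using s2 frame_trans[OF s1(5) s2(5)] False by (auto simp: nodes_from_step[OF c])
    next
      case True
      obtain S G X M where v: "v = (S, G, X, M)" by (cases v) auto
      note ek = enough_kid[OF en c True]
      obtain s1 out1 where s1: "iterates w walk_guard walk_body s out1 walk_cost s1" "holds m s1 (kid c v)" "vars s1 ''c'' = 0"
        "vars s1 ''d'' = D + 1" "frame D s s1" "list_all2 (shows_pair n) out1 (visits_if b (sets (kid c v)))"
        and st: "arrs s1 ''a'' D = c" "arrs s1 ''b'' D = G (side c)" "arrs s1 ''e'' D = X (side c)" "arrs s1 ''f'' D = M (side c)"
        using descend[OF Suc.prems(2) p Suc.prems(3) c True Suc.prems(5) _ Suc.prems(7-9) v] dd ek(1) by auto
      have io1: "vars s1 ''s'' = 0" "vars s1 ''n'' = n" "vars s1 ''z'' = of_bool b"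
        using s1(5) Suc.prems(7-9) by (simp_all add: frame_def)
      let ?K = "nodes_from m (f - 1) 0 (kid c v)"
      have "f - 1 < f" "D + 1 + (f - 1) + 1 < 2 ^ w" using ek(1) dd by auto
      then obtain s2 out2 where s2: "iterates w walk_guard walk_body s1 out2 (walk_cost * (8 - 0 + 10 * length ?K)) s2"
        "holds m s2 (kid c v)" "vars s2 ''c'' = 8" "vars s2 ''d'' = D + 1" "frame (D + 1) s1 s2"
        "list_all2 (shows_pair n) out2 (concat (map (\<lambda>u. visits_if b (sets u)) ?K))"
        using outer[OF _ ek(2) s1(2) s1(3) _ s1(4) _ io1] by auto
      have st2: "arrs s2 ''a'' D = c" "arrs s2 ''b'' D = G (side c)" "arrs s2 ''e'' D = X (side c)" "arrs s2 ''f'' D = M (side c)"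
        using s2(5) st by (simp_all add: frame_def)
      obtain s3 where s3: "iterates w walk_guard walk_body s2 [] walk_cost s3" "holds m s3 v" "vars s3 ''c'' = c + 1"
        "vars s3 ''d'' = D" "frame D s2 s3"
        using ascend[OF s2(2) p c True s2(3) s2(4) _ v st2] dd ek(1) by auto
      have f3: "frame D s s3" using frame_trans[OF frame_trans[OF s1(5) s2(5)] s3(5)] by simp
      have io3: "vars s3 ''s'' = 0" "vars s3 ''n'' = n" "vars s3 ''z'' = of_bool b"
        using f3 Suc.prems(7-9) by (simp_all add: frame_def)
      let ?R = "nodes_from m f (c + 1) v"
      have "k = 8 - (c + 1)" using Suc.hyps(2) by simp
      then obtain s4 out4 where s4: "iterates w walk_guard walk_body s3 out4 (walk_cost * (8 - (c + 1) + 10 * length ?R)) s4"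
        "holds m s4 v" "vars s4 ''c'' = 8" "vars s4 ''d'' = D" "frame D s3 s4"
        "list_all2 (shows_pair n) out4 (concat (map (\<lambda>u. visits_if b (sets u)) ?R))"
        using Suc.hyps(1)[of "c + 1" s3] en s3 c dd io3 by (auto simp: Suc_le_eq)
      have nodes: "nodes_from m f c v = kid c v # ?K @ ?R"
        unfolding nodes_from_step[OF c] subtree_nodes_from[OF ek(2)] using True by simp
      have "iterates w walk_guard walk_body s (out1 @ out2 @ out4) (walk_cost * (8 - c + 10 * length (nodes_from m f c v))) s4"
      proof (rule iterates_mono)
        show "iterates w walk_guard walk_body s (out1 @ out2 @ out4)
            (walk_cost + (walk_cost * (8 - 0 + 10 * length ?K) + (walk_cost + walk_cost * (8 - (c + 1) + 10 * length ?R)))) s4"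
          using iterates_trans[OF s1(1) iterates_trans[OF s2(1) iterates_trans[OF s3(1) s4(1)]]] by simp
        have "walk_cost + (walk_cost * (8 - 0 + 10 * length ?K) + (walk_cost + walk_cost * (8 - (c + 1) + 10 * length ?R)))
            = walk_cost * (1 + (8 + 10 * length ?K) + 1 + (8 - (c + 1) + 10 * length ?R))"
          by (simp add: algebra_simps)
        also have "\<dots> \<le> walk_cost * (8 - c + 10 * length (nodes_from m f c v))"
          unfolding nodes by (rule mult_le_mono2) simp
        finally show "walk_cost + (walk_cost * (8 - 0 + 10 * length ?K) + (walk_cost + walk_cost * (8 - (c + 1) + 10 * length ?R)))
            \<le> walk_cost * (8 - c + 10 * length (nodes_from m f c v))" .
      qed
      moreover have "list_all2 (shows_pair n) (out1 @ out2 @ out4) (concat (map (\<lambda>u. visits_if b (sets u)) (nodes_from m f c v)))"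
        unfolding nodes using s1(6) s2(6) s4(6) by (simp add: list_all2_appendI)
      moreover have "frame D s s4" using frame_trans[OF f3 s4(5)] by simp
      ultimately show ?thesis using s4 by blast
    qed
  qed
qed

end

section \<open>Stepping from one root to the next\<close>

abbreviation "AtX i \<equiv> Elem ''X'' (Const i)"
abbreviation "AtM i \<equiv> Elem ''M'' (Const i)"

definition put :: "expr \<Rightarrow> nat \<Rightarrow> nat \<Rightarrow> com" where
  "put i t b = Store ''S'' (cell_index i (Const t)) (Const b)"

definition gap_code :: "nat \<Rightarrow> com" where
  "gap_code t = If (AtX t) (Store ''G'' (Const t) (AtX t)) (Store ''G'' (Const t) (Plus (AtM t) (Const 1)))"

definition succ_code :: com where
  "succ_code = If (AtX 0)
     (block [put (AtX 0) 0 1, Store ''X'' (Const 0) (Minus (AtX 0) (Const 1)), put (AtX 0) 0 0])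
     (block [put (AtM 0) 0 0, Store ''X'' (Const 0) (AtM 0), Store ''M'' (Const 0) (Plus (AtM 0) (Const 1)), put (AtM 0) 0 1])"

text \<open>The gap is filled and the maximum removed. This is the predecessor step when the gap is
  right below the maximum, and from any other gap it is the jump of the second set in
  \<open>skip_code\<close>.\<close>

definition shrink_code :: com where
  "shrink_code = block [put (AtX 1) 1 1, put (AtM 1) 1 0, Store ''M'' (Const 1) (Minus (AtM 1) (Const 1)),
     Store ''X'' (Const 1) (Const 0)]"

definition pred_code :: com where
  "pred_code = If (Lt (Plus (AtX 1) (Const 1)) (AtM 1))
     (block [put (AtX 1) 1 1, Store ''X'' (Const 1) (Plus (AtX 1) (Const 1)), put (AtX 1) 1 0])
     shrink_code"

definition shift_code :: com where
  "shift_code = block [put (AtX 0) 0 1, Store ''X'' (Const 0) (Minus (AtX 0) (Var ''u'')), put (AtX 0) 0 0]"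

definition exhausted :: expr where
  "exhausted = Lt (Var ''K'') (Plus (Var ''P'') (Var ''P''))"

definition stop_code :: com where
  "stop_code = Assign ''o'' (Const 0)"

text \<open>The amount \<open>u\<close> is the weight lost by the second set when it shrinks. It is
  credited to the first set by moving the gap down just as far.\<close>

definition skip_code :: com where
  "skip_code = Seq (Assign ''u'' (Minus (AtM 1) (AtX 1)))
     (If (Lt (AtX 0) (Var ''u'')) stop_code
       (Seq (Assign ''P'' (Plus (Var ''P'') (Var ''u''))) (If exhausted stop_code (Seq shrink_code shift_code))))"

definition next_code :: com where
  "next_code = Seq (Assign ''P'' (Plus (Var ''P'') (Const 1))) (If exhausted stop_code
     (block [succ_code, pred_code, If (Lt (Var ''m'') (Plus (AtM 0) (AtM 1))) skip_code Skip, gap_code 0, gap_code 1]))"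

definition root_sets :: "root \<Rightarrow> nat \<Rightarrow> nat set" where
  "root_sets = (\<lambda>(u, x, v, y) t. if t = 0 then {1..u} - {x} else {1..v} - {y})"

definition holds_root :: "state \<Rightarrow> root \<Rightarrow> bool" where
  "holds_root s r \<longleftrightarrow> bits (arrs s ''S'') (root_sets r) \<and> (case r of (u, x, v, y) \<Rightarrow>
     arrs s ''X'' 0 = x \<and> arrs s ''X'' (Suc 0) = y \<and> arrs s ''M'' 0 = u \<and> arrs s ''M'' (Suc 0) = v)"

definition same_vars :: "vname set \<Rightarrow> state \<Rightarrow> state \<Rightarrow> bool" where
  "same_vars Y s s' \<longleftrightarrow> (\<forall>y\<in>Y. vars s' y = vars s y)"

definition prepare_code :: com where
  "prepare_code = block [Assign ''z'' (Lt (Plus (Var ''P'') (Var ''P'')) (Var ''K'')), Assign ''c'' (Const 0), visit_code]"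

definition root_body :: com where
  "root_body = block [prepare_code, While walk_guard walk_body, next_code]"

text \<open>
  A node costs at most eight tries, one push and one pop, hence the factor 10.
\<close>

definition root_cost :: nat where
  "root_cost = 1 + expr_cost (Var ''o'') + cost prepare_code + walk_cost * 8 + 1 + expr_cost walk_guard + cost next_code
     + walk_cost * 10"

lemma loop_free_root: "loop_free prepare_code" "loop_free next_code"
  by (simp_all add: prepare_code_def visit_code_def next_code_def succ_code_def pred_code_def shrink_code_def
      shift_code_def skip_code_def stop_code_def gap_code_def put_def)

lemma visit_free_next: "visit_free next_code"
  by (simp add: next_code_def succ_code_def pred_code_def shrink_code_def
      shift_code_def skip_code_def stop_code_def gap_code_def put_def)

context machine
begin

lemma final_put:
  assumes "eval_expr w i s = a" "a \<le> m + 2" "t < 2" "b \<le> 1"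
  shows "final w (put i t b) s = set_elem ''S'' (a + a + t) b s"
proof -
  have "t < 2 ^ w" "b < 2 ^ w" "a + a + t < 2 ^ w" using assms W by auto
  thus ?thesis using assms(1) by (simp add: put_def cell_index_def)
qed

lemma holds_root_bits:
  assumes "bits (arrs s ''S'') S" "\<And>t i. t < 2 \<Longrightarrow> 1 \<le> i \<Longrightarrow> i \<in> S t \<longleftrightarrow> i \<in> root_sets r t"
    "case r of (u, x, v, y) \<Rightarrow>
     arrs s ''X'' 0 = x \<and> arrs s ''X'' (Suc 0) = y \<and> arrs s ''M'' 0 = u \<and> arrs s ''M'' (Suc 0) = v"
  shows "holds_root s r"
  unfolding holds_root_def using bits_cong[OF assms(2) assms(1)] assms(3) by blast

lemma final_succ:
  assumes h: "holds_root s (u, x, v, y)" and c: "compact u x" "u \<le> m"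
  shows "holds_root (final w succ_code s) (case succ_compact u x of (u', x') \<Rightarrow> (u', x', v, y))"
    "vars (final w succ_code s) = vars s"
proof -
  have arr: "arrs s ''X'' 0 = x" "arrs s ''X'' (Suc 0) = y" "arrs s ''M'' 0 = u" "arrs s ''M'' (Suc 0) = v"
    and b: "bits (arrs s ''S'') (root_sets (u, x, v, y))"
    using h by (auto simp: holds_root_def)
  have x: "x \<le> u" using c by (auto simp: compact_def)
  have *: "holds_root (final w succ_code s) (case succ_compact u x of (u', x') \<Rightarrow> (u', x', v, y)) \<and>
    vars (final w succ_code s) = vars s"
  proof (cases "0 < x")
    case True
    have "final w succ_code s = set_elem ''S'' (x - 1 + (x - 1) + 0) 0 (set_elem ''X'' 0 (x - 1) (set_elem ''S'' (x + x + 0) 1 s))"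
      using True x c W W_pos arr by (simp add: succ_code_def final_put)
    moreover have "bits ((arrs s ''S'')(x + x + 0 := 1, x - 1 + (x - 1) + 0 := 0))
        ((root_sets (u, x, v, y))(0 := insert x (root_sets (u, x, v, y) 0) - {x - 1}))"
      using bits_remove[OF bits_insert[OF b, of 0 x], of 0 "x - 1"] by simp
    ultimately show ?thesis using True x arr
      by (auto simp: succ_compact_def root_sets_def intro!: holds_root_bits)
  next
    case False
    have "final w succ_code s = set_elem ''S'' (u + 1 + (u + 1) + 0) 1 (set_elem ''M'' 0 (u + 1) (set_elem ''X'' 0 u (set_elem ''S'' (u + u + 0) 0 s)))"
      using False c W W_pos arr by (simp add: succ_code_def final_put)
    moreover have "bits ((arrs s ''S'')(u + u + 0 := 0, u + 1 + (u + 1) + 0 := 1))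
        ((root_sets (u, x, v, y))(0 := insert (u + 1) (root_sets (u, x, v, y) 0 - {u})))"
      using bits_insert[OF bits_remove[OF b, of 0 u], of 0 "u + 1"] by simp
    ultimately show ?thesis using False arr
      by (auto simp: succ_compact_def root_sets_def intro!: holds_root_bits)
  qed
  thus "holds_root (final w succ_code s) (case succ_compact u x of (u', x') \<Rightarrow> (u', x', v, y))"
    "vars (final w succ_code s) = vars s" by auto
qed

lemma final_shrink:
  assumes h: "holds_root s (u, x, v, y)" and c: "compact v y" "0 < v" "v \<le> m"
  shows "holds_root (final w shrink_code s) (u, x, v - 1, 0)" "vars (final w shrink_code s) = vars s"
proof -
  have arr: "arrs s ''X'' 0 = x" "arrs s ''X'' (Suc 0) = y" "arrs s ''M'' 0 = u" "arrs s ''M'' (Suc 0) = v"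
    and b: "bits (arrs s ''S'') (root_sets (u, x, v, y))"
    using h by (auto simp: holds_root_def)
  have y: "y < v" using c by (auto simp: compact_def)
  have fin: "final w shrink_code s = set_elem ''X'' 1 0 (set_elem ''M'' 1 (v - 1) (set_elem ''S'' (v + v + 1) 0 (set_elem ''S'' (y + y + 1) 1 s)))"
    using y c W W_pos arr by (simp add: shrink_code_def final_put)
  have bit: "bits ((arrs s ''S'')(y + y + 1 := 1, v + v + 1 := 0))
        ((root_sets (u, x, v, y))(1 := insert y (root_sets (u, x, v, y) 1) - {v}))"
    using bits_remove[OF bits_insert[OF b, of 1 y], of 1 v] by simp
  show "holds_root (final w shrink_code s) (u, x, v - 1, 0)" "vars (final w shrink_code s) = vars s"
  proof -
    have "i \<in> insert y ({1..v} - {y}) - {v} \<longleftrightarrow> i \<in> {1..v - 1} - {0}" if "1 \<le> i" for i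
      using that y by auto
    note shrunk = this
    have "bits ((arrs s ''S'')(y + y + 1 := 1, v + v + 1 := 0)) (root_sets (u, x, v - 1, 0))"
    proof (rule bits_cong[OF _ bit])
      fix t i :: nat assume "t < 2" "1 \<le> i"
      hence "t = 0 \<or> t = 1" by auto
      thus "i \<in> ((root_sets (u, x, v, y))(1 := insert y (root_sets (u, x, v, y) 1) - {v})) t
          \<longleftrightarrow> i \<in> root_sets (u, x, v - 1, 0) t"
        using shrunk[OF \<open>1 \<le> i\<close>] by (elim disjE) (simp_all add: root_sets_def)
    qed
    thus "holds_root (final w shrink_code s) (u, x, v - 1, 0)"
      using arr by (simp add: holds_root_def fin)
    show "vars (final w shrink_code s) = vars s" by (simp add: fin)
  qed
qed

lemma final_pred:
  assumes h: "holds_root s (u, x, v, y)" and c: "compact v y" "0 < v" "v \<le> m"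
  shows "holds_root (final w pred_code s) (case pred_compact v y of (v', y') \<Rightarrow> (u, x, v', y'))"
    "vars (final w pred_code s) = vars s"
proof -
  have arr: "arrs s ''X'' 0 = x" "arrs s ''X'' (Suc 0) = y" "arrs s ''M'' 0 = u" "arrs s ''M'' (Suc 0) = v"
    and b: "bits (arrs s ''S'') (root_sets (u, x, v, y))"
    using h by (auto simp: holds_root_def)
  have y: "y < v" using c by (auto simp: compact_def)
  have *: "holds_root (final w pred_code s) (case pred_compact v y of (v', y') \<Rightarrow> (u, x, v', y')) \<and>
    vars (final w pred_code s) = vars s"
  proof (cases "y + 1 < v")
    case True
    have "final w pred_code s = set_elem ''S'' (y + 1 + (y + 1) + 1) 0 (set_elem ''X'' 1 (y + 1) (set_elem ''S'' (y + y + 1) 1 s))"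
      using True c W W_pos arr by (simp add: pred_code_def final_put)
    moreover have "bits ((arrs s ''S'')(y + y + 1 := 1, y + 1 + (y + 1) + 1 := 0))
        ((root_sets (u, x, v, y))(1 := insert y (root_sets (u, x, v, y) 1) - {y + 1}))"
      using bits_remove[OF bits_insert[OF b, of 1 y], of 1 "y + 1"] by simp
    ultimately show ?thesis using True arr
      by (auto simp: pred_compact_def root_sets_def less_2_cases_iff intro!: holds_root_bits)
  next
    case False
    have "eval_expr w (Lt (Plus (AtX 1) (Const 1)) (AtM 1)) s = 0" using False y c W W_pos arr by simp
    hence "final w pred_code s = final w shrink_code s" by (simp add: pred_code_def)
    thus ?thesis using False final_shrink[OF h c] by (simp add: pred_compact_def)
  qed
  thus "holds_root (final w pred_code s) (case pred_compact v y of (v', y') \<Rightarrow> (u, x, v', y'))"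
    "vars (final w pred_code s) = vars s" by auto
qed

lemma final_shift:
  assumes h: "holds_root s (u, x, v, y)" and c: "compact u x" "u \<le> m + 1" and d: "vars s ''u'' = d" "0 < d" "d \<le> x"
  shows "holds_root (final w shift_code s) (u, x - d, v, y)" "vars (final w shift_code s) = vars s"
proof -
  have arr: "arrs s ''X'' 0 = x" "arrs s ''X'' (Suc 0) = y" "arrs s ''M'' 0 = u" "arrs s ''M'' (Suc 0) = v"
    and b: "bits (arrs s ''S'') (root_sets (u, x, v, y))"
    using h by (auto simp: holds_root_def)
  have x: "x \<le> u" using c by (auto simp: compact_def)
  have "final w shift_code s = set_elem ''S'' (x - d + (x - d) + 0) 0 (set_elem ''X'' 0 (x - d) (set_elem ''S'' (x + x + 0) 1 s))"
    using x c d W W_pos arr by (simp add: shift_code_def final_put)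
  moreover have "bits ((arrs s ''S'')(x + x + 0 := 1, x - d + (x - d) + 0 := 0))
        ((root_sets (u, x, v, y))(0 := insert x (root_sets (u, x, v, y) 0) - {x - d}))"
    using bits_remove[OF bits_insert[OF b, of 0 x], of 0 "x - d"] by simp
  ultimately show "holds_root (final w shift_code s) (u, x - d, v, y)" "vars (final w shift_code s) = vars s"
    using x d arr by (auto simp: root_sets_def intro!: holds_root_bits)
qed

lemma final_gap:
  assumes h: "holds_root s (u, x, v, y)" and c: "u \<le> m + 1" "v \<le> m + 1" and m: "vars s ''m'' = m"
  shows "holds m (final w (gap_code 1) (final w (gap_code 0) s)) (root_node (u, x, v, y))"
    "vars (final w (gap_code 1) (final w (gap_code 0) s)) = vars s"
proof -
  have arr: "arrs s ''X'' 0 = x" "arrs s ''X'' (Suc 0) = y" "arrs s ''M'' 0 = u" "arrs s ''M'' (Suc 0) = v"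
    and b: "bits (arrs s ''S'') (root_sets (u, x, v, y))"
    using h by (auto simp: holds_root_def)
  have "final w (gap_code 1) (final w (gap_code 0) s) = set_elem ''G'' 1 (low_gap v y) (set_elem ''G'' 0 (low_gap u x) s)"
    using arr c W W_pos by (simp add: gap_code_def low_gap_def)
  thus "holds m (final w (gap_code 1) (final w (gap_code 0) s)) (root_node (u, x, v, y))"
    "vars (final w (gap_code 1) (final w (gap_code 0) s)) = vars s"
    using arr b m by (simp_all add: holds_def root_node_def less_2_cases_iff root_sets_def)
qed

lemma final_next:
  assumes h: "holds m s (root_node r)" and r: "root_inv m K r" and K: "4 * K + 4 * m + 30 \<le> 2 ^ w"
    and P: "vars s ''P'' = root_weight r" "vars s ''K'' = K"
  defines "s' \<equiv> final w next_code s"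
  shows "case next_root m K r of None \<Rightarrow> vars s' ''o'' = 0
    | Some r' \<Rightarrow> holds m s' (root_node r') \<and> vars s' ''P'' = root_weight r' \<and> vars s' ''o'' = vars s ''o''"
    "same_vars {''n'', ''m'', ''K'', ''s'', ''d''} s s'"
proof -
  obtain u x v y where r_eq: "r = (u, x, v, y)" by (cases r)
  from r have c: "compact u x" "compact v y" "u + v \<le> m" and sum: "tri u - x + (tri v - y) = K"
    and half: "2 * root_weight r \<le> K" and rw: "root_weight r = tri u - x"
    by (auto simp: root_inv_def r_eq root_weight_def)
  have hr: "holds_root s r" and ms: "vars s ''m'' = m"
    using h by (auto simp: holds_def holds_root_def root_node_def r_eq root_sets_def)
  define P' where "P' = root_weight r + 1"
  have P'_eq: "P' = tri u - x + 1" by (simp only: P'_def rw)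
  define s1 where "s1 = set_var ''P'' P' s"
  have P': "P' + P' < 2 ^ w" "P' < 2 ^ w" using half K by (simp_all add: P'_def)
  have s1: "final w (Assign ''P'' (Plus (Var ''P'') (Const 1))) s = s1"
    using P P' W_pos by (simp add: s1_def P'_def)
  have vars1: "vars s1 ''P'' = P'" "vars s1 ''K'' = K" "vars s1 ''m'' = m" and hr1: "holds_root s1 (u, x, v, y)"
    using P ms hr by (simp_all add: s1_def holds_root_def r_eq)
  have ex: "eval_expr w exhausted t = of_bool (K < p + p)"
    if "vars t ''P'' = p" "vars t ''K'' = K" "p + p < 2 ^ w" for t p
    using that W_pos by (simp add: exhausted_def)
  have stop: "final w stop_code t = set_var ''o'' 0 t" for t by (simp add: stop_code_def)
  have *: "(case next_root m K r of None \<Rightarrow> vars s' ''o'' = 0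
    | Some r' \<Rightarrow> holds m s' (root_node r') \<and> vars s' ''P'' = root_weight r' \<and> vars s' ''o'' = vars s ''o'')
    \<and> same_vars {''n'', ''m'', ''K'', ''s'', ''d''} s s'"
  proof (cases "K < 2 * P'")
    case True
    have "s' = set_var ''o'' 0 s1"
      using True ex[OF vars1(1,2) P'(1)] unfolding s'_def next_code_def final.simps(4) s1 final.simps(5) stop by simp
    moreover have "next_root m K r = None" using True by (simp add: next_root_def r_eq P'_eq)
    ultimately show ?thesis by (simp add: same_vars_def s1_def)
  next
    case False
    have "0 < v" using sum half rw False by (cases v) (auto simp: P'_def)
    obtain u' x' where su: "succ_compact u x = (u', x')" by (cases "succ_compact u x")
    obtain v' y' where pr: "pred_compact v y = (v', y')" by (cases "pred_compact v y")
    have A: "compact u' x'" "tri u' - x' = P'" "u' \<le> u + 1"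
      using succ_compact[OF c(1) su] by (simp_all add: P'_def rw)
    have B: "compact v' y'" "tri v' - y' + 1 = tri v - y" "v' \<le> v"
      using pred_compact[OF c(2) \<open>0 < v\<close> pr] by simp_all
    have bounds: "u' \<le> m + 1" "v' \<le> m" "u \<le> m" "v \<le> m" using A(3) B(3) c(3) by auto
    define s2 where "s2 = final w succ_code s1"
    have s2: "holds_root s2 (u', x', v, y)" "vars s2 = vars s1"
      using final_succ[OF hr1 c(1) bounds(3)] su by (simp_all add: s2_def)
    define s3 where "s3 = final w pred_code s2"
    have s3: "holds_root s3 (u', x', v', y')" "vars s3 = vars s1"
      using final_pred[OF s2(1) c(2) \<open>0 < v\<close> bounds(4)] pr s2(2) by (simp_all add: s3_def)
    have nr: "next_root m K r = (if u' + v' \<le> m then Some (u', x', v', y') else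
        if x' < v' - y' \<or> K < 2 * (P' + (v' - y')) then None else Some (u', x' - (v' - y'), v' - 1, 0))"
      using False by (simp add: next_root_def r_eq P'_eq su pr)
    have arr3: "arrs s3 ''X'' 0 = x'" "arrs s3 ''X'' (Suc 0) = y'" "arrs s3 ''M'' 0 = u'" "arrs s3 ''M'' (Suc 0) = v'"
      using s3(1) by (auto simp: holds_root_def)
    have over: "eval_expr w (Lt (Var ''m'') (Plus (AtM 0) (AtM 1))) s3 = of_bool (m < u' + v')"
      using arr3 bounds W W_pos vars1(3) by (simp add: s3(2))
    define t where "t = (if m < u' + v' then final w skip_code s3 else s3)"
    have s': "s' = final w (gap_code 1) (final w (gap_code 0) t)"
      using False ex[OF vars1(1,2) P'(1)] over
      unfolding s'_def next_code_def block.simps final.simps(4) s1 final.simps(5) s2_def[symmetric] s3_def[symmetric] t_def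
      by simp
    have gapv: "vars (final w (gap_code i) z) = vars z" for i z by (simp add: gap_code_def)
    show ?thesis
    proof (cases "u' + v' \<le> m")
      case True
      hence t: "t = s3" by (simp add: t_def)
      have "holds m s' (root_node (u', x', v', y'))"
        unfolding s' t using final_gap(1)[OF s3(1)] bounds vars1(3) s3(2) by simp
      moreover have "vars s' = vars s1" unfolding s' t by (simp add: gapv s3(2))
      moreover have "root_weight (u', x', v', y') = P'" using A(2) by (simp add: root_weight_def)
      ultimately show ?thesis using True by (simp add: nr same_vars_def s1_def)
    next
      case big: False
      define d where "d = v' - y'"
      have "u' + v' = m + 1" using big A(3) B(3) c(3) by simp
      have K': "P' + (tri v' - y') = K" using B(2) sum by (simp add: P'_def rw)
      have "tri v' - y' \<noteq> 0" using K' False by (auto simp: P'_def)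
      hence "0 < v'" by (cases v') auto
      hence d: "0 < d" "d \<le> v'" using B(1) by (auto simp: d_def compact_def)
      define s4 where "s4 = set_var ''u'' d s3"
      have s4: "final w (Assign ''u'' (Minus (AtM 1) (AtX 1))) s3 = s4"
        using arr3 bounds W W_pos d(2) by (simp add: s4_def d_def)
      have lt: "eval_expr w (Lt (AtX 0) (Var ''u'')) s4 = of_bool (x' < d)"
        using arr3 W_pos by (simp add: s4_def)
      have t: "t = final w (If (Lt (AtX 0) (Var ''u'')) stop_code
       (Seq (Assign ''P'' (Plus (Var ''P'') (Var ''u''))) (If exhausted stop_code (Seq shrink_code shift_code)))) s4"
        unfolding t_def skip_code_def final.simps(4) s4 using big by simp
      show ?thesis
      proof (cases "x' < d")
        case True
        hence "vars t ''o'' = 0" "same_vars {''n'', ''m'', ''K'', ''s'', ''d''} s t"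
          unfolding t using lt stop by (simp_all add: same_vars_def s4_def s3(2) s1_def)
        thus ?thesis using True big by (simp add: nr d_def s' gapv same_vars_def)
      next
        case dx: False
        have Pd: "P' + d < 2 ^ w" "P' + d + (P' + d) < 2 ^ w"
          using half K bounds d(2) by (simp_all add: P'_def)
        define s5 where "s5 = set_var ''P'' (P' + d) s4"
        have s5: "final w (Assign ''P'' (Plus (Var ''P'') (Var ''u''))) s4 = s5"
          using Pd vars1 by (simp add: s5_def s4_def s3(2))
        have vars5: "vars s5 ''P'' = P' + d" "vars s5 ''K'' = K" "vars s5 ''u'' = d"
          using vars1 by (simp_all add: s5_def s4_def s3(2))
        have t: "t = final w (If exhausted stop_code (Seq shrink_code shift_code)) s5"
          using t dx lt s5 by simp
        have same5: "same_vars {''n'', ''m'', ''K'', ''s'', ''d''} s s5" "vars s5 ''o'' = vars s ''o''"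
          by (simp_all add: same_vars_def s5_def s4_def s3(2) s1_def)
        show ?thesis
        proof (cases "K < 2 * (P' + d)")
          case True
          hence "t = set_var ''o'' 0 s5" using t ex[OF vars5(1,2) Pd(2)] stop by simp
          thus ?thesis using True big same5 by (simp add: nr d_def s' gapv same_vars_def)
        next
          case fits: False
          hence t: "t = final w shift_code (final w shrink_code s5)" using t ex[OF vars5(1,2) Pd(2)] by simp
          have "holds_root s5 (u', x', v', y')" using s3(1) by (simp add: holds_root_def s5_def s4_def)
          note sh = final_shrink[OF this B(1) \<open>0 < v'\<close> bounds(2)]
          have "vars (final w shrink_code s5) ''u'' = d" using sh(2) vars5 by simp
          note sf = final_shift[OF sh(1) A(1) bounds(1) this d(1)]
          have tr: "holds_root t (u', x' - d, v' - 1, 0)" "vars t = vars s5"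
            using sf sh(2) dx by (simp_all add: t)
          have "vars t ''m'' = m" using tr(2) same5 ms by (simp add: same_vars_def)
          hence "holds m s' (root_node (u', x' - d, v' - 1, 0))"
            unfolding s' using final_gap(1)[OF tr(1)] bounds by simp
          moreover have "vars s' = vars s5" unfolding s' by (simp add: gapv tr(2))
          moreover have "root_weight (u', x' - d, v' - 1, 0) = P' + d"
            using A(2) compact_le_tri[OF A(1)] dx by (simp add: root_weight_def)
          moreover have "next_root m K r = Some (u', x' - d, v' - 1, 0)"
            using big dx fits by (simp add: nr d_def)
          ultimately show ?thesis using same5 vars5(1) by (simp add: same_vars_def)
        qed
      qed
    qed
  qed
  thus "case next_root m K r of None \<Rightarrow> vars s' ''o'' = 0
    | Some r' \<Rightarrow> holds m s' (root_node r') \<and> vars s' ''P'' = root_weight r' \<and> vars s' ''o'' = vars s ''o''"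
    "same_vars {''n'', ''m'', ''K'', ''s'', ''d''} s s'" by auto
qed

lemma root_step:
  assumes h: "holds m s (root_node r)" and r: "root_inv m K r" and K: "4 * K + 4 * m + 30 \<le> 2 ^ w"
    and depth: "2 * m ^ 3 + 1 < 2 ^ w"
    and P: "vars s ''P'' = root_weight r" "vars s ''K'' = K"
    and io: "vars s ''s'' = 0" "vars s ''n'' = n" "vars s ''d'' = 0" "vars s ''o'' = 1"
  shows "\<exists>s' out. iterates w (Var ''o'') root_body s out (root_cost * length (root_subtree m r)) s' \<and>
    list_all2 (shows_pair n) out (generation m K r) \<and> same_vars {''n'', ''K'', ''s'', ''d''} s s' \<and>
    (case next_root m K r of None \<Rightarrow> vars s' ''o'' = 0
      | Some r' \<Rightarrow> holds m s' (root_node r') \<and> vars s' ''P'' = root_weight r' \<and> vars s' ''o'' = 1)"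
proof -
  let ?v = "root_node r" and ?b = "2 * root_weight r < K"
  have half: "2 * root_weight r \<le> K" using r by (auto simp: root_inv_def root_weight_def)
  have p: "proper m ?v" using r by (auto simp: root_inv_def intro!: proper_root_node)
  hence en: "enough m (2 * m ^ 3) ?v" by (simp add: enough_def)
  define s1 where "s1 = set_var ''c'' 0 (set_var ''z'' (of_bool ?b) s)"
  have z: "eval_expr w (Lt (Plus (Var ''P'') (Var ''P'')) (Var ''K'')) s = of_bool ?b"
    using P half K W_pos by (simp add: mult_2)
  have io1: "vars s1 ''s'' = 0" "vars s1 ''n'' = n" "vars s1 ''z'' = of_bool ?b" "vars s1 ''c'' = 0" "vars s1 ''d'' = 0"
    using io by (simp_all add: s1_def)
  have h1: "holds m s1 ?v" using h by (simp add: s1_def holds_def split: prod.splits)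
  have fin1: "final w prepare_code s = s1" "outputs w prepare_code s = outputs w visit_code s1"
  proof -
    have "final w (Assign ''c'' (Const 0)) (final w (Assign ''z'' (Lt (Plus (Var ''P'') (Var ''P'')) (Var ''K''))) s) = s1"
      unfolding final.simps(2) z s1_def by simp
    thus "final w prepare_code s = s1" "outputs w prepare_code s = outputs w visit_code s1"
      unfolding prepare_code_def block.simps final.simps(4) outputs.simps(1)
      by (simp_all only: final_visit[OF io1(1)] outputs.simps append_Nil)
  qed
  obtain t1 where t1: "t1 \<le> cost prepare_code" "exec w prepare_code s (outputs w visit_code s1) t1 s1"
    using exec_loop_free[OF loop_free_root(1), of w s] unfolding fin1 by blast
  let ?N = "nodes_from m (2 * m ^ 3) 0 ?v"
  obtain s2 out2 where s2: "iterates w walk_guard walk_body s1 out2 (walk_cost * (8 - 0 + 10 * length ?N)) s2"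
    "holds m s2 ?v" "vars s2 ''c'' = 8" "vars s2 ''d'' = 0" "frame 0 s1 s2"
    "list_all2 (shows_pair n) out2 (concat (map (\<lambda>u. visits_if ?b (sets u)) ?N))"
    using walk[OF en h1 io1(4) _ io1(5) _ io1(1,2,3)] depth by auto
  obtain t2 where t2: "t2 \<le> walk_cost * (8 - 0 + 10 * length ?N) + 1 + expr_cost walk_guard"
    "exec w (While walk_guard walk_body) s1 out2 t2 s2"
    using exec_iterates[OF s2(1) guard_stop[OF s2(3,4)]] by blast
  define s3 where "s3 = final w next_code s2"
  obtain t3 where t3: "t3 \<le> cost next_code" "exec w next_code s2 [] t3 s3"
    using exec_loop_free[OF loop_free_root(2), of w s2] outputs_visit_free[OF visit_free_next, of w s2]
    unfolding s3_def by auto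
  have same: "vars s2 ''P'' = root_weight r" "vars s2 ''K'' = K" "vars s2 ''n'' = vars s ''n''" "vars s2 ''s'' = vars s ''s''"
    using s2(5) P by (simp_all add: frame_def s1_def)
  have o2: "vars s2 ''o'' = 1" using s2(5) io(4) by (simp add: frame_def s1_def)
  note nx = final_next[OF s2(2) r K same(1,2), folded s3_def]
  have "exec w root_body s (outputs w visit_code s1 @ out2 @ []) (t1 + (t2 + t3)) s3"
    unfolding root_body_def block.simps by (rule exec.Seq[OF t1(2) exec.Seq[OF t2(2) t3(2)]])
  hence "iterates w (Var ''o'') root_body s (outputs w visit_code s1 @ out2) (1 + expr_cost (Var ''o'') + (t1 + (t2 + t3))) s3"
    using iterates_once[of w "Var ''o''" s root_body _ _ s3 "1 + expr_cost (Var ''o'') + (t1 + (t2 + t3))"] io(4)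
    by simp
  moreover have nodes: "root_subtree m r = ?v # ?N"
    unfolding root_subtree_def by (rule subtree_nodes_from[OF en])
  have "1 + expr_cost (Var ''o'') + (t1 + (t2 + t3)) \<le> root_cost * length (root_subtree m r)"
  proof -
    have "1 + expr_cost (Var ''o'') + (t1 + (t2 + t3)) \<le> root_cost + walk_cost * 10 * length ?N"
      using t1(1) t2(1) t3(1) by (simp add: root_cost_def algebra_simps)
    also have "\<dots> \<le> root_cost + root_cost * length ?N"
      by (intro add_left_mono mult_le_mono1) (simp add: root_cost_def)
    finally show ?thesis by (simp add: nodes)
  qed
  ultimately have "iterates w (Var ''o'') root_body s (outputs w visit_code s1 @ out2) (root_cost * length (root_subtree m r)) s3"
    using iterates_mono by blast
  moreover have "generation m K r = visits_if ?b (sets ?v) @ concat (map (\<lambda>u. visits_if ?b (sets u)) ?N)"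
    unfolding generation_def nodes visits_def visits_if_def by simp
  hence "list_all2 (shows_pair n) (outputs w visit_code s1 @ out2) (generation m K r)"
    using outputs_visit[OF h1 io1(1-3)] s2(6) by (simp add: list_all2_appendI)
  moreover have "same_vars {''n'', ''K'', ''s'', ''d''} s s3"
    using nx(2) same P io(3) s2(4) by (simp add: same_vars_def)
  ultimately show ?thesis using nx(1)[unfolded o2] by blast
qed

text \<open>Every node yields at least one output, so time charged to nodes may be charged to
  outputs.\<close>

lemma length_generation: "length (root_subtree m r) \<le> length (generation m K r)"
proof -
  have "length vs \<le> length (concat (map (visits K r) vs))" for vs
    by (induction vs) (auto simp: visits_def)
  thus ?thesis by (simp add: generation_def)
qed

lemma all_roots:
  assumes "holds m s (root_node r)" "root_inv m K r" "4 * K + 4 * m + 30 \<le> 2 ^ w" "2 * m ^ 3 + 1 < 2 ^ w"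
    "vars s ''P'' = root_weight r" "vars s ''K'' = K" "vars s ''s'' = 0" "vars s ''n'' = n" "vars s ''d'' = 0" "vars s ''o'' = 1"
    "K \<le> root_weight r + f"
  shows "\<exists>s' out. iterates w (Var ''o'') root_body s out
      (root_cost * length (concat (map (generation m K) (roots m K f r)))) s' \<and>
    list_all2 (shows_pair n) out (concat (map (generation m K) (roots m K f r))) \<and> vars s' ''o'' = 0"
  using assms
proof (induction f arbitrary: s r)
  case (0 s r)
  have "2 * root_weight r \<le> K" using 0(2) by (auto simp: root_inv_def root_weight_def)
  \<comment> \<open>Here \<open>2 * root_weight r \<le> K \<le> root_weight r\<close>, so the list
    of roots ends at once.\<close>
  hence "K = 0" "root_weight r = 0" using 0(11) by auto
  hence none: "next_root m K r = None"
    by (cases r) (simp add: next_root_def root_weight_def)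
  obtain s' out where s': "iterates w (Var ''o'') root_body s out (root_cost * length (root_subtree m r)) s'"
    "list_all2 (shows_pair n) out (generation m K r)" "vars s' ''o'' = 0"
    using root_step[OF 0(1-10)] none by auto
  thus ?case using length_generation[of r K]
    by (intro exI[of _ s'] exI[of _ out]) (auto intro: iterates_mono)
next
  case (Suc f s r)
  obtain s' out where s': "iterates w (Var ''o'') root_body s out (root_cost * length (root_subtree m r)) s'"
    "list_all2 (shows_pair n) out (generation m K r)" "same_vars {''n'', ''K'', ''s'', ''d''} s s'"
    "case next_root m K r of None \<Rightarrow> vars s' ''o'' = 0
      | Some r' \<Rightarrow> holds m s' (root_node r') \<and> vars s' ''P'' = root_weight r' \<and> vars s' ''o'' = 1"
    using root_step[OF Suc.prems(1-10)] by blast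
  have it: "iterates w (Var ''o'') root_body s out (root_cost * length (generation m K r)) s'"
    using s'(1) length_generation[of r K] by (auto intro: iterates_mono)
  show ?case
  proof (cases "next_root m K r")
    case None
    thus ?thesis using it s' by (intro exI[of _ s'] exI[of _ out]) simp
  next
    case (Some r')
    with next_root[OF Suc.prems(2)] have r': "root_inv m K r'" "root_weight r < root_weight r'" by auto
    have "K \<le> root_weight r' + f" using r'(2) Suc.prems(11) by simp
    moreover have "vars s' ''K'' = K" "vars s' ''s'' = 0" "vars s' ''n'' = n" "vars s' ''d'' = 0"
      using s'(3) Suc.prems(6-9) by (simp_all add: same_vars_def)
    ultimately obtain s'' out' where s'': "iterates w (Var ''o'') root_body s' out'
        (root_cost * length (concat (map (generation m K) (roots m K f r')))) s''"
      "list_all2 (shows_pair n) out' (concat (map (generation m K) (roots m K f r')))" "vars s'' ''o'' = 0"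
      using Suc.IH[of s' r'] s'(4) Some r'(1) Suc.prems(3,4) by auto
    have "iterates w (Var ''o'') root_body s (out @ out')
        (root_cost * length (generation m K r) + root_cost * length (concat (map (generation m K) (roots m K f r')))) s''"
      by (rule iterates_trans[OF it s''(1)])
    thus ?thesis using Some s'(2) s''(2,3)
      by (intro exI[of _ s''] exI[of _ "out @ out'"]) (simp add: algebra_simps list_all2_appendI)
  qed
qed

end


section \<open>The generator\<close>

text \<open>For odd \<open>n\<close> the target weight is the complement of \<open>k\<close>. If
  \<open>k\<close> exceeds the number of dominoes, the flag \<open>o\<close> stays 0 and the main
  loop is never entered.\<close>

definition setup_code :: com where
  "setup_code = block [Assign ''m'' (Minus (Var ''n'') (Const 2)),
     If (Odd (Var ''n''))
       (Seq (Assign ''u'' (Op Quot (Op Mul (Var ''n'') (Minus (Var ''n'') (Const 1))) (Const 2)))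
         (If (Lt (Var ''u'') (Var ''k'')) Skip
           (Seq (Assign ''K'' (Minus (Var ''u'') (Var ''k''))) (Assign ''o'' (Const 1)))))
       (Seq (Assign ''K'' (Var ''k'')) (Assign ''o'' (Const 1)))]"

definition fill_guard :: expr where
  "fill_guard = Op Mul (Lt (Var ''r'') (Var ''K'')) (Lt (Var ''i'') (Var ''m''))"

definition fill_body :: com where
  "fill_body = block [Assign ''i'' (Plus (Var ''i'') (Const 1)), Assign ''r'' (Plus (Var ''r'') (Var ''i'')),
     put (Var ''i'') 1 1]"

definition finish_code :: com where
  "finish_code = If (Lt (Var ''r'') (Var ''K'')) stop_code
     (block [Store ''X'' (Const 1) (Minus (Var ''r'') (Var ''K'')), put (AtX 1) 1 0,
       Store ''M'' (Const 1) (Var ''i''), gap_code 0, gap_code 1])"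

definition generator :: com where
  "generator = block [setup_code, If (Var ''o'') (Seq (While fill_guard fill_body) finish_code) Skip,
     While (Var ''o'') root_body]"

definition fill_cost :: nat where
  "fill_cost = 1 + expr_cost fill_guard + cost fill_body"

definition filled :: "state \<Rightarrow> nat \<Rightarrow> bool" where
  "filled s i \<longleftrightarrow> vars s ''i'' = i \<and> vars s ''r'' = tri i \<and> arrs s ''X'' = (\<lambda>_. 0) \<and> arrs s ''M'' = (\<lambda>_. 0) \<and>
     bits (arrs s ''S'') (\<lambda>t. if t = 0 then {} else {1..i})"

context machine
begin

text \<open>Elements are added to the second set until its sum reaches \<open>K\<close>, which is
  the linear part of the initialization. The bound \<open>m\<close> ends the loop when
  \<open>K\<close> is out of reach.\<close>

lemma fill:
  assumes "filled s i" "i \<le> m" "i = 0 \<or> tri (i - 1) < K" "vars s ''K'' = K" "vars s ''m'' = m"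
    and T: "tri m + m + 2 < 2 ^ w"
  shows "\<exists>s' i'. iterates w fill_guard fill_body s [] (fill_cost * (m - i)) s' \<and> filled s' i' \<and> i' \<le> m \<and>
    (i' = 0 \<or> tri (i' - 1) < K) \<and> (K \<le> tri i' \<or> i' = m) \<and>
    same_vars {''n'', ''m'', ''K'', ''P'', ''s'', ''d'', ''o''} s s'"
  using assms(1-5)
proof (induction "m - i" arbitrary: s i)
  case 0
  thus ?case using iterates_refl by (intro exI[of _ s] exI[of _ i]) (auto simp: same_vars_def)
next
  case (Suc j)
  show ?case
  proof (cases "K \<le> tri i")
    case True
    thus ?thesis using Suc.prems iterates_mono[OF iterates_refl]
      by (intro exI[of _ s] exI[of _ i]) (auto simp: same_vars_def)
  next
    case False
    have i: "i < m" using Suc.hyps(2) by simp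
    have bnd: "tri i + (i + 1) < 2 ^ w" "i + 1 < 2 ^ w" using T tri_mono[of i m] i by simp_all
    have st: "vars s ''i'' = i" "vars s ''r'' = tri i" and b: "bits (arrs s ''S'') (\<lambda>t. if t = 0 then {} else {1..i})"
      using Suc.prems(1) by (simp_all add: filled_def)
    have guard: "eval_expr w fill_guard s \<noteq> 0"
      using False i st Suc.prems(4,5) W_pos by (simp add: fill_guard_def)
    define s1 where "s1 = set_elem ''S'' (i + 1 + (i + 1) + 1) 1 (set_var ''r'' (tri i + (i + 1)) (set_var ''i'' (i + 1) s))"
    have "final w fill_body s = s1"
      using st bnd i W_pos by (simp add: fill_body_def final_put s1_def)
    moreover have "outputs w fill_body s = []" "loop_free fill_body"
      by (simp_all add: fill_body_def put_def)
    ultimately have it: "iterates w fill_guard fill_body s [] fill_cost s1"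
      using iterates_body[OF guard, of fill_body] by (simp add: fill_cost_def)
    have "bits ((arrs s ''S'')(i + 1 + (i + 1) + 1 := 1)) (\<lambda>t. if t = 0 then {} else {1..Suc i})"
      by (rule bits_cong[OF _ bits_insert[OF b, of 1 "i + 1"]]) (auto simp: less_2_cases_iff)
    hence f1: "filled s1 (i + 1)" using Suc.prems(1) by (simp add: filled_def s1_def)
    have "j = m - (i + 1)" using Suc.hyps(2) by simp
    moreover have "vars s1 ''K'' = K" "vars s1 ''m'' = m" using Suc.prems(4,5) by (simp_all add: s1_def)
    ultimately obtain s' i' where s': "iterates w fill_guard fill_body s1 [] (fill_cost * (m - (i + 1))) s'" "filled s' i'" "i' \<le> m"
      "i' = 0 \<or> tri (i' - 1) < K" "K \<le> tri i' \<or> i' = m" "same_vars {''n'', ''m'', ''K'', ''P'', ''s'', ''d'', ''o''} s1 s'"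
      using Suc.hyps(1)[of "i + 1" s1] f1 i False by (auto simp: Suc_le_eq)
    have "m - i = Suc (m - (i + 1))" using i by simp
    hence "iterates w fill_guard fill_body s [] (fill_cost * (m - i)) s'"
      using iterates_trans[OF it s'(1)] by simp
    moreover have "same_vars {''n'', ''m'', ''K'', ''P'', ''s'', ''d'', ''o''} s s'"
      using s'(6) by (simp add: same_vars_def s1_def)
    ultimately show ?thesis using s' by blast
  qed
qed

text \<open>Minimality of \<open>i\<close> makes the surplus \<open>tri i - K\<close> smaller than
  \<open>i\<close> unless both are 0. Removing this one number gives the compact set of weight
  \<open>K\<close>, and the first set of the initial root is empty.\<close>

lemma final_finish:
  assumes f: "filled s i" and i: "i \<le> m" "tri i < 2 ^ w" and K: "vars s ''K'' = K" and ms: "vars s ''m'' = m"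
    and c: "i = 0 \<or> tri (i - 1) < K" "K \<le> tri i"
  shows "compact i (tri i - K)" "holds m (final w finish_code s) (root_node (0, 0, i, tri i - K))"
    "vars (final w finish_code s) = vars s"
proof -
  have x: "tri i - K \<le> i" and cx: "compact i (tri i - K)"
    using c by (cases i; auto simp: compact_def)+
  show "compact i (tri i - K)" by (rule cx)
  have st: "vars s ''i'' = i" "vars s ''r'' = tri i" "arrs s ''X'' = (\<lambda>_. 0)" "arrs s ''M'' = (\<lambda>_. 0)"
    and b: "bits (arrs s ''S'') (\<lambda>t. if t = 0 then {} else {1..i})"
    using f by (simp_all add: filled_def)
  define x where "x = tri i - K"
  define s1 where "s1 = set_elem ''M'' 1 i (set_elem ''S'' (x + x + 1) 0 (set_elem ''X'' 1 x s))"
  have "bits ((arrs s ''S'')(x + x + 1 := 0)) (root_sets (0, 0, i, x))"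
    by (rule bits_cong[OF _ bits_remove[OF b, of 1 x]]) (auto simp: less_2_cases_iff root_sets_def)
  hence h1: "holds_root s1 (0, 0, i, x)" using st by (simp add: holds_root_def s1_def)
  have lt: "eval_expr w (Lt (Var ''r'') (Var ''K'')) s = 0" using st K c(2) by simp
  have "final w finish_code s = final w (gap_code 1) (final w (gap_code 0) s1)"
  proof -
    have 1: "final w (Store ''X'' (Const 1) (Minus (Var ''r'') (Var ''K''))) s = set_elem ''X'' 1 x s"
      using st K i W_pos by (simp add: x_def)
    have 2: "final w (put (AtX 1) 1 0) (set_elem ''X'' 1 x s) = set_elem ''S'' (x + x + 1) 0 (set_elem ''X'' 1 x s)"
      using W_pos \<open>tri i - K \<le> i\<close> i by (intro final_put) (simp_all add: x_def)
    have 3: "final w (Store ''M'' (Const 1) (Var ''i'')) (set_elem ''S'' (x + x + 1) 0 (set_elem ''X'' 1 x s)) = s1"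
      using st W_pos by (simp add: s1_def)
    show ?thesis
      unfolding finish_code_def block.simps final.simps(5) lt unfolding final.simps(4) 1 2 3 by simp
  qed
  with final_gap[OF h1] i ms st
  show "holds m (final w finish_code s) (root_node (0, 0, i, tri i - K))" "vars (final w finish_code s) = vars s"
    by (simp_all add: s1_def x_def)
qed

end

section \<open>Assembly of the generator\<close>

definition target :: "nat \<Rightarrow> nat \<Rightarrow> nat option" where
  "target n k = (if even n then Some k else if k \<le> n * (n - 1) div 2 then Some (n * (n - 1) div 2 - k) else None)"

lemma V_target:
  assumes "1 \<le> n"
  shows "V n k = (case target n k of None \<Rightarrow> {} | Some K \<Rightarrow> tiling n ` {P \<in> flip_pairs (n - 2). flip_weight P = K})"
  unfolding V_eq_tilings[OF assms] target_def by (auto intro!: image_eqI)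

lemma final_setup:
  assumes "n + k + 5 < 2 ^ w" "n * n < 2 ^ w" "0 < w" "3 < (2::nat) ^ w"
  defines "s \<equiv> final w setup_code (input_state n k)"
  shows "case target n k of None \<Rightarrow> vars s ''o'' = 0 | Some K \<Rightarrow> vars s ''o'' = 1 \<and> vars s ''K'' = K"
    "vars s ''m'' = n - 2" "vars s ''n'' = n" "vars s ''P'' = 0" "vars s ''s'' = 0" "vars s ''d'' = 0" "filled s 0"
proof -
  have "n * (n - Suc 0) < 2 ^ w" using assms(2) by (metis diff_le_self le_less_trans mult_le_mono2)
  moreover have "n * (n - Suc 0) div 2 < 2 ^ w" using calculation by linarith
  moreover have "n mod 2 < 2 ^ w" using assms(4) by (metis less_trans mod_less_divisor numeral_2_eq_2 zero_less_Suc lessI numeral_3_eq_3)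
  moreover have "n * (n - Suc 0) div 2 - k < 2 ^ w" using calculation by linarith
  moreover have "n - Suc 0 < 2 ^ w" using assms(1) by linarith
  moreover have "bits (\<lambda>_. 0) (\<lambda>t. if t = 0 then {} else {1..0})" by (simp add: bits_def)
  ultimately show "case target n k of None \<Rightarrow> vars s ''o'' = 0 | Some K \<Rightarrow> vars s ''o'' = 1 \<and> vars s ''K'' = K"
    "vars s ''m'' = n - 2" "vars s ''n'' = n" "vars s ''P'' = 0" "vars s ''s'' = 0" "vars s ''d'' = 0" "filled s 0"
    using assms(1-4) unfolding s_def
    by (auto simp: setup_code_def Odd_def input_state_def target_def filled_def even_iff_mod_2_eq_zero not_less)
qed

definition start_cost :: nat where
  "start_cost = cost setup_code + 10 + expr_cost fill_guard + cost finish_code"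

lemma generator_correct:
  assumes n: "1 \<le> n" and B: "4 * n + 30 \<le> 2 ^ w" "n + k + 5 < 2 ^ w" "n * n < 2 ^ w" "2 * (n - 2) ^ 3 + 1 < 2 ^ w"
    "4 * tri (n - 2) + 4 * n + 30 \<le> 2 ^ w"
  shows "\<exists>out s' L t. exec w generator (input_state n k) out t s' \<and> t \<le> start_cost + fill_cost * n + root_cost * length L \<and>
    distinct L \<and> list_all2 (shows_pair n) out L \<and> set L \<subseteq> flip_pairs (n - 2) \<and> tiling n ` set L = V n k"
proof -
  define m where "m = n - 2"
  interpret machine w m using B(1) by unfold_locales (simp add: m_def)
  have "3 < (2::nat) ^ w" using W_pos(1) by simp
  note raw = final_setup[OF B(2,3) W_pos(2) this]
  define s0 where "s0 = input_state n k"
  define s1 where "s1 = final w setup_code s0"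
  have set: "case target n k of None \<Rightarrow> vars s1 ''o'' = 0 | Some K \<Rightarrow> vars s1 ''o'' = 1 \<and> vars s1 ''K'' = K"
    "vars s1 ''m'' = m" "vars s1 ''n'' = n" "vars s1 ''P'' = 0" "vars s1 ''s'' = 0" "vars s1 ''d'' = 0" "filled s1 0"
    unfolding s1_def s0_def m_def by (rule raw)+
  obtain t1 where t1: "t1 \<le> cost setup_code" "exec w setup_code s0 [] t1 s1"
  proof -
    have "loop_free setup_code" "visit_free setup_code" by (simp_all add: setup_code_def)
    thus ?thesis using that exec_loop_free[of setup_code w s0] outputs_visit_free[of setup_code w s0]
      unfolding s1_def by auto
  qed
  let ?loop = "While (Var ''o'') root_body"
  \<comment> \<open>Common end of the two cases without output, an undefined target and a target
    above \<open>tri m\<close>: the main loop is left after 2 steps.\<close>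
  have empty: "\<exists>out s' L t. exec w generator s0 out t s' \<and> t \<le> start_cost + fill_cost * n + root_cost * length L \<and>
    distinct L \<and> list_all2 (shows_pair n) out L \<and> set L \<subseteq> flip_pairs (n - 2) \<and> tiling n ` set L = V n k"
    if "exec w (If (Var ''o'') (Seq (While fill_guard fill_body) finish_code) Skip) s1 [] t2 s2" "vars s2 ''o'' = 0"
      "V n k = {}" "t1 + (t2 + 2) \<le> start_cost + fill_cost * n" for t2 s2
  proof -
    have "exec w ?loop s2 [] 2 s2" using exec.WhileFalse[of w "Var ''o''" s2 root_body] that(2) by (simp add: numeral_2_eq_2)
    from exec.Seq[OF t1(2) exec.Seq[OF that(1) this]]
    have "exec w generator s0 [] (t1 + (t2 + 2)) s2" by (simp add: generator_def)
    thus ?thesis using that(3,4) by (intro exI[of _ "[]"] exI[of _ s2] exI[of _ "t1 + (t2 + 2)"]) simp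
  qed
  show ?thesis
  proof (cases "target n k")
    case None
    have "exec w (If (Var ''o'') (Seq (While fill_guard fill_body) finish_code) Skip) s1 [] 3 s1"
      using exec.IfFalse[OF _ exec.Skip, of w "Var ''o''" s1] set(1) None by (simp add: numeral_3_eq_3)
    thus ?thesis using empty[of 3 s1] set(1) None V_target[OF n] t1(1) by (simp add: start_cost_def s0_def)
  next
    case (Some K)
    have s1: "vars s1 ''o'' = 1" "vars s1 ''K'' = K" using set(1) Some by simp_all
    have tm: "tri m + m + 2 < 2 ^ w" using B(5) by (simp add: m_def)
    obtain s2 i where s2: "iterates w fill_guard fill_body s1 [] (fill_cost * (m - 0)) s2" "filled s2 i" "i \<le> m"
      "i = 0 \<or> tri (i - 1) < K" "K \<le> tri i \<or> i = m" "same_vars {''n'', ''m'', ''K'', ''P'', ''s'', ''d'', ''o''} s1 s2"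
      using fill[OF set(7) _ _ s1(2) set(2) tm] by auto
    have v2: "vars s2 ''n'' = n" "vars s2 ''m'' = m" "vars s2 ''K'' = K" "vars s2 ''P'' = 0" "vars s2 ''s'' = 0"
      "vars s2 ''d'' = 0" "vars s2 ''o'' = 1"
      using s2(6) s1 set by (simp_all add: same_vars_def)
    have ir: "vars s2 ''i'' = i" "vars s2 ''r'' = tri i" using s2(2) by (simp_all add: filled_def)
    have "eval_expr w fill_guard s2 = 0" using s2(5) v2 ir by (auto simp: fill_guard_def)
    from exec_iterates[OF s2(1) this] obtain t2 where
      t2: "t2 \<le> fill_cost * m + 1 + expr_cost fill_guard" "exec w (While fill_guard fill_body) s1 [] t2 s2" by auto
    define s3 where "s3 = final w finish_code s2"
    obtain t3 where t3: "t3 \<le> cost finish_code" "exec w finish_code s2 [] t3 s3"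
    proof -
      have "loop_free finish_code" "visit_free finish_code"
        by (simp_all add: finish_code_def stop_code_def put_def gap_code_def)
      thus ?thesis using that exec_loop_free[of finish_code w s2] outputs_visit_free[of finish_code w s2]
        unfolding s3_def by auto
    qed
    have ex3: "exec w (If (Var ''o'') (Seq (While fill_guard fill_body) finish_code) Skip) s1 [] (2 + (t2 + t3)) s3"
      using exec.IfTrue[OF _ exec.Seq[OF t2(2) t3(2)], of "Var ''o''" Skip] s1(1) by simp
    have "fill_cost * m \<le> fill_cost * n" by (simp add: m_def)
    hence cost3: "t1 + (2 + (t2 + t3) + 2) \<le> start_cost + fill_cost * n"
      using t1(1) t2(1) t3(1) unfolding start_cost_def by linarith
    have Vk: "V n k = tiling n ` {P \<in> flip_pairs m. flip_weight P = K}"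
      using V_target[OF n] Some by (simp add: m_def)
    show ?thesis
    proof (cases "K \<le> tri i")
      case False
      hence "tri m < K" using s2(5) by auto
      hence "{P \<in> flip_pairs m. flip_weight P = K} = {}" using flip_weight_bound[of _ m] by fastforce
      hence "V n k = {}" using Vk by simp
      moreover have "vars s3 ''o'' = 0"
        using False v2 ir W_pos by (simp add: s3_def finish_code_def stop_code_def)
      ultimately show ?thesis using empty[OF ex3] cost3 unfolding s0_def by simp
    next
      case True
      have ti: "tri i \<le> tri m" by (rule tri_mono[OF s2(3)])
      have "tri i < 2 ^ w" using ti tm by simp
      note fin = final_finish[OF s2(2,3) this v2(3,2) s2(4) True, folded s3_def]
      let ?r = "(0, 0, i, tri i - K)"
      have Ki: "tri i - (tri i - K) = K" using True by simp
      have inv: "root_inv m K ?r" using fin(1) s2(3) Ki by (simp add: root_inv_def compact_def)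
      have KW: "4 * K + 4 * m + 30 \<le> 2 ^ w" using True ti B(5) by (simp add: m_def)
      let ?L = "concat (map (generation m K) (roots m K K ?r))"
      have rw: "root_weight ?r = 0" by (simp add: root_weight_def)
      obtain s4 out where s4: "iterates w (Var ''o'') root_body s3 out (root_cost * length ?L) s4"
        "list_all2 (shows_pair n) out ?L" "vars s4 ''o'' = 0"
        using all_roots[OF fin(2) inv KW _ _ _ _ _ _ _, of n K] B(4) v2 rw fin(3) by (auto simp: m_def)
      from s4(3) have "eval_expr w (Var ''o'') s4 = 0" by simp
      from exec_iterates[OF s4(1) this] obtain t4 where t4: "t4 \<le> root_cost * length ?L + 2"
        "exec w ?loop s3 out t4 s4" by auto
      have "exec w generator s0 out (t1 + (2 + (t2 + t3) + t4)) s4"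
        using exec.Seq[OF t1(2) exec.Seq[OF ex3 t4(2)]] by (simp add: generator_def)
      moreover have "t1 + (2 + (t2 + t3) + t4) \<le> start_cost + fill_cost * n + root_cost * length ?L"
        using cost3 t4(1) by simp
      moreover note gen = generate_all[OF fin(1) s2(3) Ki]
      ultimately show ?thesis
        using s4(2) Vk unfolding s0_def m_def[symmetric]
        by (intro exI[of _ out] exI[of _ s4] exI[of _ ?L] exI[of _ "t1 + (2 + (t2 + t3) + t4)"]) auto
    qed
  qed
qed

text \<open>All quantities are at most cubic in \<open>N\<close>, the stack height being the cubic
  one. The five remaining factors \<open>N \<ge> 3\<close> contribute \<open>3 ^ 5 = 243\<close>,
  which is enough for all constants.\<close>

lemma word_bounds:
  assumes n: "1 \<le> n" and W: "(n + k + 2) ^ 8 \<le> (2::nat) ^ w"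
  shows "4 * n + 30 \<le> 2 ^ w" "n + k + 5 < 2 ^ w" "n * n < 2 ^ w" "2 * (n - 2) ^ 3 + 1 < 2 ^ w"
    "4 * tri (n - 2) + 4 * n + 30 \<le> 2 ^ w"
proof -
  define N where "N = n + k + 2"
  have N: "3 \<le> N" "n \<le> N" "k \<le> N" using n by (simp_all add: N_def)
  have "(3::nat) ^ 5 \<le> N ^ 5" by (rule power_mono[OF N(1)]) simp
  hence "243 * N ^ 3 \<le> N ^ 5 * N ^ 3" by (intro mult_le_mono1) simp
  also have "\<dots> = N ^ 8" by (simp flip: power_add)
  finally have big: "243 * N ^ 3 \<le> 2 ^ w" using W by (simp add: N_def)
  have "(3::nat) ^ 3 \<le> N ^ 3" by (rule power_mono[OF N(1)]) simp
  hence c: "27 \<le> N ^ 3" by simp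
  have sq: "N ^ 2 \<le> N ^ 3" "N \<le> N ^ 3" using N(1) by (simp_all add: power_increasing self_le_power)
  have nn: "n * n \<le> N ^ 2" using N(2) by (simp add: power2_eq_square mult_le_mono)
  have cube: "(n - 2) ^ 3 \<le> N ^ 3" using N(2) by (intro power_mono) auto
  have "2 * tri (n - 2) \<le> n * n"
    unfolding double_tri using n by (intro mult_le_mono) auto
  with nn sq big c N cube show "4 * n + 30 \<le> 2 ^ w" "n + k + 5 < 2 ^ w" "n * n < 2 ^ w" "2 * (n - 2) ^ 3 + 1 < 2 ^ w"
    "4 * tri (n - 2) + 4 * n + 30 \<le> 2 ^ w"
    by linarith+
qed

theorem theorem1: "\<exists>p. CAT_algorithm p V"
proof (intro exI[of _ generator])
  let ?a = "start_cost + fill_cost" and ?b = root_cost and ?d = "cost lookup_code"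
  have "\<exists>t. generates w generator lookup_code ?d n k (V n k) t \<and> t \<le> ?a * n + ?b * card (V n k)"
    if n: "1 \<le> n" and W: "(n + k + 2) ^ 8 \<le> (2::nat) ^ w" for n k w
  proof -
    note bounds = word_bounds[OF n W]
    obtain out s' L t where ex: "exec w generator (input_state n k) out t s'"
      and t: "t \<le> start_cost + fill_cost * n + root_cost * length L" and L: "distinct L" "list_all2 (shows_pair n) out L"
      "set L \<subseteq> flip_pairs (n - 2)" "tiling n ` set L = V n k"
      using generator_correct[OF n bounds] by blast
    have inj: "inj_on (tiling n) (set L)" by (rule inj_on_subset[OF inj_on_tiling[OF n] L(3)])
    hence dist: "distinct (map (tiling n) L)" using L(1) by (simp add: distinct_map)
    have "4 * n + 8 \<le> 2 ^ w" using bounds(1) by simp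
    hence look: "represents w lookup_code ?d n s (tiling n P)" if "shows_pair n s P" "P \<in> set L" for s P
      using lookup_code n L(3) that by blast
    have "list_all2 (represents w lookup_code ?d n) out (map (tiling n) L)"
      unfolding list.rel_map using L(2) look by (auto intro: list.rel_mono_strong)
    hence gen: "generates w generator lookup_code ?d n k (V n k) t"
      unfolding generates_def using ex dist L(4)
      by (intro exI[of _ out] exI[of _ s'] exI[of _ "map (tiling n) L"]) simp
    have len: "card (V n k) = length L"
      using distinct_card[OF dist] L(4) by simp
    \<comment> \<open>The constant overhead goes into the linear term, since \<open>V n k\<close>
      may be empty.\<close>
    have "start_cost * 1 \<le> start_cost * n" by (rule mult_le_mono2[OF n])
    hence "t \<le> ?a * n + ?b * card (V n k)" using t unfolding len add_mult_distrib by linarith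
    with gen show ?thesis by blast
  qed
  thus "CAT_algorithm generator V" unfolding CAT_algorithm_def by blast
qed

end
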